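(* Let $k \geq 2$ be an integer. Then there exists $n_0 = n_0(k)$ such that for every integer $n \geq n_0$, Maker (whether he plays as the first or as the second player) has a strategy for winning the Maker-Breaker game $(E(K_n), \mathcal{C}_n^k)$ within at most $\lfloor kn/2 \rfloor + 1$ moves.
   Context: A Maker-Breaker (weak) game $(X,\mathcal{F})$ has a finite board $X$ and a family $\mathcal{F}\subseteq 2^X$ of winning sets. Two players, Maker and Breaker, alternately claim one previously unclaimed element of $X$ per turn. Maker wins as soon as he has claimed all elements of some $F\in\mathcal{F}$; if all elements of $X$ are claimed and Maker has not fully claimed any winning set, Breaker wins. "Winning within $t$ moves" means Maker fully claims a winning set after at most $t$ of his own moves. Here $K_n$ is the complete graph on $n$ vertices, and $\mathcal{C}_n^k$ is the family of edge sets of all $k$-vertex-connected subgraphs of $K_n$. *)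

theory Defs
  imports Main
begin

section \<open>Maker-Breaker games\<close>

datatype player = Maker | Breaker

text \<open>
  A position is the history of the game: the list of all elements claimed so far, in the order in
  which they were claimed. The parameter \<open>p\<close> is always the player who makes the first move.
\<close>

definition maker_turn :: "player \<Rightarrow> nat \<Rightarrow> bool" where
  "maker_turn p i \<longleftrightarrow> (case p of Maker \<Rightarrow> even i | Breaker \<Rightarrow> odd i)"

definition maker_claimed :: "player \<Rightarrow> 'a list \<Rightarrow> 'a set" where
  "maker_claimed p h = {h ! i | i. i < length h \<and> maker_turn p i}"

definition maker_moves :: "player \<Rightarrow> 'a list \<Rightarrow> nat" where
  "maker_moves p h = card {i. i < length h \<and> maker_turn p i}"

definition maker_has_won :: "player \<Rightarrow> 'a set set \<Rightarrow> 'a list \<Rightarrow> bool" where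
  "maker_has_won p \<F> h \<longleftrightarrow> (\<exists>F\<in>\<F>. F \<subseteq> maker_claimed p h)"

definition game_over :: "player \<Rightarrow> 'a set \<Rightarrow> 'a set set \<Rightarrow> 'a list \<Rightarrow> bool" where
  "game_over p X \<F> h \<longleftrightarrow> maker_has_won p \<F> h \<or> set h = X"

text \<open>
  The histories that can arise when Maker follows the strategy \<open>\<sigma>\<close>, which maps a history to the
  element Maker claims next, while Breaker claims arbitrary free elements.
\<close>

inductive play :: "player \<Rightarrow> 'a set \<Rightarrow> 'a set set \<Rightarrow> ('a list \<Rightarrow> 'a) \<Rightarrow> 'a list \<Rightarrow> bool"
  for p X \<F> \<sigma> where
  start: "play p X \<F> \<sigma> []"
| maker_move: "\<lbrakk>play p X \<F> \<sigma> h; \<not> game_over p X \<F> h; maker_turn p (length h);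
    \<sigma> h \<in> X - set h\<rbrakk> \<Longrightarrow> play p X \<F> \<sigma> (h @ [\<sigma> h])"
| breaker_move: "\<lbrakk>play p X \<F> \<sigma> h; \<not> game_over p X \<F> h; \<not> maker_turn p (length h);
    x \<in> X - set h\<rbrakk> \<Longrightarrow> play p X \<F> \<sigma> (h @ [x])"

text \<open>
  The first conjunct requires \<open>\<sigma>\<close> to offer a legal move whenever Maker has to move. On a
  finite board it guarantees that every play can be continued until the game is over, so that the
  second conjunct speaks about the end of every play.
\<close>

definition winning_strategy_within ::
    "player \<Rightarrow> 'a set \<Rightarrow> 'a set set \<Rightarrow> nat \<Rightarrow> ('a list \<Rightarrow> 'a) \<Rightarrow> bool" where
  "winning_strategy_within p X \<F> t \<sigma> \<longleftrightarrow>
     (\<forall>h. play p X \<F> \<sigma> h \<and> \<not> game_over p X \<F> h \<and> maker_turn p (length h) \<longrightarrow> \<sigma> h \<in> X - set h) \<and>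
     (\<forall>h. play p X \<F> \<sigma> h \<and> game_over p X \<F> h \<longrightarrow> maker_has_won p \<F> h \<and> maker_moves p h \<le> t)"

definition maker_wins_within :: "player \<Rightarrow> 'a set \<Rightarrow> 'a set set \<Rightarrow> nat \<Rightarrow> bool" where
  "maker_wins_within p X \<F> t \<longleftrightarrow> (\<exists>\<sigma>. winning_strategy_within p X \<F> t \<sigma>)"


section \<open>Graphs and vertex connectivity\<close>

text \<open>A simple graph is given by a vertex set \<open>V\<close> and a set \<open>E\<close> of two-element subsets of \<open>V\<close>.\<close>

definition complete_edges :: "'v set \<Rightarrow> 'v set set" where
  "complete_edges V = {e. e \<subseteq> V \<and> card e = 2}"

definition connected_graph :: "'v set \<Rightarrow> 'v set set \<Rightarrow> bool" where
  "connected_graph V E \<longleftrightarrow> V \<noteq> {} \<and> (\<forall>u\<in>V. \<forall>v\<in>V. (u, v) \<in> {(x, y). {x, y} \<in> E}\<^sup>*)"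

text \<open>The pair \<open>V - S\<close> and \<open>{e \<in> E. e \<inter> S = {}}\<close> is the graph with the vertices in \<open>S\<close> deleted.\<close>

definition vertex_connected :: "nat \<Rightarrow> 'v set \<Rightarrow> 'v set set \<Rightarrow> bool" where
  "vertex_connected k V E \<longleftrightarrow>
     card V > k \<and>
     (\<forall>S. S \<subseteq> V \<and> card S < k \<longrightarrow> connected_graph (V - S) {e \<in> E. e \<inter> S = {}})"

text \<open>
  The subgraphs are spanning: connectivity is required on the whole vertex set \<open>{..<n}\<close> of the
  complete graph, not only on the vertices covered by \<open>E\<close>.
\<close>

definition k_connected_family :: "nat \<Rightarrow> nat \<Rightarrow> nat set set set" where
  "k_connected_family n k =
     {E. E \<subseteq> complete_edges {..<n} \<and> vertex_connected k {..<n} E}"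

end

theory Submission
  imports Defs
begin

text \<open>
  A graph with minimum degree \<open>k\<close> on \<open>n\<close> vertices has at least \<open>kn/2\<close> edges, so all but the last one
  or two of Maker's edges have to join two vertices whose degree is still below \<open>k\<close>. For
  \<open>k \<ge> 3\<close> fix disjoint vertex sets \<open>W 0, \<dots>, W (k - 1)\<close> of equal size. Maker builds a spanning tree on
  each \<open>W j\<close> and gives every other vertex exactly one neighbour in each \<open>W j\<close>. If fewer than \<open>k\<close>
  vertices are deleted, some tree stays intact and is adjacent to all surviving vertices outside
  the trees, while a part of another tree has too many neighbours to be cut off. While Maker builds
  this graph he only has to rescue, before it is too late, the boundedly many vertices at which Breaker
  claims linearly many edges. The sizes are chosen such that finally a linear number of pairwise
  non-adjacent tree vertices lack one edge each, and it does not matter how they are joined to each other. Maker pairs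
  them up, preferring vertices of large degree in Breaker's graph, until at most two are left; these
  get an edge to an arbitrary vertex.

  For \<open>k = 2\<close> Maker merges paths into a Hamiltonian path by the same methods and adds two crossing
  chords at its ends.
\<close>

section \<open>Winning positions\<close>

text \<open>The budget has no slack, so a rescue must not waste a degree: its edge is always one
  that the final graph may contain anyway, and only its time is forced. Trees use average degree
  less than 2, which for \<open>k \<ge> 3\<close> leaves room for leaf edges and rescues; for
  \<open>k = 2\<close> there is none, and paths take over. The obstacle of the endgame is its last
  rounds, when Breaker must not have blocked all pairs. Each pair joined by Maker takes Breaker's
  edges at it out of the game while Breaker adds one; using vertices of large degree lowers the
  average step by step, until a matching and boundedly many edges are left. A matching with one
  extra edge can be maintained to the end. For \<open>k \<ge> 3\<close>, leftover vertices cost one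
  edge each instead of half an edge, whence the \<open>+ 1\<close> in the bound.\<close>

inductive mwins :: "'a set \<Rightarrow> ('a set \<Rightarrow> bool) \<Rightarrow> nat \<Rightarrow> 'a set \<Rightarrow> 'a set \<Rightarrow> bool"
  for X Win N where
  won: "Win M \<Longrightarrow> mwins X Win N M B"
| move: "\<lbrakk>e \<in> X; e \<notin> M; e \<notin> B; card M < N;
    \<And>f. \<lbrakk>f \<in> X; f \<notin> insert e M; f \<notin> B\<rbrakk> \<Longrightarrow> mwins X Win N (insert e M) (insert f B)\<rbrakk>
    \<Longrightarrow> mwins X Win N M B"

lemma maker_turn_Suc: "maker_turn p (Suc i) \<longleftrightarrow> \<not> maker_turn p i"
  by (cases p) (auto simp: maker_turn_def)

definition breaker_claimed :: "player \<Rightarrow> 'a list \<Rightarrow> 'a set" where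
  "breaker_claimed p h = {h ! i | i. i < length h \<and> \<not> maker_turn p i}"

lemma maker_claimed_snoc:
  "maker_claimed p (h @ [x]) = (if maker_turn p (length h) then insert x (maker_claimed p h) else maker_claimed p h)"
proof -
  have "{i. i < length (h @ [x]) \<and> maker_turn p i} =
     (if maker_turn p (length h) then insert (length h) {i. i < length h \<and> maker_turn p i}
      else {i. i < length h \<and> maker_turn p i})"
    by (auto simp: less_Suc_eq)
  then have "(\<lambda>i. (h @ [x]) ! i) ` {i. i < length (h @ [x]) \<and> maker_turn p i} =
     (if maker_turn p (length h) then insert x ((!) h ` {i. i < length h \<and> maker_turn p i})
      else (!) h ` {i. i < length h \<and> maker_turn p i})"
    by (auto simp: nth_append)
  then show ?thesis unfolding maker_claimed_def setcompr_eq_image .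
qed

lemma breaker_claimed_snoc:
  "breaker_claimed p (h @ [x]) = (if maker_turn p (length h) then breaker_claimed p h else insert x (breaker_claimed p h))"
proof -
  have "{i. i < length (h @ [x]) \<and> \<not> maker_turn p i} =
     (if \<not> maker_turn p (length h) then insert (length h) {i. i < length h \<and> \<not> maker_turn p i}
      else {i. i < length h \<and> \<not> maker_turn p i})"
    by (auto simp: less_Suc_eq)
  then have "(\<lambda>i. (h @ [x]) ! i) ` {i. i < length (h @ [x]) \<and> \<not> maker_turn p i} =
     (if \<not> maker_turn p (length h) then insert x ((!) h ` {i. i < length h \<and> \<not> maker_turn p i})
      else (!) h ` {i. i < length h \<and> \<not> maker_turn p i})"
    by (auto simp: nth_append)
  then show ?thesis unfolding breaker_claimed_def setcompr_eq_image by auto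
qed

lemma claimed_Nil [simp]: "maker_claimed p [] = {}" "breaker_claimed p [] = {}"
  by (auto simp: maker_claimed_def breaker_claimed_def)

lemma set_claimed: "set h = maker_claimed p h \<union> breaker_claimed p h"
  unfolding maker_claimed_def breaker_claimed_def set_conv_nth by auto

lemma maker_moves_Nil [simp]: "maker_moves p [] = 0"
  by (simp add: maker_moves_def)

lemma maker_moves_snoc:
  "maker_moves p (h @ [x]) = (if maker_turn p (length h) then Suc (maker_moves p h) else maker_moves p h)"
proof -
  have "{i. i < length (h @ [x]) \<and> maker_turn p i} =
     (if maker_turn p (length h) then insert (length h) {i. i < length h \<and> maker_turn p i}
      else {i. i < length h \<and> maker_turn p i})"
    by (auto simp: less_Suc_eq)
  then show ?thesis unfolding maker_moves_def by simp
qed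

text \<open>The exact values by turn and first player carry the bound through the induction.\<close>

lemma length_maker_moves:
  "length h \<le> 2 * maker_moves p h + 1 \<and> (maker_turn p (length h) \<longrightarrow> maker_turn p 0 \<longrightarrow> length h = 2 * maker_moves p h)
   \<and> (\<not> maker_turn p (length h) \<longrightarrow> \<not> maker_turn p 0 \<longrightarrow> length h = 2 * maker_moves p h)
   \<and> (maker_turn p (length h) \<longrightarrow> \<not> maker_turn p 0 \<longrightarrow> length h = 2 * maker_moves p h + 1)
   \<and> (\<not> maker_turn p (length h) \<longrightarrow> maker_turn p 0 \<longrightarrow> length h + 1 = 2 * maker_moves p h)"
  by (induction h rule: rev_induct) (auto simp: maker_moves_snoc maker_turn_Suc)

text \<open>\<open>mwins\<close> only describes positions with Maker to move, so a game opened by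
  Breaker is covered by the positions after each possible first claim. The rule \<open>move\<close>
  would also favour Maker when Breaker has no reply left; \<open>big\<close> excludes this, since a
  full board needs \<open>card X\<close> moves while at most \<open>2 * N + 1\<close> have been
  made.\<close>

theorem maker_wins_within_if_mwins:
  assumes fin: "finite X" and big: "card X > 2 * N + 1"
    and win: "\<And>M. Win M \<longleftrightarrow> (\<exists>F\<in>\<F>. F \<subseteq> M)"
    and first: "mwins X Win N {} {}"
    and second: "\<And>f. f \<in> X \<Longrightarrow> mwins X Win N {} {f}"
  shows "maker_wins_within p X \<F> N"
proof -
  define good where "good M B e \<longleftrightarrow> e \<in> X \<and> e \<notin> M \<and> e \<notin> B \<and> card M < N \<and>
    (\<forall>f. f \<in> X \<and> f \<notin> insert e M \<and> f \<notin> B \<longrightarrow> mwins X Win N (insert e M) (insert f B))" for M B e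
  define \<sigma> where "\<sigma> h = (SOME e. good (maker_claimed p h) (breaker_claimed p h) e)" for h
  have goodE: "good (maker_claimed p h) (breaker_claimed p h) (\<sigma> h)"
    if "mwins X Win N (maker_claimed p h) (breaker_claimed p h)" "\<not> Win (maker_claimed p h)" for h
  proof -
    have "\<exists>e. good (maker_claimed p h) (breaker_claimed p h) e"
      using that(1) by (cases rule: mwins.cases) (use that(2) in \<open>auto simp: good_def\<close>)
    then show ?thesis unfolding \<sigma>_def by (rule someI_ex)
  qed
  \<comment> \<open>On Breaker's turn the invariant anticipates all his replies.\<close>
  have inv: "distinct h \<and> set h \<subseteq> X \<and> card (maker_claimed p h) = maker_moves p h \<and> maker_moves p h \<le> N \<and>
     (if maker_turn p (length h) then mwins X Win N (maker_claimed p h) (breaker_claimed p h)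
      else (\<forall>f\<in>X - set h. mwins X Win N (maker_claimed p h) (insert f (breaker_claimed p h))))"
    if "play p X \<F> \<sigma> h" for h
    using that
  proof (induction rule: play.induct)
    case start
    then show ?case using first second by auto
  next
    case (maker_move h)
    have nw: "\<not> Win (maker_claimed p h)"
      using maker_move.hyps by (auto simp: game_over_def maker_has_won_def win)
    have g: "good (maker_claimed p h) (breaker_claimed p h) (\<sigma> h)"
      using goodE[OF _ nw] maker_move by auto
    have f: "finite (maker_claimed p h)" by (metis finite_Un finite_set set_claimed)
    show ?case using maker_move g f set_claimed[of h p]
      by (auto simp: maker_claimed_snoc breaker_claimed_snoc maker_moves_snoc maker_turn_Suc good_def)
  next
    case (breaker_move h x)
    then show ?case
      by (auto simp: maker_claimed_snoc breaker_claimed_snoc maker_moves_snoc maker_turn_Suc)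
  qed
  have "winning_strategy_within p X \<F> N \<sigma>"
    unfolding winning_strategy_within_def
  proof (intro conjI allI impI; elim conjE)
    fix h assume h: "play p X \<F> \<sigma> h" "\<not> game_over p X \<F> h" "maker_turn p (length h)"
    have nw: "\<not> Win (maker_claimed p h)"
      using h(2) by (auto simp: game_over_def maker_has_won_def win)
    show "\<sigma> h \<in> X - set h" using goodE[OF _ nw] inv[OF h(1)] h(3) set_claimed[of h p] by (auto simp: good_def)
  next
    fix h assume h: "play p X \<F> \<sigma> h" "game_over p X \<F> h"
    show "maker_moves p h \<le> N" using inv[OF h(1)] by auto
    show "maker_has_won p \<F> h"
    proof (rule ccontr)
      assume "\<not> maker_has_won p \<F> h"
      then have "set h = X" using h(2) by (auto simp: game_over_def)
      then have "card X = length h" using inv[OF h(1)] distinct_card by fastforce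
      then show False using inv[OF h(1)] length_maker_moves[of h p] big by linarith
    qed
  qed
  then show ?thesis unfolding maker_wins_within_def by blast
qed

section \<open>Counting edges\<close>

definition nbr :: "'v set set \<Rightarrow> 'v \<Rightarrow> 'v set" where
  "nbr E v = {u. {v, u} \<in> E}"

definition degr :: "'v set set \<Rightarrow> 'v \<Rightarrow> nat" where
  "degr E v = card (nbr E v)"

text \<open>An edge inside \<open>A \<inter> B\<close> is counted twice.\<close>

definition ec :: "'v set set \<Rightarrow> 'v set \<Rightarrow> 'v set \<Rightarrow> nat" where
  "ec E A B = (\<Sum>a\<in>A. \<Sum>b\<in>B. of_bool ({a, b} \<in> E))"

lemma ec_sym: "ec E A B = ec E B A"
  unfolding ec_def by (subst sum.swap) (simp add: insert_commute)

lemma ec_Un1: "\<lbrakk>finite A; finite A'; A \<inter> A' = {}\<rbrakk> \<Longrightarrow> ec E (A \<union> A') B = ec E A B + ec E A' B"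
  unfolding ec_def by (rule sum.union_disjoint)

lemma ec_Un2: "\<lbrakk>finite B; finite B'; B \<inter> B' = {}\<rbrakk> \<Longrightarrow> ec E A (B \<union> B') = ec E A B + ec E A B'"
  using ec_Un1[of B B' E A] by (simp add: ec_sym)

lemma ec_diff2: "\<lbrakk>finite B; C \<subseteq> B\<rbrakk> \<Longrightarrow> ec E A B = ec E A C + ec E A (B - C)"
  using ec_Un2[of C "B - C" E A] by (metis Diff_disjoint Un_Diff_cancel finite_Diff finite_subset sup.absorb2)

lemma ec_diff1: "\<lbrakk>finite A; C \<subseteq> A\<rbrakk> \<Longrightarrow> ec E A B = ec E C B + ec E (A - C) B"
  using ec_diff2[of A C E B] by (simp add: ec_sym)

lemma ec_sum: "ec E A B = (\<Sum>a\<in>A. ec E {a} B)"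
  unfolding ec_def by simp

lemma ec_empty [simp]: "ec E {} B = 0" "ec E A {} = 0" "ec {} A B = 0"
  unfolding ec_def by auto

lemma ec_UN2:
  "\<lbrakk>finite J; \<And>j. j \<in> J \<Longrightarrow> finite (W j); \<And>i j. \<lbrakk>i \<in> J; j \<in> J; i \<noteq> j\<rbrakk> \<Longrightarrow> W i \<inter> W j = {}\<rbrakk>
    \<Longrightarrow> ec E A (\<Union>j\<in>J. W j) = (\<Sum>j\<in>J. ec E A (W j))"
  unfolding ec_def by (subst sum.UNION_disjoint, simp, simp, simp, subst sum.swap[of _ J], simp)

lemma ec_single: "finite B \<Longrightarrow> ec E {v} B = card (nbr E v \<inter> B)"
  unfolding ec_def nbr_def by (simp add: sum.If_cases of_bool_def Int_def conj_commute)

lemma ec_mono: "\<lbrakk>E \<subseteq> E'; A \<subseteq> A'; B \<subseteq> B'; finite A'; finite B'\<rbrakk> \<Longrightarrow> ec E A B \<le> ec E' A' B'"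
proof -
  assume a: "E \<subseteq> E'" "A \<subseteq> A'" "B \<subseteq> B'" "finite A'" "finite B'"
  have "ec E A B \<le> (\<Sum>a\<in>A. \<Sum>b\<in>B'. of_bool ({a, b} \<in> E'))"
    unfolding ec_def using a
    by (intro sum_mono order_trans[OF sum_mono sum_mono2]) (auto simp: of_bool_def)
  also have "\<dots> \<le> ec E' A' B'" unfolding ec_def using a by (intro sum_mono2) auto
  finally show ?thesis .
qed

lemma ec_eq_0_iff: "\<lbrakk>finite A; finite B\<rbrakk> \<Longrightarrow> ec E A B = 0 \<longleftrightarrow> (\<forall>a\<in>A. \<forall>b\<in>B. {a, b} \<notin> E)"
  unfolding ec_def by (auto simp: of_bool_def)

lemma ec_insert:
  assumes "finite A" "finite B" "x \<noteq> y" "{x, y} \<notin> E"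
  shows "ec (insert {x, y} E) A B = ec E A B + of_bool (x \<in> A \<and> y \<in> B) + of_bool (y \<in> A \<and> x \<in> B)"
proof -
  have *: "of_bool ({a, b} \<in> insert {x, y} E) =
     (of_bool ({a, b} \<in> E) + of_bool (a = x) * of_bool (b = y) + of_bool (a = y) * of_bool (b = x) :: nat)" for a b
    using assms(3,4) by (auto simp: of_bool_def doubleton_eq_iff insert_commute)
  show ?thesis
    unfolding ec_def * using assms(1,2)
    by (simp add: sum.distrib sum_distrib_left[symmetric] sum.delta of_bool_def if_distrib[of "\<lambda>c. _ * c"] sum.If_cases Int_def cong: if_cong)
qed

lemma ec_insert_le:
  assumes "finite A" "finite B" "x \<noteq> y"
  shows "ec (insert {x, y} E) A B \<le> ec E A B + of_bool (x \<in> A \<and> y \<in> B) + of_bool (y \<in> A \<and> x \<in> B)"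
  using ec_insert[OF assms] by (cases "{x, y} \<in> E") (auto simp: insert_absorb)

lemma nbr_insert: "nbr (insert {x, y} E) v = nbr E v \<union> (if v = x then {y} else {}) \<union> (if v = y then {x} else {})"
  unfolding nbr_def by (auto simp: doubleton_eq_iff)

lemma nbr_sym: "u \<in> nbr E v \<longleftrightarrow> v \<in> nbr E u"
  by (simp add: nbr_def insert_commute)

section \<open>Degrees and edge counts in subgraphs of a complete graph\<close>

locale finite_graph =
  fixes V :: "'v set"
  assumes finV: "finite V"
begin

abbreviation "X \<equiv> complete_edges V"

lemma X_edge: "{x, y} \<in> X \<longleftrightarrow> x \<in> V \<and> y \<in> V \<and> x \<noteq> y"
  unfolding complete_edges_def by (auto simp: card_2_iff doubleton_eq_iff)

lemma X_E:
  assumes "e \<in> X" obtains x y where "e = {x, y}" "x \<in> V" "y \<in> V" "x \<noteq> y"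
  using assms unfolding complete_edges_def by (auto simp: card_2_iff)

lemma finX: "finite X"
  unfolding complete_edges_def using finV by auto

lemma finE: "E \<subseteq> X \<Longrightarrow> finite E"
  using finX finite_subset by blast

lemma nbr_V: "E \<subseteq> X \<Longrightarrow> nbr E v \<subseteq> V - {v}"
  unfolding nbr_def using X_edge by fastforce

lemma fin_nbr: "E \<subseteq> X \<Longrightarrow> finite (nbr E v)"
  using nbr_V finV by (meson finite_Diff finite_subset)

lemma degr_ec: "E \<subseteq> X \<Longrightarrow> degr E v = ec E {v} V"
  unfolding degr_def ec_single[OF finV] using nbr_V by (metis Diff_subset Int_absorb2 order_trans)

lemma degr_insert:
  assumes "E \<subseteq> X" "x \<noteq> y" "{x, y} \<notin> E"
  shows "degr (insert {x, y} E) v = degr E v + of_bool (v = x \<or> v = y)"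
proof -
  have "y \<notin> nbr E x" "x \<notin> nbr E y" using assms(3) by (auto simp: nbr_def insert_commute)
  then show ?thesis using assms(2) fin_nbr[OF assms(1)] by (auto simp: degr_def nbr_insert)
qed

lemma degr_insert_le:
  assumes "E \<subseteq> X" "x \<noteq> y"
  shows "degr (insert {x, y} E) v \<le> degr E v + of_bool (v = x \<or> v = y)"
  using degr_insert[OF assms] by (cases "{x, y} \<in> E") (auto simp: insert_absorb)

lemma degr_insert_le_Suc: "\<lbrakk>E \<subseteq> X; e \<in> X\<rbrakk> \<Longrightarrow> degr (insert e E) v \<le> Suc (degr E v)"
  using degr_insert_le[of E] by (metis X_E add.commute add_mono_thms_linordered_semiring(2) of_bool_less_eq_one order_trans plus_1_eq_Suc)

lemma degr_mono: "\<lbrakk>E \<subseteq> E'; E' \<subseteq> X\<rbrakk> \<Longrightarrow> degr E v \<le> degr E' v"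
  unfolding degr_def by (intro card_mono fin_nbr) (auto simp: nbr_def)

lemma handshake: "E \<subseteq> X \<Longrightarrow> (\<Sum>v\<in>V. degr E v) = 2 * card E"
proof -
  assume E: "E \<subseteq> X"
  have "finite E" using E finE by blast
  then show ?thesis using E
  proof (induction E rule: finite_induct)
    case empty
    then show ?case by (simp add: degr_def nbr_def)
  next
    case (insert e F)
    then obtain x y where e: "e = {x, y}" "x \<in> V" "y \<in> V" "x \<noteq> y" using X_E by (metis insert_subset)
    have "(\<Sum>v\<in>V. degr (insert e F) v) = (\<Sum>v\<in>V. degr F v + (of_bool (v = x) + of_bool (v = y)))"
      using insert e by (intro sum.cong) (auto simp: degr_insert)
    also have "\<dots> = 2 * card F + 2" using insert e finV
      by (simp add: sum.distrib of_bool_def sum.delta)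
    finally show ?case using insert by simp
  qed
qed

lemma sum_degr: "E \<subseteq> X \<Longrightarrow> (\<Sum>v\<in>A. degr E v) = ec E A V"
  by (simp add: degr_ec ec_sum[of E A])

text \<open>
  The parameter \<open>d\<close> counts the moves made to rescue a vertex whose degree in
  Breaker's graph has become too large. A rescue is made at a vertex of Breaker-degree above \<open>L\<close>, and
  each vertex is rescued at most \<open>k\<close> times, so \<open>d\<close> stays bounded.
\<close>

definition ctrl :: "nat \<Rightarrow> nat \<Rightarrow> 'v set set \<Rightarrow> 'v set set \<Rightarrow> nat \<Rightarrow> bool" where
  "ctrl k L M B d \<longleftrightarrow> M \<subseteq> X \<and> B \<subseteq> X \<and> M \<inter> B = {} \<and> card B \<le> card M + 1 \<and>
     (\<forall>v\<in>V. degr M v \<le> k) \<and>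
     (\<forall>v\<in>V. degr M v < k \<longrightarrow> degr B v \<le> L + d + 1) \<and>
     d \<le> (\<Sum>v\<in>{v\<in>V. L < degr B v}. degr M v)"

section \<open>Rescues and the control of Breaker's degrees\<close>

lemma ctrl_start:
  assumes "B \<subseteq> X" "card B \<le> 1"
  shows "ctrl k L {} B 0"
proof -
  have fB: "finite B" using assms finE by blast
  have "degr B v \<le> 1" for v
    using card_inj_on_le[of "\<lambda>u. {v, u}" "nbr B v" B] assms fB
    by (fastforce simp: degr_def nbr_def inj_on_def doubleton_eq_iff)
  then have "degr B v \<le> L + 0 + 1" for v by (meson le_add2 order_trans)
  moreover have "degr {} v = 0" for v :: 'v by (simp add: degr_def nbr_def)
  ultimately show ?thesis using assms by (simp add: ctrl_def)
qed

text \<open>Breaker's at most \<open>N + 1\<close> edges give at most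
  \<open>2 * (N + 1) / (L + 1)\<close> vertices of Breaker-degree above \<open>L\<close>, and each
  of them contributes at most \<open>k\<close> to the sum that bounds \<open>d\<close>.\<close>

lemma ctrl_bound:
  assumes "ctrl k L M B d" "2 * k * (N + 1) < D * (L + 1)" "card M \<le> N"
  shows "d < D"
proof -
  define Big where "Big = {v\<in>V. L < degr B v}"
  have fin: "finite Big" using finV by (simp add: Big_def)
  have "(L + 1) * card Big = (\<Sum>v\<in>Big. L + 1)" by simp
  also have "\<dots> \<le> (\<Sum>v\<in>Big. degr B v)" by (intro sum_mono) (auto simp: Big_def)
  also have "\<dots> \<le> (\<Sum>v\<in>V. degr B v)" using finV by (intro sum_mono2) (auto simp: Big_def)
  also have "\<dots> = 2 * card B" using assms(1) by (intro handshake) (auto simp: ctrl_def)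
  also have "\<dots> \<le> 2 * (N + 1)" using assms by (auto simp: ctrl_def)
  finally have b: "(L + 1) * card Big \<le> 2 * (N + 1)" .
  have "d \<le> (\<Sum>v\<in>Big. degr M v)" using assms(1) by (auto simp: ctrl_def Big_def)
  also have "\<dots> \<le> (\<Sum>v\<in>Big. k)" using assms(1) by (intro sum_mono) (auto simp: ctrl_def Big_def)
  finally have "d \<le> card Big * k" by simp
  then have "d * (L + 1) \<le> k * ((L + 1) * card Big)" by (metis mult.assoc mult.commute mult_le_mono1)
  also have "\<dots> \<le> 2 * k * (N + 1)" using b by (metis mult.assoc mult.commute mult_le_mono2)
  finally show ?thesis using assms(2) by (meson le_less_trans mult_less_cancel2)
qed

text \<open>A rescue helps only \<open>v\<close>, while Breaker's reply may raise the degree of any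
  other deficient vertex; increasing \<open>d\<close> raises the permitted bound
  \<open>L + d + 1\<close> accordingly. If no deficient vertex exceeds \<open>L + d\<close>, the
  reply stays within the old bound. A rescue adds 1 to the Maker-degree of a vertex of
  Breaker-degree above \<open>L\<close>, so the sum keeps pace with \<open>d\<close>.\<close>

lemma ctrl_step:
  assumes c: "ctrl k L M B d" and uv: "u \<in> V" "v \<in> V" "u \<noteq> v" "{u, v} \<notin> M" "{u, v} \<notin> B"
    and k: "\<forall>w\<in>V. degr (insert {u, v} M) w \<le> k"
    and d: "(d' = d \<and> (\<forall>v\<in>V. degr M v < k \<longrightarrow> degr B v \<le> L + d)) \<or> (d' = Suc d \<and> L < degr B v)"
    and f: "f \<in> X" "f \<notin> insert {u, v} M" "f \<notin> B"
  shows "ctrl k L (insert {u, v} M) (insert f B) d'"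
proof -
  have MX: "M \<subseteq> X" and BX: "B \<subseteq> X" and dis: "M \<inter> B = {}" and cB: "card B \<le> card M + 1"
    and un: "\<And>w. w \<in> V \<Longrightarrow> degr M w < k \<Longrightarrow> degr B w \<le> L + d + 1"
    and ds: "d \<le> (\<Sum>v\<in>{v\<in>V. L < degr B v}. degr M v)" using c by (auto simp: ctrl_def)
  have MX': "insert {u, v} M \<subseteq> X" "insert f B \<subseteq> X" using MX BX f uv by (auto simp: X_edge)
  have dB: "degr (insert f B) w \<le> degr B w + 1" "degr B w \<le> degr (insert f B) w" for w
    using degr_insert_le_Suc[OF BX f(1)] degr_mono[of B "insert f B"] MX' by auto
  have dM: "degr (insert {u, v} M) w = degr M w + of_bool (w = u \<or> w = v)" for w
    using degr_insert[OF MX uv(3,4)] .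
  have "\<forall>w\<in>V. degr (insert {u, v} M) w < k \<longrightarrow> degr (insert f B) w \<le> L + d' + 1"
  proof (intro ballI impI)
    fix w assume w: "w \<in> V" "degr (insert {u, v} M) w < k"
    then have "degr M w < k" using dM[of w] by linarith
    then have "degr B w \<le> L + d'" using d un[OF w(1)] w(1) by auto
    then show "degr (insert f B) w \<le> L + d' + 1" using dB(1)[of w] by linarith
  qed
  moreover have "d' \<le> (\<Sum>w\<in>{w\<in>V. L < degr (insert f B) w}. degr (insert {u, v} M) w)"
  proof -
    have "d' \<le> (\<Sum>w\<in>{w\<in>V. L < degr B w}. degr (insert {u, v} M) w)"
    proof (cases "d' = d")
      case True
      have "(\<Sum>w\<in>{w\<in>V. L < degr B w}. degr M w) \<le> (\<Sum>w\<in>{w\<in>V. L < degr B w}. degr (insert {u, v} M) w)"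
        by (intro sum_mono) (simp add: dM)
      then show ?thesis using True ds by linarith
    next
      case False
      then have d': "d' = Suc d" "L < degr B v" using d by auto
      have "(\<Sum>w\<in>{w\<in>V. L < degr B w}. degr M w) + 1 = (\<Sum>w\<in>{w\<in>V. L < degr B w}. degr M w + of_bool (w = v))"
        using d' uv finV by (simp add: sum.distrib of_bool_def sum.delta)
      also have "\<dots> \<le> (\<Sum>w\<in>{w\<in>V. L < degr B w}. degr (insert {u, v} M) w)"
        by (intro sum_mono) (auto simp: dM)
      finally show ?thesis using d' ds by linarith
    qed
    also have "\<dots> \<le> (\<Sum>w\<in>{w\<in>V. L < degr (insert f B) w}. degr (insert {u, v} M) w)"
      using dB(2) finV by (intro sum_mono2) (auto intro: less_le_trans)
    finally show ?thesis .
  qed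
  moreover have "card (insert f B) \<le> card (insert {u, v} M) + 1"
    using cB f uv finE[OF MX] finE[OF BX] by simp
  moreover have "insert {u, v} M \<inter> insert f B = {}" using dis f uv(5) by blast
  ultimately show ?thesis using MX' k unfolding ctrl_def by simp
qed

text \<open>A template for stages with linearly many moves. \<open>P\<close> will be Breaker's
  neighbourhood of \<open>v\<close>, which lets \<open>I\<close> and \<open>G\<close> be stated
  without Breaker. \<open>danger\<close> must handle every deficient \<open>v\<close>, whereas
  \<open>progress\<close> may choose its own. No measure of progress is required: every move adds an
  edge, and \<open>I\<close> forces \<open>card M < N\<close>, so the stage can only end in
  \<open>G\<close>.\<close>

lemma controlled_stage:
  fixes I G :: "'v set set \<Rightarrow> nat \<Rightarrow> bool"
  assumes inv: "\<And>M d v. I M d \<or> G M d \<Longrightarrow> v \<in> V \<Longrightarrow> degr M v \<le> k"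
    and card: "\<And>M d. \<lbrakk>I M d; M \<subseteq> X\<rbrakk> \<Longrightarrow> card M < N"
    and danger: "\<And>M d v P. \<lbrakk>I M d; M \<subseteq> X; d < D; v \<in> V; degr M v < k; finite P; card P \<le> m\<rbrakk> \<Longrightarrow>
      \<exists>u\<in>V - P. u \<noteq> v \<and> {u, v} \<notin> M \<and> (I (insert {u, v} M) (Suc d) \<or> G (insert {u, v} M) (Suc d))"
    and progress: "\<And>M d. \<lbrakk>I M d; M \<subseteq> X; d < D\<rbrakk> \<Longrightarrow> \<exists>v\<in>V. degr M v < k \<and> (\<forall>P. finite P \<and> card P \<le> m \<longrightarrow>
      (\<exists>u\<in>V - P. u \<noteq> v \<and> {u, v} \<notin> M \<and> (I (insert {u, v} M) d \<or> G (insert {u, v} M) d)))"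
    and goal: "\<And>M B d. \<lbrakk>G M d; ctrl k L M B d\<rbrakk> \<Longrightarrow> mwins X Win N M B"
    and D: "2 * k * (N + 1) < D * (L + 1)" and m: "L + D + 1 \<le> m"
    and start: "I M d \<or> G M d" "ctrl k L M B d"
  shows "mwins X Win N M B"
  using start
proof (induction "N - card M" arbitrary: M B d rule: less_induct)
  case less
  show ?case
  proof (cases "G M d")
    case True
    then show ?thesis using goal less.prems by blast
  next
    case False
    then have I: "I M d" using less.prems by blast
    have MX: "M \<subseteq> X" and BX: "B \<subseteq> X" using less.prems(2) by (auto simp: ctrl_def)
    have cM: "card M < N" using card[OF I MX] .
    have dD: "d < D" using ctrl_bound[OF less.prems(2) D] cM by simp
    have P: "finite (nbr B v)" "degr M v < k \<Longrightarrow> card (nbr B v) \<le> m" if "v \<in> V" for v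
      using fin_nbr[OF BX] less.prems(2) m dD that by (fastforce simp: ctrl_def degr_def)+
    obtain u v d' where uv: "u \<in> V" "v \<in> V" "u \<notin> nbr B v" "u \<noteq> v" "{u, v} \<notin> M"
      "I (insert {u, v} M) d' \<or> G (insert {u, v} M) d'"
      "(d' = d \<and> (\<forall>v\<in>V. degr M v < k \<longrightarrow> degr B v \<le> L + d)) \<or> (d' = Suc d \<and> L < degr B v)"
    proof (cases "\<exists>v\<in>V. degr M v < k \<and> L + d < degr B v")
      case True
      then obtain v where v: "v \<in> V" "degr M v < k" "L + d < degr B v" by blast
      have "L < degr B v" using v(3) by simp
      then show ?thesis
        using danger[OF I MX dD v(1,2) P(1)[OF v(1)] P(2)[OF v(1,2)]] that[of _ v "Suc d"] v(1) by blast
    next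
      case False
      obtain v where v: "v \<in> V" "degr M v < k" "\<forall>P. finite P \<and> card P \<le> m \<longrightarrow>
        (\<exists>u\<in>V - P. u \<noteq> v \<and> {u, v} \<notin> M \<and> (I (insert {u, v} M) d \<or> G (insert {u, v} M) d))"
        using progress[OF I MX dD] by blast
      then show ?thesis
        using P[OF v(1)] False that[of _ v d] by (metis DiffE not_less)
    qed
    have nB: "{u, v} \<notin> B" using uv(3) by (simp add: nbr_def insert_commute)
    show ?thesis
    proof (rule mwins.move[of "{u, v}"])
      show "{u, v} \<in> X" using uv by (simp add: X_edge)
      fix f assume f: "f \<in> X" "f \<notin> insert {u, v} M" "f \<notin> B"
      have k: "\<forall>w\<in>V. degr (insert {u, v} M) w \<le> k" using inv[OF uv(6)] by blast
      have c: "ctrl k L (insert {u, v} M) (insert f B) d'"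
        by (rule ctrl_step[OF less.prems(2) uv(1,2,4,5) nB k uv(7) f])
      show "mwins X Win N (insert {u, v} M) (insert f B)"
        using less.hyps[OF _ uv(6) c] cM uv(5) finE[OF MX] by simp
    qed (use uv nB cM in auto)
  qed
qed

text \<open>For a stage so short that nothing needs rescuing: \<open>mu\<close> bounds the moves
  still to come, and no Breaker-degree can pass \<open>m\<close> within that many replies.\<close>

lemma short_stage:
  fixes I G :: "'v set set \<Rightarrow> bool" and mu :: "'v set set \<Rightarrow> nat"
  assumes card: "\<And>M. \<lbrakk>I M; M \<subseteq> X\<rbrakk> \<Longrightarrow> card M < N"
    and progress: "\<And>M. \<lbrakk>I M; M \<subseteq> X\<rbrakk> \<Longrightarrow> \<exists>v\<in>V. degr M v < k \<and> (\<forall>P. finite P \<and> card P \<le> m \<longrightarrow>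
      (\<exists>u\<in>V - P. u \<noteq> v \<and> {u, v} \<notin> M \<and> mu (insert {u, v} M) < mu M \<and> (I (insert {u, v} M) \<or> G (insert {u, v} M))))"
    and goal: "\<And>M B. \<lbrakk>G M; M \<subseteq> X; B \<subseteq> X; M \<inter> B = {}; card B \<le> card M + 1;
      \<forall>v\<in>V. degr M v < k \<longrightarrow> degr B v \<le> m\<rbrakk> \<Longrightarrow> mwins X Win N M B"
    and start: "I M \<or> G M" "M \<subseteq> X" "B \<subseteq> X" "M \<inter> B = {}" "card B \<le> card M + 1"
      "\<forall>v\<in>V. degr M v < k \<longrightarrow> degr B v + mu M \<le> m"
  shows "mwins X Win N M B"
  using start
proof (induction "mu M" arbitrary: M B rule: less_induct)
  case less
  show ?case
  proof (cases "G M")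
    case True
    then show ?thesis using less.prems by (intro goal) auto
  next
    case False
    then have I: "I M" using less.prems by blast
    note MX = less.prems(2) and BX = less.prems(3)
    obtain v where v: "v \<in> V" "degr M v < k" "\<forall>P. finite P \<and> card P \<le> m \<longrightarrow>
      (\<exists>u\<in>V - P. u \<noteq> v \<and> {u, v} \<notin> M \<and> mu (insert {u, v} M) < mu M \<and> (I (insert {u, v} M) \<or> G (insert {u, v} M)))"
      using progress[OF I MX] by blast
    have "finite (nbr B v) \<and> card (nbr B v) \<le> m"
      using less.prems(6) v(1,2) fin_nbr[OF BX] by (auto simp: degr_def)
    then obtain u where u: "u \<in> V" "u \<notin> nbr B v" "u \<noteq> v" "{u, v} \<notin> M" "mu (insert {u, v} M) < mu M"
      "I (insert {u, v} M) \<or> G (insert {u, v} M)" using v(3) by blast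
    have nB: "{u, v} \<notin> B" using u(2) by (simp add: nbr_def insert_commute)
    have uvX: "{u, v} \<in> X" using u v by (simp add: X_edge)
    show ?thesis
    proof (rule mwins.move[of "{u, v}"])
      fix f assume f: "f \<in> X" "f \<notin> insert {u, v} M" "f \<notin> B"
      have "\<forall>w\<in>V. degr (insert {u, v} M) w < k \<longrightarrow> degr (insert f B) w + mu (insert {u, v} M) \<le> m"
      proof (intro ballI impI)
        fix w assume w: "w \<in> V" "degr (insert {u, v} M) w < k"
        then have "degr M w < k" using degr_insert[OF MX u(3,4), of w] by linarith
        then have "degr B w + mu M \<le> m" using less.prems(6) w(1) by blast
        moreover have "degr (insert f B) w \<le> degr B w + 1"
          using degr_insert_le_Suc[OF BX f(1)] by simp
        ultimately show "degr (insert f B) w + mu (insert {u, v} M) \<le> m" using u(5) by linarith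
      qed
      then show "mwins X Win N (insert {u, v} M) (insert f B)"
        using less.prems f u uvX nB finE[OF MX] finE[OF BX] by (intro less.hyps) auto
    qed (use uvX u nB card[OF I MX] in auto)
  qed
qed

end

section \<open>Pairing up the deficient vertices\<close>

lemma ex_partner:
  assumes "finite U" "x \<in> U" "finite Q" "card (nbr B x \<inter> U) + card Q + 1 < card U"
  shows "\<exists>y\<in>U - Q. y \<noteq> x \<and> y \<notin> nbr B x"
proof (rule ccontr)
  assume "\<not> ?thesis"
  then have "U \<subseteq> insert x ((nbr B x \<inter> U) \<union> Q)" by blast
  then have "card U \<le> card (insert x ((nbr B x \<inter> U) \<union> Q))" using assms by (intro card_mono) auto
  also have "\<dots> \<le> Suc (card (nbr B x \<inter> U) + card Q)"
    using card_Un_le[of "nbr B x \<inter> U" Q] assms by (simp add: card_insert_if)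
  finally show False using assms(4) by simp
qed

text \<open>Degree at most one means that Breaker's graph on \<open>U\<close>, without the
  exceptional edges \<open>Xs\<close>, is a matching.\<close>

definition matching_but :: "'v set set \<Rightarrow> 'v set \<Rightarrow> 'v set set \<Rightarrow> bool" where
  "matching_but B U Xs \<longleftrightarrow> (\<forall>v\<in>U. card (nbr (B - Xs) v \<inter> U) \<le> 1)"

lemma matching_but_mono:
  assumes "matching_but B U Xs" "finite U" "U' \<subseteq> U"
    and "\<And>a b. \<lbrakk>a \<in> U'; b \<in> U'; {a, b} \<in> B'; {a, b} \<notin> Xs'\<rbrakk> \<Longrightarrow> {a, b} \<in> B \<and> {a, b} \<notin> Xs"
  shows "matching_but B' U' Xs'"
  unfolding matching_but_def
proof
  fix v assume v: "v \<in> U'"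
  have "card (nbr (B' - Xs') v \<inter> U') \<le> card (nbr (B - Xs) v \<inter> U)"
    using assms v by (intro card_mono) (auto simp: nbr_def)
  then show "card (nbr (B' - Xs') v \<inter> U') \<le> 1" using assms(1,3) v unfolding matching_but_def
    by (meson le_trans subsetD)
qed

lemma card_nbr_Diff:
  assumes "finite U" "finite Xs"
  shows "card (nbr B x \<inter> U) \<le> card (nbr (B - Xs) x \<inter> U) + card Xs"
proof -
  have fin: "finite {z. {x, z} \<in> Xs}"
    by (rule finite_imageD[of "\<lambda>z. {x, z}"]) (auto intro: finite_subset[OF _ assms(2)] simp: inj_on_def doubleton_eq_iff)
  have "card {z. {x, z} \<in> Xs} \<le> card Xs"
    by (rule card_inj_on_le[of "\<lambda>z. {x, z}"]) (auto simp: inj_on_def doubleton_eq_iff assms)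
  moreover have "card (nbr B x \<inter> U) \<le> card ((nbr (B - Xs) x \<inter> U) \<union> {z. {x, z} \<in> Xs})"
    using assms fin by (intro card_mono) (auto simp: nbr_def)
  ultimately show ?thesis using card_Un_le[of "nbr (B - Xs) x \<inter> U" "{z. {x, z} \<in> Xs}"] by linarith
qed

text \<open>
  \<open>U\<close> is the set of vertices that still lack one edge. Maker may join any two of them, except that
  \<open>x\<close> may not be joined to \<open>\<pi> M x\<close>. The bound \<open>mm\<close> is maintained because \<open>U\<close> loses two vertices per round.
\<close>

locale pairing_game = finite_graph V for V :: "'v set" +
  fixes Win :: "'v set set \<Rightarrow> bool" and N :: nat and J :: "'v set set \<Rightarrow> 'v set \<Rightarrow> bool"
    and \<pi> :: "'v set set \<Rightarrow> 'v \<Rightarrow> 'v" and mm :: nat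
  assumes J_sub: "J M U \<Longrightarrow> U \<subseteq> V \<and> M \<subseteq> X"
    and J_card: "\<lbrakk>J M U; 3 \<le> card U\<rbrakk> \<Longrightarrow> card M < N"
    and J_step: "\<lbrakk>J M U; 3 \<le> card U; x \<in> U; y \<in> U; x \<noteq> y; y \<noteq> \<pi> M x\<rbrakk> \<Longrightarrow>
      {x, y} \<notin> M \<and> J (insert {x, y} M) (U - {x, y})"
    and J_three: "\<lbrakk>J M U; card U = 3; x \<in> U\<rbrakk> \<Longrightarrow> \<pi> M x \<notin> U - {x}"
    and J_final: "\<And>M U B. \<lbrakk>J M U; card U \<le> 2; B \<subseteq> X; M \<inter> B = {}; \<forall>v\<in>U. degr B v + card U \<le> mm\<rbrakk> \<Longrightarrow> mwins X Win N M B"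
begin

definition ok :: "'v set set \<Rightarrow> 'v set set \<Rightarrow> 'v set \<Rightarrow> bool" where
  "ok M B U \<longleftrightarrow> J M U \<and> B \<subseteq> X \<and> M \<inter> B = {} \<and> (\<forall>v\<in>U. degr B v + card U \<le> mm)"

lemma ok_fin: "ok M B U \<Longrightarrow> finite U" "ok M B U \<Longrightarrow> finite B" "ok M B U \<Longrightarrow> B \<subseteq> X" "ok M B U \<Longrightarrow> U \<subseteq> V"
  using J_sub finV finE unfolding ok_def by (auto intro: finite_subset)

lemma final: "\<lbrakk>ok M B U; card U \<le> 2\<rbrakk> \<Longrightarrow> mwins X Win N M B"
  unfolding ok_def by (intro J_final) auto

lemma round:
  assumes ok: "ok M B U" and c: "3 \<le> card U"
    and xy: "x \<in> U" "y \<in> U" "y \<noteq> x" "y \<notin> nbr B x" "y \<noteq> \<pi> M x"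
    and cont: "\<And>f M'. \<lbrakk>f \<in> X; f \<notin> B; ok M' (insert f B) (U - {x, y})\<rbrakk> \<Longrightarrow> mwins X Win N M' (insert f B)"
  shows "mwins X Win N M B"
proof -
  have J: "J M U" and BX: "B \<subseteq> X" and dis: "M \<inter> B = {}" and deg: "\<forall>v\<in>U. degr B v + card U \<le> mm"
    using ok by (auto simp: ok_def)
  have st: "{x, y} \<notin> M" "J (insert {x, y} M) (U - {x, y})" using J_step[OF J c xy(1,2)] xy by auto
  have nB: "{x, y} \<notin> B" using xy by (simp add: nbr_def insert_commute)
  have cU: "card (U - {x, y}) + 2 = card U" using c xy ok_fin(1)[OF ok] by (simp add: card_Diff_insert)
  show ?thesis
  proof (rule mwins.move[of "{x, y}"])
    show "{x, y} \<in> X" using xy ok_fin(4)[OF ok] by (auto simp: X_edge)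
    fix f assume f: "f \<in> X" "f \<notin> insert {x, y} M" "f \<notin> B"
    have "ok (insert {x, y} M) (insert f B) (U - {x, y})"
      unfolding ok_def
    proof (intro conjI ballI)
      fix v assume v: "v \<in> U - {x, y}"
      then show "degr (insert f B) v + card (U - {x, y}) \<le> mm"
        using degr_insert_le_Suc[OF BX f(1), of v] deg cU by fastforce
    qed (use st f BX dis nB in auto)
    then show "mwins X Win N (insert {x, y} M) (insert f B)" using cont f by blast
  qed (use st nB J_card[OF J c] in auto)
qed

text \<open>While at least five vertices are left, Maker uses an end of \<open>f\<close>; afterwards
  the only edge outside the matching is Breaker's reply, and the situation recurs. An empty
  \<open>f\<close>, or one that is not inside \<open>U\<close>, does no harm.\<close>

lemma steady:
  assumes "ok M B U" "matching_but B U {f}" "finite f" "card f \<le> 2"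
  shows "mwins X Win N M B"
  using assms
proof (induction "card U" arbitrary: M B U f rule: less_induct)
  case less
  note ok = less.prems(1) and mb = less.prems(2)
  have fU: "finite U" using ok_fin ok by blast
  show ?case
  proof (cases "card U \<le> 2")
    case True
    then show ?thesis using final ok by blast
  next
    case False
    then have c3: "3 \<le> card U" by simp
    \<comment> \<open>In the last round \<open>x\<close> is taken off \<open>f\<close> and so has at
      most one Breaker-neighbour. Of four vertices, one is then neither \<open>x\<close>, nor
      blocked, nor \<open>\<pi> M x\<close>; of three this needs \<open>J_three\<close>.\<close>
    obtain x where x: "x \<in> U" "if card U \<le> 4 then x \<notin> f else f \<noteq> {} \<and> f \<subseteq> U \<longrightarrow> x \<in> f"
    proof (cases "card U \<le> 4")
      case True
      have "\<not> U \<subseteq> f" using c3 less.prems(3,4) card_mono[of f U] by auto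
      then show ?thesis using that True by auto
    next
      case False
      then have "U \<noteq> {}" by auto
      then show ?thesis using that False by (cases "f \<noteq> {} \<and> f \<subseteq> U") auto
    qed
    have nx: "card (nbr (B - {f}) x \<inter> U) \<le> 1" using mb x(1) by (auto simp: matching_but_def)
    obtain y where y: "y \<in> U" "y \<noteq> x" "y \<notin> nbr B x" "y \<noteq> \<pi> M x"
    proof -
      consider "card U = 3" | "card U = 4" | "5 \<le> card U" using c3 by linarith
      then show ?thesis
      proof cases
        case 1
        then have "nbr (B - {f}) x = nbr B x" using x(2) by (auto simp: nbr_def)
        then have "card (nbr B x \<inter> U) + card ({}::'v set) + 1 < card U" using nx 1 by simp
        then obtain y where "y \<in> U" "y \<noteq> x" "y \<notin> nbr B x" using ex_partner[OF fU x(1), of "{}"] by blast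
        then show ?thesis using that J_three[of M U x] 1 x(1) ok by (auto simp: ok_def)
      next
        case 2
        then have "nbr (B - {f}) x = nbr B x" using x(2) by (auto simp: nbr_def)
        then have "card (nbr B x \<inter> U) + card {\<pi> M x} + 1 < card U" using nx 2 by simp
        then show ?thesis using that ex_partner[OF fU x(1), of "{\<pi> M x}"] by blast
      next
        case 3
        have "card (nbr B x \<inter> U) + card {\<pi> M x} + 1 < card U"
          using card_nbr_Diff[OF fU, of "{f}" B x] nx 3 by simp
        then show ?thesis using that ex_partner[OF fU x(1), of "{\<pi> M x}"] by blast
      qed
    qed
    show ?thesis
    proof (rule round[OF ok c3 x(1) y])
      fix g M' assume g: "g \<in> X" "g \<notin> B" and ok': "ok M' (insert g B) (U - {x, y})"
      have sm: "card (U - {x, y}) + 2 = card U" using c3 x y fU by (simp add: card_Diff_insert)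
      show "mwins X Win N M' (insert g B)"
      proof (cases "card U \<le> 4")
        case True
        then show ?thesis using final[OF ok'] sm by simp
      next
        case False
        have "matching_but (insert g B) (U - {x, y}) {g}"
        proof (rule matching_but_mono[OF mb fU])
          fix a b assume "a \<in> U - {x, y}" "b \<in> U - {x, y}" "{a, b} \<in> insert g B" "{a, b} \<notin> {g}"
          then show "{a, b} \<in> B \<and> {a, b} \<notin> {f}" using x(2) False by auto
        qed auto
        moreover have "finite g \<and> card g \<le> 2" using g finV by (auto simp: complete_edges_def intro: finite_subset)
        ultimately show ?thesis using less.hyps[OF _ ok'] sm by auto
      qed
    qed
  qed
qed

lemma matching_but_round:
  assumes "matching_but B U Xs" "finite U"
  shows "matching_but (insert f B) (U - {x, y}) (insert f {e\<in>Xs. x \<notin> e \<and> y \<notin> e})"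
  by (rule matching_but_mono[OF assms]) auto

text \<open>Only Breaker's reply remains as an exceptional edge, which is the situation of
  \<open>steady\<close>.\<close>

lemma kill_all:
  assumes ok: "ok M B U" and c: "3 \<le> card U"
    and xy: "x \<in> U" "y \<in> U" "y \<noteq> x" "y \<notin> nbr B x" "y \<noteq> \<pi> M x"
    and mb: "matching_but B U Xs" and all: "\<forall>e\<in>Xs. x \<in> e \<or> y \<in> e"
  shows "mwins X Win N M B"
proof (rule round[OF ok c xy])
  fix f M' assume f: "f \<in> X" "f \<notin> B" and ok': "ok M' (insert f B) (U - {x, y})"
  have "{e\<in>Xs. x \<notin> e \<and> y \<notin> e} = {}" using all by blast
  then have "matching_but (insert f B) (U - {x, y}) {f}"
    using matching_but_round[OF mb ok_fin(1)[OF ok], of f x y] by (simp only:)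
  moreover have "finite f \<and> card f \<le> 2" using f finV by (auto simp: complete_edges_def intro: finite_subset)
  ultimately show "mwins X Win N M' (insert f B)" using steady[OF ok'] by blast
qed

lemma matching_but_restrict:
  assumes "matching_but B U Xs" "finite U"
  shows "matching_but B U {e\<in>Xs. e \<subseteq> U \<and> e \<in> B}"
  by (rule matching_but_mono[OF assms]) auto

text \<open>A single pair hits both edges. A common vertex of \<open>e1\<close> and
  \<open>e2\<close> does so with any partner. Otherwise \<open>c\<close> has no Breaker-neighbour in
  \<open>U\<close> except along \<open>e1\<close>, so it can be joined to whichever end of
  \<open>e2\<close> is not its forbidden partner.\<close>

lemma two_extras_free_end:
  assumes ok: "ok M B U" and c: "8 \<le> card U" and mb: "matching_but B U {e1, e2}"
    and e: "c \<in> e1" "c \<in> U" "nbr (B - {e1, e2}) c \<inter> U = {}" "e1 \<in> X" "e2 \<in> X"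
  shows "mwins X Win N M B"
proof (cases "e2 \<subseteq> U")
  case False
  have "matching_but B U {e1}"
    by (rule matching_but_mono[OF mb ok_fin(1)[OF ok]]) (use False in auto)
  moreover have "finite e1 \<and> card e1 \<le> 2" using e finV by (auto simp: complete_edges_def intro: finite_subset)
  ultimately show ?thesis using steady[OF ok] by blast
next
  case True
  have c3: "3 \<le> card U" using c by simp
  have fU: "finite U" using ok_fin ok by blast
  have cn: "card (nbr B c \<inter> U) \<le> 2"
    using card_nbr_Diff[OF fU, of "{e1, e2}" B c] e(3) card_insert_le_m1[of 2 "{e2}" e1] by simp
  show ?thesis
  proof (cases "c \<in> e2")
    case True
    have "card (nbr B c \<inter> U) + card {\<pi> M c} + 1 < card U" using cn c by simp
    then obtain y where "y \<in> U" "y \<noteq> c" "y \<notin> nbr B c" "y \<noteq> \<pi> M c"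
      using ex_partner[OF fU e(2), of "{\<pi> M c}"] by blast
    then show ?thesis using kill_all[OF ok c3 e(2) _ _ _ _ mb] True e(1) by blast
  next
    case c2: False
    obtain c' where e1: "e1 = {c, c'}" using e(1,4) X_E by (metis doubleton_eq_iff insertE singletonD)
    obtain a b where ab: "e2 = {a, b}" "a \<noteq> b" using e(5) X_E by metis
    show ?thesis
    proof (cases "c' \<in> e2")
      case True
      have c'U: "c' \<in> U" using True \<open>e2 \<subseteq> U\<close> by blast
      have "card (nbr (B - {e1, e2}) c' \<inter> U) \<le> 1" using mb c'U by (auto simp: matching_but_def)
      then have "card (nbr B c' \<inter> U) + card {\<pi> M c'} + 1 < card U"
        using card_nbr_Diff[OF fU, of "{e1, e2}" B c'] c card_insert_le_m1[of 2 "{e2}" e1] by simp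
      then obtain y where "y \<in> U" "y \<noteq> c'" "y \<notin> nbr B c'" "y \<noteq> \<pi> M c'"
        using ex_partner[OF fU c'U, of "{\<pi> M c'}"] by blast
      then show ?thesis using kill_all[OF ok c3 c'U _ _ _ _ mb] True e1 by blast
    next
      case False
      obtain y where y: "y \<in> e2" "y \<noteq> \<pi> M c" using ab by auto
      have yU: "y \<in> U" using y True by blast
      have "y \<noteq> c" using y c2 by blast
      moreover have "y \<notin> nbr B c"
      proof
        assume "y \<in> nbr B c"
        then have "{c, y} = e1 \<or> {c, y} = e2" using e(3) yU by (auto simp: nbr_def)
        then show False using c2 e1 False y(1) by (auto simp: doubleton_eq_iff)
      qed
      ultimately show ?thesis using kill_all[OF ok c3 e(2) yU _ _ y(2) mb] e(1) y(1) by blast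
    qed
  qed
qed

text \<open>Breaker adds one exceptional edge per round, so Maker gains by destroying two. Two
  intersecting edges, or three disjoint ones, always allow this. Exactly two disjoint edges form the
  critical case. Each gain costs two vertices of \<open>U\<close>, which explains the factor 2 in
  the bound.\<close>

lemma extras:
  assumes "ok M B U" "matching_but B U Xs" "finite Xs" "2 * card Xs + 12 \<le> card U"
  shows "mwins X Win N M B"
  using assms
proof (induction "card Xs" arbitrary: M B U Xs rule: less_induct)
  case less
  note ok = less.prems(1) and mb = less.prems(2) and fX = less.prems(3) and cU = less.prems(4)
  have fU: "finite U" using ok_fin ok by blast
  have c3: "3 \<le> card U" using cU by simp
  define Ys where "Ys = {e\<in>Xs. e \<subseteq> U \<and> e \<in> B}"
  have mbY: "matching_but B U Ys" unfolding Ys_def by (rule matching_but_restrict[OF mb fU])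
  show ?case
  proof (cases "Ys = Xs")
    case False
    then have "card Ys < card Xs" using fX unfolding Ys_def by (intro psubset_card_mono) auto
    then show ?thesis using less.hyps[OF _ ok mbY] cU fX by (auto simp: Ys_def)
  next
    case YX: True
    then have sub: "\<And>e. e \<in> Xs \<Longrightarrow> e \<subseteq> U \<and> e \<in> B" unfolding Ys_def by blast
    have inX: "\<And>e. e \<in> Xs \<Longrightarrow> e \<in> X" using sub ok_fin(3)[OF ok] by blast
    have dA: "card (nbr B x \<inter> U) \<le> 1 + card Xs" if "x \<in> U" for x
      using card_nbr_Diff[OF fU fX, of B x] mb that unfolding matching_but_def by fastforce
    have kill2: ?thesis if xy: "x \<in> U" "y \<in> U" "y \<noteq> x" "y \<notin> nbr B x" "y \<noteq> \<pi> M x"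
      and e: "e1 \<in> Xs" "e2 \<in> Xs" "e1 \<noteq> e2" "x \<in> e1 \<or> y \<in> e1" "x \<in> e2 \<or> y \<in> e2" for x y e1 e2
    proof (rule round[OF ok c3 xy])
      fix f M' assume f: "f \<in> X" "f \<notin> B" and ok': "ok M' (insert f B) (U - {x, y})"
      let ?Z = "{e\<in>Xs. x \<notin> e \<and> y \<notin> e}"
      have "?Z \<subseteq> Xs - {e1, e2}" using e by auto
      then have "card ?Z \<le> card (Xs - {e1, e2})" using fX by (intro card_mono) auto
      also have "\<dots> = card Xs - 2" using e fX by (simp add: card_Diff_insert card_Diff_singleton)
      finally have z: "card ?Z \<le> card Xs - 2" .
      have "2 \<le> card Xs" using e fX card_mono[of Xs "{e1, e2}"] by auto
      then have z2: "card (insert f ?Z) < card Xs" using z fX by (simp add: card_insert_if) linarith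
      have "card (U - {x, y}) + 2 = card U" using xy fU c3 by (simp add: card_Diff_insert)
      then show "mwins X Win N M' (insert f B)"
        using less.hyps[OF z2 ok' matching_but_round[OF mb fU]] fX cU z2 by simp
    qed
    show ?thesis
    proof (cases "\<exists>v e1 e2. e1 \<in> Xs \<and> e2 \<in> Xs \<and> e1 \<noteq> e2 \<and> v \<in> e1 \<and> v \<in> e2")
      case True
      then obtain v e1 e2 where v: "e1 \<in> Xs" "e2 \<in> Xs" "e1 \<noteq> e2" "v \<in> e1" "v \<in> e2" by blast
      then have vU: "v \<in> U" using sub by blast
      have "card (nbr B v \<inter> U) + card {\<pi> M v} + 1 < card U" using dA[OF vU] cU by simp
      then obtain y where "y \<in> U" "y \<noteq> v" "y \<notin> nbr B v" "y \<noteq> \<pi> M v"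
        using ex_partner[OF fU vU, of "{\<pi> M v}"] by blast
      then show ?thesis using kill2[OF vU _ _ _ _ v(1-3)] v by blast
    next
      case False
      then have disj: "\<And>v e1 e2. \<lbrakk>e1 \<in> Xs; e2 \<in> Xs; v \<in> e1; v \<in> e2\<rbrakk> \<Longrightarrow> e1 = e2" by blast
      consider "card Xs \<le> 1" | "card Xs = 2" | "3 \<le> card Xs" by linarith
      then show ?thesis
      proof cases
        case 1
        then obtain f where f: "Xs \<subseteq> {f}" "finite f" "card f \<le> 2"
        proof (cases "Xs = {}")
          case True
          then show ?thesis using that[of "{}"] by simp
        next
          case False
          then have "card Xs = 1" using 1 fX by (simp add: card_gt_0_iff le_antisym Suc_leI)
          then obtain g where "Xs = {g}" by (meson card_1_singletonE)
          then show ?thesis using that[of g] inX[of g] finV by (auto simp: complete_edges_def intro: finite_subset)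
        qed
        have "matching_but B U {f}"
          by (rule matching_but_mono[OF mb fU]) (use f in auto)
        then show ?thesis using steady[OF ok _ f(2,3)] by blast
      next
        case 3
        then obtain T where T: "T \<subseteq> Xs" "card T = 3" by (meson obtain_subset_with_card_n)
        then obtain e1 e2 e3 where e: "T = {e1, e2, e3}" "e1 \<noteq> e2" "e1 \<noteq> e3" "e2 \<noteq> e3"
          by (metis card_3_iff)
        have eX: "e1 \<in> Xs" "e2 \<in> Xs" "e3 \<in> Xs" using T e by auto
        obtain a where a: "a \<in> e1" using inX[OF eX(1)] X_E by blast
        obtain c c' where c: "e2 = {c, c'}" "c \<noteq> c'" using inX[OF eX(2)] X_E by metis
        obtain d d' where d: "e3 = {d, d'}" "d \<noteq> d'" using inX[OF eX(3)] X_E by metis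
        have aU: "a \<in> U" using a sub eX by blast
        have "{c, c'} \<inter> {d, d'} = {}" using disj eX e c d by auto
        then have c4: "card (e2 \<union> e3) = 4" using c d by auto
        \<comment> \<open>Of the four ends of \<open>e2\<close> and \<open>e3\<close>, at most one
          is matched to \<open>a\<close> and at most one is \<open>\<pi> M a\<close>; the others may
          be joined to \<open>a\<close>, which destroys two exceptional edges.\<close>
        have "card (nbr (B - Xs) a \<inter> U) \<le> 1" using mb aU by (auto simp: matching_but_def)
        then have "card ((nbr (B - Xs) a \<inter> U) \<union> {\<pi> M a}) < 4"
          using card_Un_le[of "nbr (B - Xs) a \<inter> U" "{\<pi> M a}"] by simp
        then have "\<not> e2 \<union> e3 \<subseteq> (nbr (B - Xs) a \<inter> U) \<union> {\<pi> M a}"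
          using card_mono[of "(nbr (B - Xs) a \<inter> U) \<union> {\<pi> M a}" "e2 \<union> e3"] c4 fU by auto
        then obtain y where y: "y \<in> e2 \<union> e3" "y \<notin> nbr (B - Xs) a" "y \<noteq> \<pi> M a" "y \<in> U"
          using sub eX by blast
        have ne: "y \<notin> e1" using y disj eX e by blast
        have "y \<notin> nbr B a"
        proof
          assume "y \<in> nbr B a"
          then have "{a, y} \<in> Xs" using y(2) by (auto simp: nbr_def)
          then have "{a, y} = e1" using disj eX a by blast
          then show False using ne by blast
        qed
        moreover have "y \<noteq> a" using ne a by blast
        ultimately show ?thesis
          using kill2[OF aU y(4) _ _ y(3) eX(1), of e2] kill2[OF aU y(4) _ _ y(3) eX(1), of e3] e eX a y(1) by blast
      next
        case 2
        then obtain e1 e2 where e: "Xs = {e1, e2}" "e1 \<noteq> e2" by (meson card_2_iff)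
        have eX: "e1 \<in> Xs" "e2 \<in> Xs" using e by auto
        obtain a b where a: "e1 = {a, b}" "a \<noteq> b" using inX[OF eX(1)] X_E by metis
        obtain c0 d0 where c0: "e2 = {c0, d0}" "c0 \<noteq> d0" using inX[OF eX(2)] X_E by metis
        have aU: "a \<in> U" "b \<in> U" using a sub eX by blast+
        have dj: "e1 \<inter> e2 = {}" using disj e by blast
        show ?thesis
        proof (cases "\<exists>q\<in>e2. q \<notin> nbr B a \<and> q \<noteq> \<pi> M a")
          case True
          then obtain q where q: "q \<in> e2" "q \<notin> nbr B a" "q \<noteq> \<pi> M a" by blast
          then show ?thesis
            using kill_all[OF ok c3 aU(1) _ _ q(2,3) mb] sub[OF eX(2)] dj a e by auto
        next
          case False
          \<comment> \<open>Only one end of \<open>e2\<close> can be \<open>\<pi> M a\<close>, so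
            another one, \<open>c\<close>, is joined to \<open>a\<close> by a matching edge.
            Spending \<open>a\<close> on an unrelated \<open>g\<close> destroys \<open>e1\<close>
            and also frees \<open>c\<close> from that matching edge, as
            \<open>two_extras_free_end\<close> requires.\<close>
          then obtain c where c: "c \<in> e2" "c \<in> nbr B a" using c0 by auto
          have cU: "c \<in> U" using c sub eX by blast
          have ca: "c \<noteq> a" using c dj a by auto
          have "a \<notin> e2" "c \<notin> e1" using c dj a by auto
          then have "{c, a} \<noteq> e1" "{c, a} \<noteq> e2" by blast+
          moreover have "{c, a} \<in> B" using c(2) by (simp add: nbr_def insert_commute)
          ultimately have cA: "a \<in> nbr (B - Xs) c" by (simp add: nbr_def e(1))
          have "card {\<pi> M a, b, c0, d0} \<le> 4" using card_insert_le_m1[of 4 "{b,c0,d0}"] card_insert_le_m1[of 3 "{c0,d0}"] card_insert_le_m1[of 2 "{d0}"] by simp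
          then have "card (nbr B a \<inter> U) + card {\<pi> M a, b, c0, d0} + 1 < card U"
            using dA[OF aU(1)] less.prems(4) 2 by simp
          then obtain g where g: "g \<in> U" "g \<noteq> a" "g \<notin> nbr B a" "g \<noteq> \<pi> M a" "g \<noteq> b" "g \<notin> e2"
            using ex_partner[OF fU aU(1), of "{\<pi> M a, b, c0, d0}"] c0 by blast
          show ?thesis
          proof (rule round[OF ok c3 aU(1) g(1-4)])
            fix f M' assume f: "f \<in> X" "f \<notin> B" and ok': "ok M' (insert f B) (U - {a, g})"
            have "{e\<in>Xs. a \<notin> e \<and> g \<notin> e} = {e2}" using e a g dj by auto
            then have mb': "matching_but (insert f B) (U - {a, g}) {e2, f}"
              using matching_but_round[OF mb fU, of f a g] by (simp add: insert_commute)
            have "card (nbr (B - Xs) c \<inter> U) \<le> 1" using mb cU by (auto simp: matching_but_def)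
            then have na: "nbr (B - Xs) c \<inter> U \<subseteq> {a}"
              using cA aU fU by (metis IntI card_1_singleton_iff card_le_Suc0_iff_eq finite_Int One_nat_def insertI1 singletonD subsetI)
            have "nbr (insert f B - {e2, f}) c \<inter> (U - {a, g}) \<subseteq> nbr (B - Xs) c \<inter> U - {a}"
              using c dj by (auto simp: nbr_def e)
            then have n0: "nbr (insert f B - {e2, f}) c \<inter> (U - {a, g}) = {}" using na by blast
            have "card (U - {a, g}) + 2 = card U" using aU g fU c3 by (simp add: card_Diff_insert)
            then have c8: "8 \<le> card (U - {a, g})" using less.prems(4) by simp
            show "mwins X Win N M' (insert f B)"
              by (rule two_extras_free_end[OF ok' c8 mb' c(1) _ n0 inX[OF eX(2)] f(1)]) (use cU ca g c in auto)
          qed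
        qed
      qed
    qed
  qed
qed

end

text \<open>A lower bound for \<open>card U\<close> throughout stage \<open>i\<close>. When a stage
  stops, at most \<open>K + 2\<close> vertices of degree at most \<open>K\<close> are exceptional,
  so at most \<open>(K + 2) * K\<close> edges meet them. This counts twice in stage 0, because
  \<open>extras\<close> spends two vertices per edge; \<open>K + 20\<close> leaves enough partners,
  and the last summand provides for the next lower stage.\<close>

primrec thr :: "nat \<Rightarrow> nat \<Rightarrow> nat" where
  "thr K 0 = 2 * ((K + 2) * K) + K + 20"
| "thr K (Suc i) = 3 * ((K + 2) * K) + K + 20 + (2 * i + 3) * thr K i"

lemma thr_ge: "thr K 0 \<le> thr K i"
  by (cases i) auto

section \<open>Thinning out Breaker's graph on the deficient vertices\<close>

context pairing_game
begin

text \<open>As \<open>x\<close> and \<open>y\<close> are not adjacent, no edge is counted in both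
  degrees. The 2 on the right is Breaker's reply, counted from both ends.\<close>

lemma ec_remove:
  assumes BX: "B \<subseteq> X" and U: "finite U" and xy: "x \<in> U" "y \<in> U" "x \<noteq> y" "y \<notin> nbr B x" and f: "f \<in> X"
  shows "ec (insert f B) (U - {x, y}) (U - {x, y}) + 2 * card (nbr B x \<inter> U) + 2 * card (nbr B y \<inter> U) \<le> ec B U U + 2"
proof -
  let ?W = "U - {x, y}" and ?P = "{x, y}"
  have sub: "?P \<subseteq> U" using xy by blast
  obtain a b where f: "f = {a, b}" "a \<noteq> b" using f X_E by metis
  have "{x, y} \<notin> B" using xy(4) by (simp add: nbr_def)
  moreover have "{x, x} \<notin> B" "{y, y} \<notin> B" using BX X_edge by blast+
  ultimately have P0: "ec B ?P ?P = 0"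
    by (subst ec_eq_0_iff) (auto simp: insert_commute)
  have 1: "ec B U U = ec B ?P U + ec B ?W U" using ec_diff1[OF U sub] .
  have 2: "ec B ?W U = ec B ?W ?P + ec B ?W ?W" using ec_diff2[OF U sub] .
  have 3: "ec B ?P U = ec B ?P ?W" using ec_diff2[OF U sub, of B ?P] P0 by simp
  have 4: "ec B ?P U = card (nbr B x \<inter> U) + card (nbr B y \<inter> U)"
    using xy(3) by (subst ec_sum) (simp add: ec_single U)
  have 5: "ec (insert f B) ?W ?W \<le> ec B ?W ?W + 2"
    using ec_insert_le[of ?W ?W a b B] f U by (auto simp: of_bool_def split: if_splits)
  show ?thesis using 1 2 3 4 5 ec_sym[of B ?W ?P] by linarith
qed

text \<open>The exempted edge is Breaker's latest reply, which may have lifted the degrees of its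
  ends to \<open>K + 1\<close>.\<close>

definition low :: "nat \<Rightarrow> 'v set set \<Rightarrow> 'v set \<Rightarrow> bool" where
  "low K B U \<longleftrightarrow> (\<exists>f. \<forall>v\<in>U. card (nbr (B - {f}) v \<inter> U) \<le> K)"

lemma low_insert:
  assumes "\<forall>v\<in>U'. card (nbr B v \<inter> U) \<le> K" "finite U" "U' \<subseteq> U"
  shows "low K (insert f B) U'"
  unfolding low_def
proof (intro exI ballI)
  fix v assume "v \<in> U'"
  have "card (nbr (insert f B - {f}) v \<inter> U') \<le> card (nbr B v \<inter> U)"
    using assms by (intro card_mono) (auto simp: nbr_def)
  then show "card (nbr (insert f B - {f}) v \<inter> U') \<le> K" using assms \<open>v \<in> U'\<close> by fastforce
qed

lemma low_if_bounded: "\<forall>v\<in>U. card (nbr B v \<inter> U) \<le> K \<Longrightarrow> low K B U"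
  unfolding low_def by (rule exI[of _ "{}"]) (simp add: nbr_def)

text \<open>
  In stage \<open>i\<close> every round destroys at least \<open>2 * i + 3\<close> of Breaker's edges inside \<open>U\<close>, either by using
  a vertex of degree above \<open>K\<close> or two non-adjacent vertices of degree at least \<open>i + 2\<close>; hence the
  difference of \<open>(2 * i + 3) * card U\<close> and \<open>ec B U U\<close> does not decrease.
\<close>

lemma thinning_round:
  assumes ok: "ok M B U" and low: "low K B U" and ec: "ec B U U + (2 * i + 3) * t \<le> (2 * i + 3) * card U"
    and t: "thr K 0 \<le> t" and K: "2 * i + 3 \<le> K"
    and stop: "\<And>M B U. \<lbrakk>ok M B U; \<forall>v\<in>U. card (nbr B v \<inter> U) \<le> K; t \<le> card U;
      card {v\<in>U. i + 2 \<le> card (nbr B v \<inter> U)} \<le> K + 2\<rbrakk> \<Longrightarrow> mwins X Win N M B"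
  shows "mwins X Win N M B"
  using ok low ec
proof (induction "card U" arbitrary: M B U rule: less_induct)
  case less
  note ok = less.prems(1) and low = less.prems(2) and ec = less.prems(3)
  have fU: "finite U" and BX: "B \<subseteq> X" using ok_fin ok by blast+
  have "(2 * i + 3) * t \<le> (2 * i + 3) * card U" using ec by linarith
  then have tU: "t \<le> card U" by (metis mult_le_cancel1 add_gr_0 zero_less_numeral)
  then have c: "K + 20 \<le> card U" using t by simp
  \<comment> \<open>The pair takes at least \<open>2 * (2 * i + 4)\<close> from \<open>ec\<close>
    and Breaker's reply restores at most 2, so \<open>ec\<close> falls at least as much as
    \<open>(2 * i + 3) * card U\<close>.\<close>
  have round': ?case if xy: "x \<in> U" "y \<in> U" "y \<noteq> x" "y \<notin> nbr B x" "y \<noteq> \<pi> M x"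
    and deg: "2 * i + 4 \<le> card (nbr B x \<inter> U) + card (nbr B y \<inter> U)"
    and lw: "\<forall>v\<in>U - {x, y}. card (nbr B v \<inter> (U - {x})) \<le> K" for x y
  proof (rule round[OF ok _ xy])
    show "3 \<le> card U" using c by simp
    fix f M' assume f: "f \<in> X" "f \<notin> B" and ok': "ok M' (insert f B) (U - {x, y})"
    have cU: "card (U - {x, y}) + 2 = card U" using xy fU c by (simp add: card_Diff_insert)
    have e: "ec (insert f B) (U - {x, y}) (U - {x, y}) + 2 * (2 * i + 3) \<le> ec B U U"
      using ec_remove[OF BX fU xy(1,2) _ xy(4) f(1)] xy(3) deg by simp
    show "mwins X Win N M' (insert f B)"
    proof (rule less.hyps[OF _ ok'])
      show "low K (insert f B) (U - {x, y})"
        by (rule low_insert[OF lw]) (use fU in auto)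
      have "(2 * i + 3) * card U = (2 * i + 3) * card (U - {x, y}) + 2 * (2 * i + 3)"
        unfolding cU[symmetric] by algebra
      then show "ec (insert f B) (U - {x, y}) (U - {x, y}) + (2 * i + 3) * t \<le> (2 * i + 3) * card (U - {x, y})"
        using e ec by linarith
    qed (use cU in simp)
  qed
  obtain f where f: "\<And>v. v \<in> U \<Longrightarrow> card (nbr (B - {f}) v \<inter> U) \<le> K" using low unfolding low_def by blast
  show ?case
  proof (cases "\<exists>x\<in>U. K < card (nbr B x \<inter> U)")
    case True
    then obtain x where x: "x \<in> U" "K < card (nbr B x \<inter> U)" by blast
    have "card (nbr B x \<inter> U) \<le> K + 1" using card_nbr_Diff[OF fU, of "{f}" B x] f[OF x(1)] by simp
    then have "card (nbr B x \<inter> U) + card {\<pi> M x} + 1 < card U" using c by simp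
    then obtain y where y: "y \<in> U" "y \<noteq> x" "y \<notin> nbr B x" "y \<noteq> \<pi> M x"
      using ex_partner[OF fU x(1), of "{\<pi> M x}"] by blast
    \<comment> \<open>A degree above \<open>K\<close> can only come from the exempted edge; removing
      \<open>x\<close> removes that edge and thus restores the bound \<open>K\<close> for all
      others.\<close>
    have "x \<in> f"
    proof (rule ccontr)
      assume "x \<notin> f"
      then have "nbr (B - {f}) x = nbr B x" by (auto simp: nbr_def)
      then show False using f[OF x(1)] x(2) by simp
    qed
    have "card (nbr B v \<inter> (U - {x})) \<le> K" if "v \<in> U - {x, y}" for v
    proof -
      have "card (nbr B v \<inter> (U - {x})) \<le> card (nbr (B - {f}) v \<inter> U)"
        using that \<open>x \<in> f\<close> fU by (intro card_mono) (auto simp: nbr_def)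
      then show ?thesis using f[of v] that by fastforce
    qed
    then show ?thesis using round'[OF x(1) y] x(2) K by simp
  next
    case False
    then have lw: "\<forall>v\<in>U. card (nbr B v \<inter> U) \<le> K" by (meson not_less)
    define H where "H = {v\<in>U. i + 2 \<le> card (nbr B v \<inter> U)}"
    have fH: "finite H" using fU by (simp add: H_def)
    show ?thesis
    proof (cases "card H \<le> K + 2")
      case True
      then show ?thesis using stop[OF ok lw tU] by (simp add: H_def)
    next
      case False
      then obtain x where x: "x \<in> H" by fastforce
      have xU: "x \<in> U" using x by (simp add: H_def)
      have "card (nbr B x \<inter> H) \<le> K"
        using lw xU card_mono[of "nbr B x \<inter> U" "nbr B x \<inter> H"] fU by (fastforce simp: H_def)
      then have "card (nbr B x \<inter> H) + card {\<pi> M x} + 1 < card H" using False by simp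
      then obtain y where y: "y \<in> H" "y \<noteq> x" "y \<notin> nbr B x" "y \<noteq> \<pi> M x"
        using ex_partner[OF fH x, of "{\<pi> M x}"] by blast
      have yU: "y \<in> U" using y by (simp add: H_def)
      have "card (nbr B v \<inter> (U - {x})) \<le> K" if "v \<in> U - {x, y}" for v
        using lw that card_mono[of "nbr B v \<inter> U" "nbr B v \<inter> (U - {x})"] fU by fastforce
      then show ?thesis using round'[OF xU yU y(2-4)] x y by (auto simp: H_def)
    qed
  qed
qed

text \<open>Stage \<open>Suc i\<close> stops with degrees at most \<open>i + 2\<close> outside
  \<open>K + 2\<close> vertices, so \<open>ec\<close> is about \<open>(i + 2) * card U\<close>,
  which is less than the \<open>(2 * i + 3) * card U\<close> allowed at the start of stage
  \<open>i\<close>. After stage 0 almost all degrees are at most 1, and the edges at the remaining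
  vertices become the exceptional edges of \<open>extras\<close>.\<close>

lemma thinning_stage:
  assumes "ok M B U" "low K B U" "ec B U U + (2 * i + 3) * thr K i \<le> (2 * i + 3) * card U" "2 * i + 3 \<le> K"
  shows "mwins X Win N M B"
  using assms
proof (induction i arbitrary: M B U)
  case 0
  show ?case
  proof (rule thinning_round[OF 0(1-3) _ 0(4)])
    fix M B and U :: "'v set"
    assume ok: "ok M B U" and lw: "\<forall>v\<in>U. card (nbr B v \<inter> U) \<le> K" and t: "thr K 0 \<le> card U"
      and H: "card {v \<in> U. 0 + 2 \<le> card (nbr B v \<inter> U)} \<le> K + 2"
    define H where "H = {v \<in> U. 2 \<le> card (nbr B v \<inter> U)}"
    define Xs where "Xs = (\<Union>h\<in>H. (\<lambda>u. {h, u}) ` (nbr B h \<inter> U))"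
    have fU: "finite U" using ok_fin ok by blast
    then have fH: "finite H" by (simp add: H_def)
    have fX: "finite Xs" using fU fH by (auto simp: Xs_def)
    have "card Xs \<le> (\<Sum>h\<in>H. card ((\<lambda>u. {h, u}) ` (nbr B h \<inter> U)))"
      unfolding Xs_def by (rule card_UN_le[OF fH])
    also have "\<dots> \<le> (\<Sum>h\<in>H. K)"
    proof (rule sum_mono)
      fix h assume "h \<in> H"
      then show "card ((\<lambda>u. {h, u}) ` (nbr B h \<inter> U)) \<le> K"
        using lw card_image_le[of "nbr B h \<inter> U" "\<lambda>u. {h, u}"] fU by (fastforce simp: H_def)
    qed
    also have "\<dots> \<le> (K + 2) * K" using H by (simp add: H_def del: add_2_eq_Suc')
    finally have cX: "card Xs \<le> (K + 2) * K" .
    have "matching_but B U Xs"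
      unfolding matching_but_def
    proof
      fix v assume v: "v \<in> U"
      show "card (nbr (B - Xs) v \<inter> U) \<le> 1"
      proof (cases "v \<in> H")
        case True
        then have "nbr (B - Xs) v \<inter> U = {}" by (auto simp: Xs_def nbr_def)
        then show ?thesis by simp
      next
        case False
        have "card (nbr (B - Xs) v \<inter> U) \<le> card (nbr B v \<inter> U)"
          using fU by (intro card_mono) (auto simp: nbr_def)
        then show ?thesis using False v by (simp add: H_def)
      qed
    qed
    then show "mwins X Win N M B" using extras[OF ok _ fX] cX t by simp
  qed simp
next
  case (Suc i)
  show ?case
  proof (rule thinning_round[OF Suc.prems(1-3) thr_ge Suc.prems(4)])
    fix M B and U :: "'v set"
    assume ok: "ok M B U" and lw: "\<forall>v\<in>U. card (nbr B v \<inter> U) \<le> K" and t: "thr K (Suc i) \<le> card U"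
      and H: "card {v \<in> U. Suc i + 2 \<le> card (nbr B v \<inter> U)} \<le> K + 2"
    define H where "H = {v \<in> U. Suc i + 2 \<le> card (nbr B v \<inter> U)}"
    have fU: "finite U" using ok_fin ok by blast
    have "ec B U U = (\<Sum>v\<in>U. card (nbr B v \<inter> U))" by (subst ec_sum) (simp add: ec_single fU)
    also have "\<dots> \<le> (\<Sum>v\<in>U. (i + 2) + of_bool (v \<in> H) * K)"
      using lw by (intro sum_mono) (auto simp: H_def of_bool_def)
    also have "\<dots> = (i + 2) * card U + (\<Sum>v\<in>U. of_bool (v \<in> H)) * K"
      by (simp only: sum.distrib sum_distrib_right) simp
    also have "(\<Sum>v\<in>U. of_bool (v \<in> H)) = card H"
      using fU by (simp add: H_def sum.If_cases of_bool_def Int_def)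
    also have "card H * K \<le> (K + 2) * K" using H by (simp add: H_def del: add_2_eq_Suc')
    finally have e: "ec B U U \<le> (i + 2) * card U + (K + 2) * K" by simp
    have "(K + 2) * K + (2 * i + 3) * thr K i \<le> card U" using t by simp
    also have "\<dots> \<le> (i + 1) * card U" by simp
    finally have "ec B U U + (2 * i + 3) * thr K i \<le> (i + 2) * card U + (i + 1) * card U" using e by linarith
    also have "\<dots> = (2 * i + 3) * card U" by algebra
    finally have "ec B U U + (2 * i + 3) * thr K i \<le> (2 * i + 3) * card U" .
    moreover have "low K B U" using lw by (rule low_if_bounded)
    ultimately show "mwins X Win N M B" using Suc.IH[OF ok] Suc.prems(4) by simp
  qed
qed

text \<open>A vertex of degree above \<open>K\<close>, with any partner, lowers \<open>ec\<close> by
  at least \<open>2 * K\<close>, the drop of \<open>K * card U\<close>; hence at least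
  \<open>u\<close> vertices survive. A partner exists because \<open>ok\<close> bounds the
  Breaker-degree by \<open>mm - card U\<close>, which is below \<open>card U - 2\<close> by
  \<open>mm + 2 < 2 * u\<close>.\<close>

lemma truncation:
  assumes ok: "ok M B U" and u: "mm + 2 < 2 * u" "3 \<le> u" and ec: "K * u + ec B U U \<le> K * card U" and K: "2 \<le> K"
    and ec': "ec B U U \<le> e"
    and stop: "\<And>M B U. \<lbrakk>ok M B U; \<forall>v\<in>U. card (nbr B v \<inter> U) \<le> K; u \<le> card U; ec B U U \<le> e\<rbrakk> \<Longrightarrow> mwins X Win N M B"
  shows "mwins X Win N M B"
  using ok ec ec'
proof (induction "card U" arbitrary: M B U rule: less_induct)
  case less
  note ok = less.prems(1) and ec = less.prems(2) and ec' = less.prems(3)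
  have fU: "finite U" and BX: "B \<subseteq> X" using ok_fin ok by blast+
  have "K * u \<le> K * card U" using ec by linarith
  then have uU: "u \<le> card U" using K by simp
  show ?case
  proof (cases "\<forall>v\<in>U. card (nbr B v \<inter> U) \<le> K")
    case True
    then show ?thesis using stop[OF ok _ uU ec'] by blast
  next
    case False
    then obtain x where x: "x \<in> U" "K < card (nbr B x \<inter> U)" by (meson not_less)
    have "card (nbr B x \<inter> U) \<le> degr B x" unfolding degr_def using fin_nbr[OF BX] by (intro card_mono) auto
    moreover have "degr B x + card U \<le> mm" using ok x(1) by (auto simp: ok_def)
    ultimately have "card (nbr B x \<inter> U) + card {\<pi> M x} + 1 < card U" using u uU by simp
    then obtain y where y: "y \<in> U" "y \<noteq> x" "y \<notin> nbr B x" "y \<noteq> \<pi> M x"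
      using ex_partner[OF fU x(1), of "{\<pi> M x}"] by blast
    show ?thesis
    proof (rule round[OF ok _ x(1) y])
      show "3 \<le> card U" using u uU by simp
      fix f M' assume f: "f \<in> X" "f \<notin> B" and ok': "ok M' (insert f B) (U - {x, y})"
      have cU: "card (U - {x, y}) + 2 = card U" using x y fU u uU by (simp add: card_Diff_insert)
      have e: "ec (insert f B) (U - {x, y}) (U - {x, y}) + 2 * K \<le> ec B U U"
        using ec_remove[OF BX fU x(1) y(1) _ y(3) f(1)] y(2) x(2) by simp
      have "K * card U = K * card (U - {x, y}) + 2 * K" unfolding cU[symmetric] by algebra
      then show "mwins X Win N M' (insert f B)"
        using e ec ec' cU by (intro less.hyps[OF _ ok']) linarith+
    qed
  qed
qed

text \<open>Truncating at \<open>8 * c + 8\<close> uses up at most one eighth of \<open>U\<close>,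
  since \<open>(8 * c + 8) * (n div 8)\<close> is at least \<open>c * n\<close>. The remaining
  vertices still satisfy \<open>ec B U U \<le> c * n\<close>, and \<open>(2 * c + 3)\<close> times
  seven eighths of \<open>n\<close> exceeds this by enough to start the thinning in stage
  \<open>c\<close>.\<close>

theorem cleanup:
  assumes ok: "ok M B U" and ec: "ec B U U \<le> c * card U" and mm: "4 * mm + 12 \<le> 7 * card U"
    and big: "8 * thr (8 * c + 8) c + 8 * c + 8 \<le> card U"
  shows "mwins X Win N M B"
proof -
  define K where "K = 8 * c + 8"
  define n where "n = card U"
  define u where "u = n - n div 8"
  have "n < 8 * (n div 8) + 8" by (metis mod_less_divisor mult_div_mod_eq nat_add_left_cancel_less zero_less_numeral)
  then have n8: "n \<le> 8 * (n div 8) + 7" "8 * (n div 8) \<le> n" by auto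
  have u8: "7 * n \<le> 8 * u" "u + n div 8 = n" using n8 unfolding u_def by linarith+
  have big': "8 * thr K c + 8 * c + 8 \<le> n" using big by (simp add: K_def n_def)
  have "c * n \<le> c * (8 * (n div 8)) + c * 7" using n8(1) by (metis add_mult_distrib2 mult_le_mono2)
  also have "c * 7 \<le> 8 * (n div 8)" using big' n8 by linarith
  finally have e1: "c * n \<le> K * (n div 8)" by (simp add: K_def algebra_simps)
  have "K * u + c * n \<le> K * (u + n div 8)" using e1 by (simp add: add_mult_distrib2)
  then have K: "K * u + ec B U U \<le> K * card U" using ec u8(2) by (simp add: n_def)
  show ?thesis
  proof (rule truncation[OF ok _ _ K])
    show "mm + 2 < 2 * u" using mm u8 by (simp add: n_def)
    show "3 \<le> u" using u8 big' by linarith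
    show "2 \<le> K" by (simp add: K_def)
    show "ec B U U \<le> c * n" using ec by (simp add: n_def)
    fix M B and U :: "'v set"
    assume ok: "ok M B U" and lw: "\<forall>v\<in>U. card (nbr B v \<inter> U) \<le> K" and uU: "u \<le> card U" and e: "ec B U U \<le> c * n"
    have "8 * (c * n) + 8 * ((2 * c + 3) * thr K c) \<le> (2 * c + 3) * (7 * n)"
    proof -
      have "(2 * c + 3) * (8 * thr K c) \<le> (2 * c + 3) * n" using big' by (intro mult_le_mono2) simp
      then show ?thesis by (simp add: algebra_simps)
    qed
    also have "\<dots> \<le> (2 * c + 3) * (8 * card U)" using u8 uU by (intro mult_le_mono2) linarith
    finally have "ec B U U + (2 * c + 3) * thr K c \<le> (2 * c + 3) * card U" using e by simp
    moreover have "low K B U" using lw by (rule low_if_bounded)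
    ultimately show "mwins X Win N M B" by (intro thinning_stage[OF ok]) (auto simp: K_def)
  qed
qed

end

section \<open>A sufficient condition for k-connectivity\<close>

locale tree_parts = finite_graph V for V :: "'v set" +
  fixes k s :: nat and W :: "nat \<Rightarrow> 'v set"
  assumes k3: "3 \<le> k" and s2: "2 \<le> s"
    and W_V: "j < k \<Longrightarrow> W j \<subseteq> V" and card_W: "j < k \<Longrightarrow> card (W j) = s"
    and W_disj: "\<lbrakk>i < k; j < k; i \<noteq> j\<rbrakk> \<Longrightarrow> W i \<inter> W j = {}"
begin

text \<open>Called leaves below, as each of them becomes a leaf attached to every tree.\<close>

definition Lam :: "'v set" where
  "Lam = V - (\<Union>j<k. W j)"

text \<open>The condition on \<open>ec M Y Y\<close>, which counts every edge twice, says that \<open>M\<close> is a forest on \<open>W j\<close>.\<close>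

definition forest_state :: "'v set set \<Rightarrow> bool" where
  "forest_state M \<longleftrightarrow> M \<subseteq> X \<and> (\<forall>v\<in>V. degr M v \<le> k) \<and>
     (\<forall>j<k. \<forall>w\<in>W j. \<forall>v. {w, v} \<in> M \<longrightarrow> v \<in> W j \<or> v \<in> Lam) \<and>
     (\<forall>l\<in>Lam. \<forall>v\<in>Lam. {l, v} \<notin> M) \<and>
     (\<forall>j<k. \<forall>Y\<subseteq>W j. Y \<noteq> {} \<longrightarrow> ec M Y Y + 2 \<le> 2 * card Y) \<and>
     (\<forall>l\<in>Lam. \<forall>j<k. ec M {l} (W j) \<le> 1)"

text \<open>Connectivity is expressed by cuts because an empty cut is what \<open>tree_move\<close>
  starts from.\<close>

definition trees_connected :: "'v set set \<Rightarrow> bool" where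
  "trees_connected M \<longleftrightarrow> (\<forall>j<k. \<forall>K\<subseteq>W j. K \<noteq> {} \<longrightarrow> K \<noteq> W j \<longrightarrow> ec M K (W j - K) \<noteq> 0)"

lemma fin_W: "j < k \<Longrightarrow> finite (W j)"
  using W_V finV finite_subset by metis

lemma fin_sub_W: "\<lbrakk>j < k; A \<subseteq> W j\<rbrakk> \<Longrightarrow> finite A"
  using fin_W finite_subset by metis

lemma fin_Lam: "finite Lam"
  using finV by (simp add: Lam_def)

lemma Lam_V: "Lam \<subseteq> V"
  by (auto simp: Lam_def)

lemma W_Lam: "j < k \<Longrightarrow> W j \<inter> Lam = {}"
  by (auto simp: Lam_def)

lemma V_cases:
  assumes "v \<in> V"
  obtains "v \<in> Lam" | j where "j < k" "v \<in> W j"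
  using assms by (auto simp: Lam_def)

lemma card_Lam: "card Lam + k * s = card V"
proof -
  have "card (\<Union>j<k. W j) = (\<Sum>j<k. card (W j))"
    by (rule card_UN_disjoint) (use fin_W W_disj in auto)
  then have "card (\<Union>j<k. W j) = k * s" using card_W by simp
  moreover have "(\<Union>j<k. W j) \<subseteq> V" using W_V by blast
  ultimately show ?thesis unfolding Lam_def using finV
    by (metis card_Diff_subset card_mono finite_subset le_add_diff_inverse2)
qed

lemma forest_stateD:
  assumes "forest_state M"
  shows "M \<subseteq> X" "\<And>v. v \<in> V \<Longrightarrow> degr M v \<le> k"
    "\<And>j w v. \<lbrakk>j < k; w \<in> W j; {w, v} \<in> M\<rbrakk> \<Longrightarrow> v \<in> W j \<or> v \<in> Lam"
    "\<And>l v. \<lbrakk>l \<in> Lam; v \<in> Lam\<rbrakk> \<Longrightarrow> {l, v} \<notin> M"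
    "\<And>j Y. \<lbrakk>j < k; Y \<subseteq> W j; Y \<noteq> {}\<rbrakk> \<Longrightarrow> ec M Y Y + 2 \<le> 2 * card Y"
    "\<And>l j. \<lbrakk>l \<in> Lam; j < k\<rbrakk> \<Longrightarrow> ec M {l} (W j) \<le> 1"
  using assms by (simp_all add: forest_state_def)

lemma degr_W:
  assumes M: "forest_state M" and j: "j < k" and A: "A \<subseteq> W j"
  shows "(\<Sum>w\<in>A. degr M w) = ec M A (W j) + ec M A Lam"
proof -
  have fA: "finite A" using fin_sub_W[OF j A] .
  have sub: "W j \<union> Lam \<subseteq> V" using W_V[OF j] Lam_V by blast
  have "ec M A (V - (W j \<union> Lam)) = 0"
    using forest_stateD(3)[OF M j] A finV fA by (subst ec_eq_0_iff) auto
  then have "ec M A V = ec M A (W j \<union> Lam)" using ec_diff2[OF finV sub, of M A] by simp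
  also have "\<dots> = ec M A (W j) + ec M A Lam" by (rule ec_Un2[OF fin_W[OF j] fin_Lam W_Lam[OF j]])
  finally show ?thesis using sum_degr[OF forest_stateD(1)[OF M]] by simp
qed

lemma degr_Lam:
  assumes M: "forest_state M" and l: "l \<in> Lam"
  shows "degr M l = (\<Sum>j<k. ec M {l} (W j))"
proof -
  have "V = (\<Union>j<k. W j) \<union> Lam" using W_V by (auto simp: Lam_def)
  then have "degr M l = ec M {l} ((\<Union>j<k. W j) \<union> Lam)" using degr_ec[OF forest_stateD(1)[OF M]] by simp
  also have "\<dots> = ec M {l} (\<Union>j<k. W j) + ec M {l} Lam"
    by (rule ec_Un2) (use fin_W fin_Lam in \<open>auto simp: Lam_def\<close>)
  also have "ec M {l} Lam = 0" using forest_stateD(4)[OF M l] fin_Lam by (subst ec_eq_0_iff) auto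
  also have "ec M {l} (\<Union>j<k. W j) = (\<Sum>j<k. ec M {l} (W j))"
    by (rule ec_UN2) (use fin_W W_disj in auto)
  finally show ?thesis by simp
qed

text \<open>Growing a vertex set along nonempty cuts yields at least \<open>s - 1\<close> edges; the
  forest condition allows no more.\<close>

lemma trees_connected_edges:
  assumes M: "forest_state M" and c: "trees_connected M" and j: "j < k"
  shows "ec M (W j) (W j) + 2 = 2 * s"
proof -
  have "\<exists>A\<subseteq>W j. card A = i \<and> 2 * i \<le> ec M A A + 2" if "1 \<le> i" "i \<le> s" for i
    using that
  proof (induction i rule: dec_induct)
    case base
    have "W j \<noteq> {}" using card_W[OF j] s2 by auto
    then obtain w where "w \<in> W j" by blast
    then show ?case by (intro exI[of _ "{w}"]) auto
  next
    case (step i)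
    then obtain A where A: "A \<subseteq> W j" "card A = i" "2 * i \<le> ec M A A + 2" by auto
    have fA: "finite A" using fin_sub_W[OF j A(1)] .
    have "A \<noteq> {}" "A \<noteq> W j" using A step card_W[OF j] by auto
    then have "ec M A (W j - A) \<noteq> 0" using c A(1) j by (auto simp: trees_connected_def)
    then obtain a b where ab: "a \<in> A" "b \<in> W j - A" "{a, b} \<in> M"
      using fA fin_W[OF j] by (subst (asm) ec_eq_0_iff) auto
    have "ec M A {b} \<noteq> 0" using ab fA by (subst ec_eq_0_iff) auto
    then have "0 < ec M A {b}" by simp
    moreover have "ec M A A + ec M A {b} + ec M {b} A \<le> ec M (A \<union> {b}) (A \<union> {b})"
      using ab fA by (simp add: ec_Un1 ec_Un2 del: Un_insert_right)
    ultimately have "2 * i + 2 \<le> ec M (A \<union> {b}) (A \<union> {b}) + 2"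
      using A(3) ec_sym[of M "{b}" A] by linarith
    then have "2 * Suc i \<le> ec M (A \<union> {b}) (A \<union> {b}) + 2" by simp
    then show ?case using A(1,2) ab fA by (intro exI[of _ "A \<union> {b}"]) auto
  qed
  then obtain A where A: "A \<subseteq> W j" "card A = s" "2 * s \<le> ec M A A + 2" using s2 by (meson le_refl one_le_numeral order_trans)
  then have "A = W j" using card_subset_eq[OF fin_W[OF j]] card_W[OF j] by simp
  moreover have "W j \<noteq> {}" using card_W[OF j] s2 by auto
  ultimately show ?thesis using A forest_stateD(5)[OF M j, of "W j"] card_W[OF j] by simp
qed

text \<open>\<open>M0\<close> is the graph before the endgame. Let \<open>C\<close> be reachable
  from a tree untouched by \<open>S\<close>, and \<open>D\<close> the rest. Degree counting in a
  tree shows that \<open>D\<close> meets it in at most one vertex, which is deficient and has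
  \<open>S\<close> as its \<open>M0\<close>-neighbourhood. Its additional edge would lead to a
  vertex of the same kind in another tree, but vertices in different trees cannot share this
  neighbourhood. The other end of the additional edge is therefore arbitrary.\<close>

theorem vertex_connected_if_trees:
  assumes st: "forest_state M0" and con: "trees_connected M0"
    and leaf: "\<And>l j. \<lbrakk>l \<in> Lam; j < k\<rbrakk> \<Longrightarrow> ec M0 {l} (W j) = 1"
    and deg: "\<And>v. v \<in> V \<Longrightarrow> k \<le> degr M0 v + 1"
    and indep: "\<And>u v. \<lbrakk>u \<in> V; v \<in> V; degr M0 u < k; degr M0 v < k\<rbrakk> \<Longrightarrow> {u, v} \<notin> M0"
    and sub: "M0 \<subseteq> M" "M \<subseteq> X"
    and extra: "\<And>u. \<lbrakk>u \<in> V; degr M0 u < k\<rbrakk> \<Longrightarrow> \<exists>v. {u, v} \<in> M \<and> {u, v} \<notin> M0"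
  shows "vertex_connected k V M"
proof -
  have kV: "k < card V"
  proof -
    have "k * 2 \<le> k * s" using s2 by simp
    then show ?thesis using card_Lam k3 by linarith
  qed
  moreover have "connected_graph (V - S) {e \<in> M. e \<inter> S = {}}" if S: "S \<subseteq> V" "card S < k" for S
  proof -
    have fS: "finite S" using S finV finite_subset by blast
    have "V - S \<noteq> {}" using kV S by auto
    moreover
    define R where "R = {(x, y). {x, y} \<in> {e \<in> M. e \<inter> S = {}}}"
    have "\<exists>h<k. W h \<inter> S = {}"
    proof (rule ccontr)
      assume "\<not> ?thesis"
      then have "\<forall>h\<in>{..<k}. \<exists>x. x \<in> W h \<inter> S" by blast
      then obtain g where g: "\<And>h. h < k \<Longrightarrow> g h \<in> W h \<inter> S" by (metis lessThan_iff)
      have "inj_on g {..<k}" using g W_disj by (intro inj_onI) (metis IntD1 IntI empty_iff lessThan_iff)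
      then have "k \<le> card S" using card_inj_on_le[of g "{..<k}" S] g fS by auto
      then show False using S by simp
    qed
    then obtain h where h: "h < k" "W h \<inter> S = {}" by blast
    have "W h \<noteq> {}" using card_W[OF h(1)] s2 by auto
    then obtain r where r: "r \<in> W h" by blast
    define C where "C = {v \<in> V - S. (r, v) \<in> R\<^sup>*}"
    have clos: "w \<in> C" if "v \<in> C" "{v, w} \<in> M" "w \<notin> S" for v w
    proof -
      have "w \<in> V" using that(2) sub(2) X_edge by blast
      moreover have "(v, w) \<in> R" using that by (auto simp: R_def C_def)
      ultimately show ?thesis using that by (auto simp: C_def intro: rtrancl_into_rtrancl)
    qed
    have rC: "r \<in> C" using r h W_V[OF h(1)] by (auto simp: C_def)
    have WhC: "W h \<subseteq> C"
    proof (rule ccontr)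
      assume n: "\<not> W h \<subseteq> C"
      have "ec M0 (W h \<inter> C) (W h - W h \<inter> C) \<noteq> 0"
        using con h(1) n r rC unfolding trees_connected_def by blast
      then obtain a b where ab: "a \<in> W h \<inter> C" "b \<in> W h - W h \<inter> C" "{a, b} \<in> M0"
        using fin_W[OF h(1)] by (subst (asm) ec_eq_0_iff) auto
      then have "b \<in> C" using clos[of a b] sub h by blast
      then show False using ab by blast
    qed
    have LC: "l \<in> C" if l: "l \<in> Lam" "l \<notin> S" for l
    proof -
      have "ec M0 {l} (W h) \<noteq> 0" using leaf[OF l(1) h(1)] by simp
      then obtain w where "w \<in> W h" "{l, w} \<in> M0" using fin_W[OF h(1)] by (subst (asm) ec_eq_0_iff) auto
      then show ?thesis using clos[of w l] WhC sub l by (auto simp: insert_commute)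
    qed
    define D where "D = V - S - C"
    have nD: "y \<in> D \<or> y \<in> S" if "x \<in> D" "{x, y} \<in> M" for x y
    proof -
      have "y \<in> V" using that sub X_edge by blast
      then show ?thesis using clos[of y x] that by (auto simp: D_def insert_commute)
    qed
    \<comment> \<open>Edges of \<open>M0\<close> leaving \<open>Y\<close> within its tree end in
      \<open>Z\<close>, and those to leaves end in \<open>P\<close>. A leaf in \<open>P\<close> has
      at most one neighbour in \<open>Y\<close>, and \<open>Z\<close> is charged through the forest
      condition on \<open>Y \<union> Z\<close>.\<close>
    have key: "\<exists>u. D \<inter> W j = {u} \<and> degr M0 u < k \<and> nbr M0 u = S" if j: "j < k" and ne: "D \<inter> W j \<noteq> {}" for j
    proof -
      define Y where "Y = D \<inter> W j"
      define Z where "Z = S \<inter> W j"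
      define P where "P = S \<inter> Lam"
      define T where "T = {y\<in>Y. degr M0 y < k}"
      have YW: "Y \<subseteq> W j" and ZW: "Z \<subseteq> W j" by (auto simp: Y_def Z_def)
      have fin: "finite Y" "finite Z" "finite P" using fin_sub_W[OF j YW] fin_sub_W[OF j ZW] fS by (auto simp: P_def)
      have YZ: "Y \<inter> Z = {}" by (auto simp: Y_def Z_def D_def)
      have Y0: "Y \<noteq> {}" using ne by (simp add: Y_def)
      have "Z \<inter> P = {}" using W_Lam[OF j] by (auto simp: Z_def P_def)
      then have cS: "card Z + card P \<le> card S"
        using card_mono[OF fS, of "Z \<union> P"] fin by (auto simp: card_Un_disjoint Z_def P_def)
      have deg0: "(\<Sum>y\<in>Y. degr M0 y) = ec M0 Y (W j) + ec M0 Y Lam" by (rule degr_W[OF st j YW])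
      have "ec M0 Y (W j - (Y \<union> Z)) = 0"
        using nD sub fin fin_W[OF j] by (subst ec_eq_0_iff) (fastforce simp: Y_def Z_def)+
      then have e1: "ec M0 Y (W j) = ec M0 Y Y + ec M0 Y Z"
        using ec_diff2[OF fin_W[OF j], of "Y \<union> Z" M0 Y] YW ZW ec_Un2[OF fin(1,2) YZ] by simp
      have "ec M0 Y (Lam - P) = 0"
        using nD LC sub fin fin_Lam by (subst ec_eq_0_iff) (fastforce simp: Y_def P_def D_def)+
      then have e2: "ec M0 Y Lam = ec M0 Y P"
        using ec_diff2[OF fin_Lam, of P M0 Y] by (simp add: P_def)
      have "ec M0 P Y \<le> (\<Sum>l\<in>P. 1)"
        unfolding ec_sum[of M0 P]
      proof (rule sum_mono)
        fix l assume "l \<in> P"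
        then show "ec M0 {l} Y \<le> 1"
          using ec_mono[of M0 M0 "{l}" "{l}" Y "W j"] forest_stateD(6)[OF st _ j, of l] YW fin_W[OF j] by (auto simp: P_def)
      qed
      then have e3: "ec M0 Y P \<le> card P" using ec_sym[of M0 Y P] by simp
      have "ec M0 (Y \<union> Z) (Y \<union> Z) + 2 \<le> 2 * card (Y \<union> Z)"
        using forest_stateD(5)[OF st j, of "Y \<union> Z"] YW ZW Y0 by blast
      moreover have "ec M0 (Y \<union> Z) (Y \<union> Z) \<ge> ec M0 Y Y + ec M0 Y Z + ec M0 Z Y"
        using fin YZ by (simp add: ec_Un1 ec_Un2)
      ultimately have e4: "ec M0 Y Y + 2 * ec M0 Y Z + 2 \<le> 2 * card Y + 2 * card Z"
        using fin YZ ec_sym[of M0 Z Y] by (simp add: card_Un_disjoint)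
      have e5: "ec M0 Y Y + 2 \<le> 2 * card Y" using forest_stateD(5)[OF st j YW Y0] .
      have VY: "y \<in> V" if "y \<in> Y" for y using that by (auto simp: Y_def D_def)
      have "(\<Sum>y\<in>Y. k) \<le> (\<Sum>y\<in>Y. degr M0 y + of_bool (y \<in> T))"
        using deg VY by (intro sum_mono) (fastforce simp: T_def)
      also have "\<dots> = (\<Sum>y\<in>Y. degr M0 y) + card T"
        using fin by (simp add: sum.distrib T_def sum.If_cases of_bool_def Int_def)
      finally have e6: "k * card Y \<le> ec M0 Y Y + ec M0 Y Z + ec M0 Y P + card T"
        using deg0 e1 e2 by (simp add: mult.commute)
      have TY: "T \<subseteq> Y" by (auto simp: T_def)
      have cY: "1 \<le> card Y" using Y0 fin by (simp add: Suc_leI card_gt_0_iff)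
      obtain q where q: "k = 3 + q" using k3 le_Suc_ex by blast
      \<comment> \<open>Adding \<open>e4\<close> and \<open>e5\<close> and using \<open>e3\<close>,
        \<open>e6\<close> and \<open>card S < k\<close> gives
        \<open>k * card Y + 3 \<le> 2 * card Y + k + card T\<close>, which fails if
        \<open>card T < card Y\<close>.\<close>
      have "T = Y"
      proof (rule ccontr)
        assume "T \<noteq> Y"
        then have "card T < card Y" using TY fin by (intro psubset_card_mono) auto
        moreover have "q \<le> q * card Y" using cY by simp
        ultimately show False using e3 e4 e5 e6 cS S(2) unfolding q add_mult_distrib by linarith
      qed
      then have "degr M0 y < k" if "y \<in> Y" for y using that by (auto simp: T_def)
      then have e7: "ec M0 Y Y = 0"
        using indep fin VY by (subst ec_eq_0_iff) blast+
      \<comment> \<open>Without edges inside \<open>Y\<close> the count improves to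
        \<open>k * card Y + 2 \<le> 2 * card Y + k\<close>.\<close>
      have "card Y < 2"
      proof (rule ccontr)
        assume "\<not> card Y < 2"
        then have "2 \<le> card Y" by simp
        moreover from this have "q * 2 \<le> q * card Y" by simp
        ultimately show False using e3 e4 e6 e7 cS S(2) arg_cong[OF \<open>T = Y\<close>, of card] unfolding q add_mult_distrib by linarith
      qed
      then have "card Y = 1" using cY by simp
      then obtain u where u: "Y = {u}" by (meson card_1_singletonE)
      have uT: "degr M0 u < k" using \<open>T = Y\<close> u by (auto simp: T_def)
      have "nbr M0 u \<subseteq> S"
      proof
        fix z assume "z \<in> nbr M0 u"
        then have z: "{u, z} \<in> M0" by (simp add: nbr_def)
        then have uz: "z \<noteq> u" using sub X_edge by blast
        have uW: "u \<in> W j" "u \<in> D" using u by (auto simp: Y_def)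
        have "z \<in> D \<or> z \<in> S" using nD uW z sub by blast
        moreover have "z \<in> W j \<or> z \<in> Lam" using forest_stateD(3)[OF st j uW(1) z] .
        ultimately show "z \<in> S" using u uz LC by (auto simp: Y_def D_def)
      qed
      moreover have "card S \<le> card (nbr M0 u)"
        using deg[of u] VY u S(2) by (simp add: degr_def)
      ultimately have "nbr M0 u = S" using card_seteq[OF fS] by blast
      then show ?thesis using u uT by (auto simp: Y_def)
    qed
    have D0: "D = {}"
    proof (rule ccontr)
      assume "D \<noteq> {}"
      then obtain x where x: "x \<in> D" by blast
      have "x \<in> V" "x \<notin> Lam" using x LC by (auto simp: D_def)
      then obtain j where j: "j < k" "x \<in> W j" using V_cases by metis
      then obtain u where u: "D \<inter> W j = {u}" "degr M0 u < k" "nbr M0 u = S" using key[OF j(1)] x by blast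
      have uV: "u \<in> V" using u by (auto simp: D_def)
      obtain v where v: "{u, v} \<in> M" "{u, v} \<notin> M0" using extra[OF uV u(2)] by blast
      have uv: "u \<noteq> v" using v sub X_edge by blast
      \<comment> \<open>All of \<open>S\<close> is already joined to \<open>u\<close> in
        \<open>M0\<close>, so the new edge ends in \<open>D\<close>, hence in another tree
        \<open>W i\<close>. By \<open>key\<close> the neighbourhood of \<open>v\<close> is
        \<open>S\<close> as well, and this contains a neighbour of \<open>u\<close> inside
        \<open>W j\<close>.\<close>
      have "v \<notin> S" using u(3) v by (auto simp: nbr_def)
      then have vD: "v \<in> D" using nD[of u v] u v by blast
      have "v \<in> V" "v \<notin> Lam" using vD LC by (auto simp: D_def)
      then obtain i where i: "i < k" "v \<in> W i" using V_cases by metis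
      then have "v \<in> D \<inter> W i" using vD by blast
      moreover from this obtain t where "D \<inter> W i = {t}" "nbr M0 t = S" using key[OF i(1)] by blast
      ultimately have v3: "nbr M0 v = S" by simp
      have uj: "u \<in> W j" using u by blast
      have ij: "i \<noteq> j" using u(1) uv vD i(2) by (metis IntI singletonD)
      have "{u} \<noteq> W j" using card_W[OF j(1)] s2 by (auto dest: arg_cong[of _ _ card])
      then have "ec M0 {u} (W j - {u}) \<noteq> 0" using con j(1) uj unfolding trees_connected_def by blast
      then obtain z where z: "z \<in> W j" "{u, z} \<in> M0" using fin_W[OF j(1)] by (subst (asm) ec_eq_0_iff) auto
      then have "z \<in> nbr M0 v" using u(3) v3 by (auto simp: nbr_def)
      then have "z \<in> W i \<or> z \<in> Lam" using forest_stateD(3)[OF st i] by (auto simp: nbr_def)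
      then show False using z W_disj[OF i(1) j(1) ij] W_Lam[OF j(1)] by blast
    qed
    have "(u, v) \<in> R\<^sup>*" if "u \<in> V - S" "v \<in> V - S" for u v
    proof -
      have "(r, u) \<in> R\<^sup>*" "(r, v) \<in> R\<^sup>*" using that D0 by (auto simp: D_def C_def)
      moreover have "sym (R\<^sup>*)" by (rule sym_rtrancl) (auto simp: R_def sym_def insert_commute)
      ultimately show ?thesis by (meson symD rtrancl_trans)
    qed
    ultimately show ?thesis unfolding connected_graph_def R_def by blast
  qed
  ultimately show ?thesis unfolding vertex_connected_def by blast
qed

end

section \<open>Growing the trees\<close>

lemma ex_avoid: "\<lbrakk>finite P; card P \<le> m; m < card Q\<rbrakk> \<Longrightarrow> \<exists>u\<in>Q. u \<notin> P"
  by (metis card_mono leD le_less_trans subsetI)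

text \<open>Greedy choice: each chosen vertex excludes itself and at most \<open>k\<close>
  neighbours.\<close>

lemma ex_independent_subset:
  assumes "finite A" "\<And>v. v \<in> A \<Longrightarrow> {v} \<notin> E" "\<And>v. v \<in> A \<Longrightarrow> card (nbr E v \<inter> A) \<le> k"
    "(k + 1) * i \<le> card A"
  shows "\<exists>I\<subseteq>A. card I = i \<and> (\<forall>u\<in>I. \<forall>v\<in>I. {u, v} \<notin> E)"
  using assms
proof (induction i arbitrary: A)
  case 0
  then show ?case by (intro exI[of _ "{}"]) auto
next
  case (Suc i)
  have "A \<noteq> {}" using Suc.prems(4) by auto
  then obtain v where v: "v \<in> A" by blast
  define A' where "A' = A - insert v (nbr E v \<inter> A)"
  have "card (insert v (nbr E v \<inter> A)) \<le> k + 1"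
    using Suc.prems(1) Suc.prems(3)[OF v] by (simp add: card_insert_if)
  moreover have "card A' = card A - card (insert v (nbr E v \<inter> A))"
    unfolding A'_def using Suc.prems(1) v by (intro card_Diff_subset) auto
  ultimately have c: "(k + 1) * i \<le> card A'" using Suc.prems(4) by simp
  have "card (nbr E u \<inter> A') \<le> k" if "u \<in> A'" for u
  proof -
    have "card (nbr E u \<inter> A') \<le> card (nbr E u \<inter> A)" using Suc.prems(1) by (intro card_mono) (auto simp: A'_def)
    then show ?thesis using Suc.prems(3)[of u] that by (auto simp: A'_def)
  qed
  then obtain I where I: "I \<subseteq> A'" "card I = i" "\<forall>u\<in>I. \<forall>v\<in>I. {u, v} \<notin> E"
    using Suc.IH[of A', OF _ _ _ c] Suc.prems(1,2) unfolding A'_def by blast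
  have "finite I" "v \<notin> I" using I(1) Suc.prems(1) by (auto simp: A'_def intro: finite_subset)
  then have "card (insert v I) = Suc i" using I by simp
  moreover have "\<forall>u\<in>insert v I. \<forall>w\<in>insert v I. {u, w} \<notin> E"
    using I Suc.prems(2)[OF v] unfolding A'_def nbr_def by (auto simp: insert_commute)
  ultimately show ?case using I v by (intro exI[of _ "insert v I"]) (auto simp: A'_def)
qed

context tree_parts
begin

text \<open>\<open>K\<close> is a union of components. A set \<open>Y\<close> containing both ends
  splits along \<open>K\<close> into two nonempty parts without edges between them; each part has
  slack 2 in the forest condition, and the new edge consumes one of the two.\<close>

lemma tree_move:
  assumes M: "forest_state M" and j: "j < k" and K: "K \<subseteq> W j" "ec M K (W j - K) = 0"
    and xy: "x \<in> K" "y \<in> W j - K" "degr M x < k" "degr M y < k"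
  shows "{x, y} \<notin> M" "forest_state (insert {x, y} M)"
proof -
  have fW: "finite (W j)" using fin_W[OF j] .
  have fK: "finite K" using fin_sub_W[OF j K(1)] .
  have ne: "x \<noteq> y" using xy by auto
  show nM: "{x, y} \<notin> M" using K(2) xy fK fW by (subst (asm) ec_eq_0_iff) auto
  have xyW: "x \<in> W j" "y \<in> W j" using xy K by auto
  have xyL: "x \<notin> Lam" "y \<notin> Lam" using xyW W_Lam[OF j] by auto
  have xyi: "i = j" if "i < k" "x \<in> W i \<or> y \<in> W i" for i
    using W_disj[OF that(1) j] that xyW by blast
  note [simp] = ec_insert[OF _ _ ne nM]
  note MX = forest_stateD(1)[OF M]
  show "forest_state (insert {x, y} M)"
    unfolding forest_state_def
  proof (intro conjI ballI allI impI)
    have "x \<in> V" "y \<in> V" using xyW W_V[OF j] by auto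
    then show "insert {x, y} M \<subseteq> X" using MX ne by (simp add: X_edge)
  next
    fix v assume "v \<in> V"
    then show "degr (insert {x, y} M) v \<le> k"
      using degr_insert[OF MX ne nM, of v] forest_stateD(2)[OF M, of v] xy by auto
  next
    fix i w v assume i: "i < k" "w \<in> W i" "{w, v} \<in> insert {x, y} M"
    then show "v \<in> W i \<or> v \<in> Lam"
      using forest_stateD(3)[OF M i(1,2)] xyi[OF i(1)] xyW by (auto simp: doubleton_eq_iff)
  next
    fix l v assume "l \<in> Lam" "v \<in> Lam"
    then show "{l, v} \<notin> insert {x, y} M"
      using forest_stateD(4)[OF M] xyL by (auto simp: doubleton_eq_iff)
  next
    fix l i assume "l \<in> Lam" "i < k"
    then show "ec (insert {x, y} M) {l} (W i) \<le> 1"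
      using forest_stateD(6)[OF M, of l i] xyL fin_W by auto
  next
    fix i Y assume Y: "i < k" "Y \<subseteq> W i" "Y \<noteq> {}"
    have fY: "finite Y" using fin_sub_W[OF Y(1,2)] .
    note sp = forest_stateD(5)[OF M]
    show "ec (insert {x, y} M) Y Y + 2 \<le> 2 * card Y"
    proof (cases "x \<in> Y \<and> y \<in> Y")
      case False
      then have "ec (insert {x, y} M) Y Y = ec M Y Y" using fY by auto
      then show ?thesis using sp[OF Y] by simp
    next
      case True
      then have ij: "i = j" using xyi Y by blast
      define A where "A = Y \<inter> K"
      define A' where "A' = Y - K"
      have Y_eq: "Y = A \<union> A'" "A \<inter> A' = {}" by (auto simp: A_def A'_def)
      have fA: "finite A" "finite A'" using fY by (auto simp: A_def A'_def)
      have ne': "A \<noteq> {}" "A' \<noteq> {}" using True xy by (auto simp: A_def A'_def)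
      have "ec M A A' \<le> ec M K (W j - K)"
        by (rule ec_mono) (use Y ij fK fW in \<open>auto simp: A_def A'_def\<close>)
      then have z: "ec M A A' = 0" "ec M A' A = 0" using K(2) ec_sym[of M A A'] by auto
      have "ec M Y Y = ec M A A + ec M A' A'"
        unfolding Y_eq(1) using fA Y_eq(2) z by (simp add: ec_Un1 ec_Un2)
      moreover have "ec M A A + 2 \<le> 2 * card A" "ec M A' A' + 2 \<le> 2 * card A'"
        using sp[OF Y(1), of A] sp[OF Y(1), of A'] ne' Y(2) by (auto simp: A_def A'_def)
      moreover have "card Y = card A + card A'" unfolding Y_eq(1) using fA Y_eq(2) by (rule card_Un_disjoint)
      ultimately show ?thesis using True fY by simp
    qed
  qed
qed

text \<open>A leaf has at most one neighbour per tree, so lacking one in \<open>W j\<close> already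
  bounds its degree by \<open>k - 1\<close>.\<close>

lemma leaf_move:
  assumes M: "forest_state M" and j: "j < k" and w: "w \<in> W j" "degr M w < k"
    and l: "l \<in> Lam" "ec M {l} (W j) = 0"
  shows "{l, w} \<notin> M" "l \<noteq> w" "degr M l < k" "forest_state (insert {l, w} M)"
proof -
  have fW: "finite (W j)" using fin_W[OF j] .
  show nM: "{l, w} \<notin> M" using l(2) w fW by (subst (asm) ec_eq_0_iff) auto
  have wL: "w \<notin> Lam" using w W_Lam[OF j] by auto
  show ne: "l \<noteq> w" using wL l by auto
  have lW: "l \<notin> W i" if "i < k" for i using W_Lam[OF that] l by auto
  have wi: "i = j" if "i < k" "w \<in> W i" for i
    using W_disj[OF that(1) j] that w by blast
  have "degr M l \<le> (\<Sum>i<k. of_bool (i \<noteq> j))"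
    unfolding degr_Lam[OF M l(1)] using forest_stateD(6)[OF M l(1)] l(2)
    by (intro sum_mono) auto
  also have "\<dots> < (\<Sum>i<k. 1)" using j by (intro sum_strict_mono_ex1) auto
  finally show dl: "degr M l < k" by simp
  note [simp] = ec_insert[OF _ _ ne nM]
  note MX = forest_stateD(1)[OF M]
  show "forest_state (insert {l, w} M)"
    unfolding forest_state_def
  proof (intro conjI ballI allI impI)
    have "w \<in> V" "l \<in> V" using w W_V[OF j] l Lam_V by auto
    then show "insert {l, w} M \<subseteq> X" using MX ne by (simp add: X_edge)
  next
    fix v assume "v \<in> V"
    then show "degr (insert {l, w} M) v \<le> k"
      using degr_insert[OF MX ne nM, of v] forest_stateD(2)[OF M, of v] w dl by auto
  next
    fix i u v assume i: "i < k" "u \<in> W i" "{u, v} \<in> insert {l, w} M"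
    then show "v \<in> W i \<or> v \<in> Lam"
      using forest_stateD(3)[OF M i(1,2)] lW[OF i(1)] l by (auto simp: doubleton_eq_iff)
  next
    fix u v assume "u \<in> Lam" "v \<in> Lam"
    then show "{u, v} \<notin> insert {l, w} M"
      using forest_stateD(4)[OF M] wL by (auto simp: doubleton_eq_iff)
  next
    fix u i assume u: "u \<in> Lam" "i < k"
    then show "ec (insert {l, w} M) {u} (W i) \<le> 1"
      using forest_stateD(6)[OF M u] wL fin_W[OF u(2)] lW[OF u(2)] l(2) wi[OF u(2)] by auto
  next
    fix i Y assume Y: "i < k" "Y \<subseteq> W i" "Y \<noteq> {}"
    have "l \<notin> Y" using Y lW by blast
    then show "ec (insert {l, w} M) Y Y + 2 \<le> 2 * card Y"
      using forest_stateD(5)[OF M Y] fin_sub_W[OF Y(1,2)] by simp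
  qed
qed

text \<open>Vertices of Maker-degree below \<open>k\<close> are called open. All others contribute
  the full \<open>k\<close> to the degree sum.\<close>

lemma open_count:
  assumes "forest_state M" "A \<subseteq> V"
  shows "k * card A \<le> (\<Sum>w\<in>A. degr M w) + k * card {w\<in>A. degr M w < k}"
proof -
  have fA: "finite A" using assms finV finite_subset by blast
  have "(\<Sum>w\<in>A. k) \<le> (\<Sum>w\<in>A. degr M w + of_bool (degr M w < k) * k)"
    by (intro sum_mono) auto
  also have "\<dots> = (\<Sum>w\<in>A. degr M w) + card {w\<in>A. degr M w < k} * k"
    using fA by (simp add: sum.distrib sum_distrib_right[symmetric] sum.If_cases of_bool_def Int_def)
  finally show ?thesis by (simp add: mult.commute)
qed

lemma open_count_le:
  assumes "forest_state M" "A \<subseteq> V"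
  shows "(\<Sum>w\<in>A. degr M w) + card {w\<in>A. degr M w < k} \<le> k * card A"
proof -
  have fA: "finite A" using assms finV finite_subset by blast
  have "(\<Sum>w\<in>A. degr M w) + card {w\<in>A. degr M w < k} = (\<Sum>w\<in>A. degr M w + of_bool (degr M w < k))"
    using fA by (simp add: sum.distrib sum.If_cases of_bool_def Int_def)
  also have "\<dots> \<le> (\<Sum>w\<in>A. k)"
    using assms forest_stateD(2)[OF assms(1)] by (intro sum_mono) fastforce
  finally show ?thesis by (simp add: mult.commute)
qed

definition lack :: "'v set set \<Rightarrow> nat \<Rightarrow> 'v set" where
  "lack M j = {l\<in>Lam. ec M {l} (W j) = 0}"

lemma card_lack:
  assumes M: "forest_state M" and j: "j < k"
  shows "card (lack M j) + ec M (W j) Lam = card Lam"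
proof -
  have "ec M (W j) Lam = (\<Sum>l\<in>Lam. ec M {l} (W j))" using ec_sym[of M "W j" Lam] ec_sum[of M Lam] by simp
  also have "\<dots> = (\<Sum>l\<in>Lam. of_bool (ec M {l} (W j) \<noteq> 0))"
    using forest_stateD(6)[OF M _ j] by (intro sum.cong) (auto intro: le_antisym)
  finally have "card (lack M j) + ec M (W j) Lam
     = (\<Sum>l\<in>Lam. of_bool (ec M {l} (W j) = 0) + of_bool (ec M {l} (W j) \<noteq> 0))"
    using fin_Lam by (simp add: sum.distrib lack_def sum.If_cases of_bool_def Int_def)
  also have "\<dots> = (\<Sum>l\<in>Lam. 1)" by (intro sum.cong) auto
  finally show ?thesis by simp
qed

lemma card_le_edges:
  assumes "forest_state M"
  shows "card M \<le> k * card V div 2"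
proof -
  have "2 * card M \<le> (\<Sum>v\<in>V. k)"
    using handshake[OF forest_stateD(1)[OF assms]] forest_stateD(2)[OF assms]
    by (metis sum_mono)
  then show ?thesis by (simp add: mult.commute)
qed

lemma trees_connected_mono: "\<lbrakk>trees_connected M; M \<subseteq> M'\<rbrakk> \<Longrightarrow> trees_connected M'"
  unfolding trees_connected_def using ec_mono[of M M'] fin_W fin_sub_W
  by (metis Diff_subset le_zero_eq order_refl finite_Diff)

lemma ex_lack_of_leaf:
  assumes M: "forest_state M" and l: "l \<in> Lam" "degr M l < k"
  shows "\<exists>j<k. l \<in> lack M j"
proof (rule ccontr)
  assume "\<not> ?thesis"
  then have "(\<Sum>j<k. 1) \<le> (\<Sum>j<k. ec M {l} (W j))" using l by (intro sum_mono) (auto simp: lack_def)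
  then show False using degr_Lam[OF M l(1)] l(2) by simp
qed

text \<open>Leaf edges arise here only from rescues, hence the bound \<open>d\<close>. The last
  condition keeps small components extendable: with at most one leaf edge per vertex, a closed set
  \<open>K\<close> of at most half the size of \<open>W j\<close> has degree sum at most
  \<open>3 * card K - 2\<close>, so one of its vertices is open. Since the complement of a closed
  set is closed, an unfinished tree always has such a \<open>K\<close>.\<close>

definition stage1 :: "'v set set \<Rightarrow> nat \<Rightarrow> bool" where
  "stage1 M d \<longleftrightarrow> forest_state M \<and> (\<forall>j<k. ec M (W j) Lam \<le> d) \<and>
     (\<forall>j<k. \<forall>w\<in>W j. ec M {w} Lam \<le> 1 \<or> (\<forall>K\<subseteq>W j. w \<in> K \<longrightarrow> ec M K (W j - K) = 0 \<longrightarrow> s < 2 * card K))"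

lemma stage1D:
  assumes "stage1 M d"
  shows "forest_state M" "\<And>j. j < k \<Longrightarrow> ec M (W j) Lam \<le> d"
    "\<And>j w K. \<lbrakk>j < k; w \<in> W j; K \<subseteq> W j; w \<in> K; ec M K (W j - K) = 0; 2 * card K \<le> s\<rbrakk> \<Longrightarrow> ec M {w} Lam \<le> 1"
  using assms by (auto simp: stage1_def) (metis not_less)

lemma closed_mono: "\<lbrakk>j < k; K \<subseteq> W j; M \<subseteq> M'; ec M' K (W j - K) = 0\<rbrakk> \<Longrightarrow> ec M K (W j - K) = 0"
  using ec_mono[of M M' K K "W j - K" "W j - K"] fin_W fin_sub_W by (metis finite_Diff le_zero_eq order_refl)

lemma stage1_tree_move:
  assumes M: "stage1 M d" and j: "j < k" and K: "K \<subseteq> W j" "ec M K (W j - K) = 0"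
    and xy: "x \<in> K" "y \<in> W j - K" "degr M x < k" "degr M y < k" and d: "d \<le> d'"
  shows "stage1 (insert {x, y} M) d'"
proof -
  note mv = tree_move[OF stage1D(1)[OF M] j K xy]
  have ne: "x \<noteq> y" using xy by auto
  have xyL: "x \<notin> Lam" "y \<notin> Lam" using xy K W_Lam[OF j] by auto
  note [simp] = ec_insert[OF _ fin_Lam ne mv(1)]
  show ?thesis unfolding stage1_def
  proof (intro conjI allI impI ballI)
    fix i assume "i < k"
    then show "ec (insert {x, y} M) (W i) Lam \<le> d'"
      using stage1D(2)[OF M, of i] xyL fin_W d by fastforce
  next
    fix i w assume i: "i < k" "w \<in> W i"
    show "ec (insert {x, y} M) {w} Lam \<le> 1 \<or> (\<forall>K\<subseteq>W i. w \<in> K \<longrightarrow> ec (insert {x, y} M) K (W i - K) = 0 \<longrightarrow> s < 2 * card K)"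
    proof (cases "ec M {w} Lam \<le> 1")
      case True
      then show ?thesis using xyL by simp
    next
      case False
      then have "\<forall>K\<subseteq>W i. w \<in> K \<longrightarrow> ec M K (W i - K) = 0 \<longrightarrow> s < 2 * card K"
        using M i unfolding stage1_def by blast
      then show ?thesis using closed_mono[OF i(1) _ subset_insertI[of M "{x, y}"]] by blast
    qed
  qed (use mv in auto)
qed

lemma stage1_leaf_move:
  assumes M: "stage1 M d" and j: "j < k" and w: "w \<in> W j" "degr M w < k"
    and l: "l \<in> lack M j"
    and small: "ec M {w} Lam = 0 \<or> (\<forall>K\<subseteq>W j. w \<in> K \<longrightarrow> ec M K (W j - K) = 0 \<longrightarrow> s < 2 * card K)"
  shows "stage1 (insert {l, w} M) (Suc d)"
proof -
  have l': "l \<in> Lam" "ec M {l} (W j) = 0" using l by (auto simp: lack_def)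
  note mv = leaf_move[OF stage1D(1)[OF M] j w l']
  have wL: "w \<notin> Lam" using w W_Lam[OF j] by auto
  have lW: "l \<notin> W i" if "i < k" for i using W_Lam[OF that] l' by auto
  note [simp] = ec_insert[OF _ fin_Lam mv(2,1)]
  show ?thesis unfolding stage1_def
  proof (intro conjI allI impI ballI)
    fix i assume "i < k"
    then show "ec (insert {l, w} M) (W i) Lam \<le> Suc d"
      using stage1D(2)[OF M, of i] wL fin_W lW by auto
  next
    fix i u assume i: "i < k" "u \<in> W i"
    have ij: "i = j" if "u = w" using W_disj[OF i(1) j] that i(2) w(1) by blast
    have ul: "u \<noteq> l" using lW i by auto
    show "ec (insert {l, w} M) {u} Lam \<le> 1 \<or> (\<forall>K\<subseteq>W i. u \<in> K \<longrightarrow> ec (insert {l, w} M) K (W i - K) = 0 \<longrightarrow> s < 2 * card K)"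
    proof (cases "ec M {u} Lam \<le> 1 \<and> (u = w \<longrightarrow> ec M {u} Lam = 0)")
      case True
      then show ?thesis using wL ul by auto
    next
      case False
      then have "\<forall>K\<subseteq>W i. u \<in> K \<longrightarrow> ec M K (W i - K) = 0 \<longrightarrow> s < 2 * card K"
        using M i small ij unfolding stage1_def by metis
      then show ?thesis using closed_mono[OF i(1) _ subset_insertI[of M "{l, w}"]] by blast
    qed
  qed (use mv in auto)
qed

lemma many_open_outside:
  assumes M: "stage1 M d" and j: "j < k" and K: "K \<subseteq> W j" "ec M K (W j - K) = 0" "2 * card K \<le> s"
    and c: "2 * (d + k * m) < s"
  shows "m < card {w\<in>W j - K. degr M w < k}"
proof -
  let ?A = "W j - K"
  note st = stage1D(1)[OF M]
  have fK: "finite K" and fW: "finite (W j)" using fin_sub_W[OF j K(1)] fin_W[OF j] by auto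
  have cA: "card ?A + card K = s" using card_W[OF j] K(1) fK fW
    by (metis card_Diff_subset card_mono le_add_diff_inverse2)
  have "0 < card ?A" using cA K(3) s2 by linarith
  then have A0: "?A \<noteq> {}" by (metis card.empty less_irrefl)
  have "k * card ?A \<le> (\<Sum>w\<in>?A. degr M w) + k * card {w\<in>?A. degr M w < k}"
    using W_V[OF j] by (intro open_count[OF st]) auto
  also have "(\<Sum>w\<in>?A. degr M w) = ec M ?A (W j) + ec M ?A Lam" by (rule degr_W[OF st j]) auto
  also have "ec M ?A (W j) = ec M ?A ?A"
    using ec_diff2[OF fW K(1), of M ?A] K(2) ec_sym[of M ?A K] by simp
  also have "ec M ?A Lam \<le> d"
    using ec_mono[of M M ?A "W j" Lam Lam] stage1D(2)[OF M j] fW fin_Lam by fastforce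
  finally have "k * card ?A + 2 \<le> 2 * card ?A + d + k * card {w\<in>?A. degr M w < k}"
    using forest_stateD(5)[OF st j, of ?A] A0 by simp
  moreover have "3 * card ?A \<le> k * card ?A" using k3 by simp
  ultimately have "card ?A < d + k * card {w\<in>?A. degr M w < k}" by linarith
  moreover have "p < r" if "a < d + r" "2 * (d + p) < s" "2 * b \<le> s" "a + b = s" for a b p r :: nat
    using that by presburger
  ultimately have "k * m < k * card {w\<in>?A. degr M w < k}" using c K(3) cA by blast
  then show ?thesis by simp
qed

text \<open>Supplies the partners for rescuing a leaf: a tree vertex without a leaf edge may receive
  one whatever the size of its component.\<close>

lemma many_open_fresh:
  assumes M: "stage1 M d" and j: "j < k" and c: "k * (d + m) < s"
  shows "m < card {w\<in>W j. ec M {w} Lam = 0 \<and> degr M w < k}"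
proof -
  let ?A = "{w\<in>W j. ec M {w} Lam = 0}"
  note st = stage1D(1)[OF M]
  have fW: "finite (W j)" using fin_W[OF j] by auto
  have W0: "W j \<noteq> {}" using card_W[OF j] s2 by auto
  have "card (W j - ?A) \<le> (\<Sum>w\<in>W j. ec M {w} Lam)"
  proof -
    have "card (W j - ?A) = (\<Sum>w\<in>W j. of_bool (ec M {w} Lam \<noteq> 0))"
      using fW by (simp add: sum.If_cases of_bool_def set_diff_eq Int_def) (metis (lifting))
    also have "\<dots> \<le> (\<Sum>w\<in>W j. ec M {w} Lam)" by (intro sum_mono) auto
    finally show ?thesis .
  qed
  then have "card (W j - ?A) \<le> d" using stage1D(2)[OF M j] ec_sum[of M "W j" Lam] by simp
  moreover have "card (W j - ?A) + card ?A = s" using card_W[OF j] fW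
    by (metis (no_types, lifting) card_Diff_subset card_mono finite_subset le_add_diff_inverse2 mem_Collect_eq subsetI)
  ultimately have cA: "s \<le> card ?A + d" by linarith
  have "k * card ?A \<le> (\<Sum>w\<in>?A. degr M w) + k * card {w\<in>?A. degr M w < k}"
    using W_V[OF j] by (intro open_count[OF st]) auto
  also have "(\<Sum>w\<in>?A. degr M w) = ec M ?A (W j) + ec M ?A Lam" by (rule degr_W[OF st j]) auto
  also have "ec M ?A Lam = 0" by (subst ec_sum) simp
  also have "ec M ?A (W j) \<le> ec M (W j) (W j)" by (rule ec_mono) (use fW in auto)
  finally have 1: "k * card ?A + 2 \<le> 2 * s + k * card {w\<in>?A. degr M w < k}"
    using forest_stateD(5)[OF st j, of "W j"] W0 card_W[OF j] by simp
  have "k * s \<le> k * card ?A + k * d" using cA by (metis add_mult_distrib2 mult_le_mono2)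
  moreover have "3 * s \<le> k * s" using k3 by simp
  ultimately have "k * m < k * card {w\<in>?A. degr M w < k}" using 1 c unfolding add_mult_distrib2 by linarith
  then show ?thesis by simp
qed

lemma stage1_wins:
  fixes Win :: "'v set set \<Rightarrow> bool"
  assumes goal: "\<And>M B d. \<lbrakk>stage1 M d; trees_connected M; ctrl k L M B d\<rbrakk> \<Longrightarrow> mwins X Win N M B"
    and N: "N = k * card V div 2 + 1"
    and D: "2 * k * (N + 1) < D * (L + 1)" and m: "L + D + 1 \<le> m"
    and c1: "2 * (D + k * m) < s" and c2: "k * (D + m) < s" and c3: "D + m < card Lam"
    and start: "stage1 M d" "ctrl k L M B d"
  shows "mwins X Win N M B"
proof (rule controlled_stage[where I = "\<lambda>M d. stage1 M d \<and> \<not> trees_connected M"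
      and G = "\<lambda>M d. stage1 M d \<and> trees_connected M" and D = D and L = L and m = m and k = k and d = d])
  fix M d v
  assume "stage1 M d \<and> \<not> trees_connected M \<or> stage1 M d \<and> trees_connected M" "v \<in> V"
  then show "degr M v \<le> k" using stage1D(1) forest_stateD(2) by blast
next
  fix M d assume "stage1 M d \<and> \<not> trees_connected M"
  then show "card M < N" using card_le_edges[of M] stage1D(1) N by fastforce
next
  fix M d v and P :: "'v set"
  assume I: "stage1 M d \<and> \<not> trees_connected M" and dD: "d < D" and v: "v \<in> V" "degr M v < k"
    and P: "finite P" "card P \<le> m"
  have M: "stage1 M d" using I by blast
  note st = stage1D(1)[OF M]
  have "\<exists>u\<in>V - P. u \<noteq> v \<and> {u, v} \<notin> M \<and> stage1 (insert {u, v} M) (Suc d)"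
    using v(1)
  proof (cases rule: V_cases)
    case 1
    obtain j where j: "j < k" "v \<in> lack M j" using ex_lack_of_leaf[OF st 1 v(2)] by blast
    have "k * (d + m) \<le> k * (D + m)" using dD by simp
    then have "m < card {w\<in>W j. ec M {w} Lam = 0 \<and> degr M w < k}"
      using c2 by (intro many_open_fresh[OF M j(1)]) linarith
    then obtain w where w: "w \<in> W j" "ec M {w} Lam = 0" "degr M w < k" "w \<notin> P"
      using ex_avoid[OF P] by blast
    have "stage1 (insert {v, w} M) (Suc d)" using stage1_leaf_move[OF M j(1) w(1,3) j(2)] w(2) by blast
    moreover have "{v, w} \<notin> M" "v \<noteq> w" using leaf_move[OF st j(1) w(1,3) 1] j(2) by (auto simp: lack_def)
    ultimately show ?thesis using w W_V[OF j(1)] by (intro bexI[of _ w]) (auto simp: insert_commute)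
  next
    \<comment> \<open>A tree vertex in a closed set of at most half the size is rescued by a tree
      edge, any other by a leaf edge; the latter is compatible with the last condition of
      \<open>stage1\<close>.\<close>
    case (2 j)
    show ?thesis
    proof (cases "\<exists>K\<subseteq>W j. v \<in> K \<and> ec M K (W j - K) = 0 \<and> 2 * card K \<le> s")
      case True
      then obtain K where K: "K \<subseteq> W j" "ec M K (W j - K) = 0" "2 * card K \<le> s" "v \<in> K" by blast
      have "m < card {w\<in>W j - K. degr M w < k}"
        using c1 dD by (intro many_open_outside[OF M 2(1) K(1-3)]) simp
      then obtain w where w: "w \<in> W j - K" "degr M w < k" "w \<notin> P" using ex_avoid[OF P] by blast
      note mv = tree_move[OF st 2(1) K(1,2,4) w(1) v(2) w(2)]
      have "stage1 (insert {v, w} M) (Suc d)" using stage1_tree_move[OF M 2(1) K(1,2,4) w(1) v(2) w(2)] by simp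
      then show ?thesis using w mv(1) K W_V[OF 2(1)] by (intro bexI[of _ w]) (auto simp: insert_commute)
    next
      case False
      then have F: "\<forall>K\<subseteq>W j. v \<in> K \<longrightarrow> ec M K (W j - K) = 0 \<longrightarrow> s < 2 * card K" by (meson not_less)
      have "m < card (lack M j)" using card_lack[OF st 2(1)] stage1D(2)[OF M 2(1)] c3 dD by linarith
      then obtain l where l: "l \<in> lack M j" "l \<notin> P" using ex_avoid[OF P] by blast
      have l': "l \<in> Lam" "ec M {l} (W j) = 0" using l by (auto simp: lack_def)
      note mv = leaf_move[OF st 2 v(2) l']
      have "stage1 (insert {l, v} M) (Suc d)" using stage1_leaf_move[OF M 2 v(2) l(1)] F by blast
      then show ?thesis using mv l l' Lam_V by blast
    qed
  qed
  then show "\<exists>u\<in>V - P. u \<noteq> v \<and> {u, v} \<notin> M \<and>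
      (stage1 (insert {u, v} M) (Suc d) \<and> \<not> trees_connected (insert {u, v} M) \<or>
       stage1 (insert {u, v} M) (Suc d) \<and> trees_connected (insert {u, v} M))" by blast
next
  fix M d assume I: "stage1 M d \<and> \<not> trees_connected M" and dD: "d < D"
  then have M: "stage1 M d" by blast
  note st = stage1D(1)[OF M]
  obtain j K0 where j: "j < k" and K0: "K0 \<subseteq> W j" "K0 \<noteq> {}" "K0 \<noteq> W j" "ec M K0 (W j - K0) = 0"
    using I unfolding trees_connected_def by blast
  have fW: "finite (W j)" using fin_W[OF j] .
  obtain K where K: "K \<subseteq> W j" "K \<noteq> {}" "ec M K (W j - K) = 0" "2 * card K \<le> s"
  proof (cases "2 * card K0 \<le> s")
    case True
    then show ?thesis using that K0 by blast
  next
    case False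
    have eq: "W j - (W j - K0) = K0" using K0 by blast
    have "card (W j - K0) = s - card K0" using card_Diff_subset[of K0 "W j"] K0 fW card_W[OF j] finite_subset by metis
    then have "2 * card (W j - K0) \<le> s" using False by simp
    then show ?thesis using that[of "W j - K0"] K0 ec_sym[of M K0] eq by auto
  qed
  have "k * card K \<le> (\<Sum>w\<in>K. degr M w) + k * card {w\<in>K. degr M w < k}"
    using W_V[OF j] K(1) by (intro open_count[OF st]) auto
  also have "(\<Sum>w\<in>K. degr M w) = ec M K (W j) + ec M K Lam" by (rule degr_W[OF st j K(1)])
  also have "ec M K (W j) = ec M K K" using ec_diff2[OF fW K(1), of M K] K(3) by simp
  also have "ec M K Lam \<le> (\<Sum>w\<in>K. 1)"
    unfolding ec_sum[of M K] using stage1D(3)[OF M j _ K(1) _ K(3,4)] K(1) by (intro sum_mono) auto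
  finally have "k * card K + 2 \<le> 3 * card K + k * card {w\<in>K. degr M w < k}"
    using forest_stateD(5)[OF st j K(1,2)] by simp
  moreover have "3 * card K \<le> k * card K" using k3 by simp
  ultimately have "card {w\<in>K. degr M w < k} \<noteq> 0" by (intro notI) simp
  then have "{w\<in>K. degr M w < k} \<noteq> {}" by (metis card.empty)
  then obtain x where x: "x \<in> K" "degr M x < k" by blast
  have xV: "x \<in> V" using x K(1) W_V[OF j] by blast
  have mo: "m < card {w\<in>W j - K. degr M w < k}"
    using c1 dD by (intro many_open_outside[OF M j K(1,3,4)]) simp
  have "\<exists>u\<in>V - P. u \<noteq> x \<and> {u, x} \<notin> M \<and> stage1 (insert {u, x} M) d" if P: "finite P" "card P \<le> m" for P
  proof -
    obtain w where w: "w \<in> W j - K" "degr M w < k" "w \<notin> P" using ex_avoid[OF P mo] by blast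
    note mv = tree_move[OF st j K(1,3) x(1) w(1) x(2) w(2)]
    have "stage1 (insert {x, w} M) d" using stage1_tree_move[OF M j K(1,3) x(1) w(1) x(2) w(2)] by simp
    then show ?thesis using w mv(1) x W_V[OF j] by (intro bexI[of _ w]) (auto simp: insert_commute)
  qed
  then show "\<exists>v\<in>V. degr M v < k \<and> (\<forall>P. finite P \<and> card P \<le> m \<longrightarrow> (\<exists>u\<in>V - P. u \<noteq> v \<and> {u, v} \<notin> M \<and>
      (stage1 (insert {u, v} M) d \<and> \<not> trees_connected (insert {u, v} M) \<or>
       stage1 (insert {u, v} M) d \<and> trees_connected (insert {u, v} M))))"
    using xV x(2) by blast
qed (use goal D m start in auto)

text \<open>The last edge of the vertices in \<open>I j\<close> is kept for the endgame.\<close>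

definition stage2 :: "(nat \<Rightarrow> 'v set) \<Rightarrow> 'v set set \<Rightarrow> bool" where
  "stage2 I M \<longleftrightarrow> forest_state M \<and> trees_connected M \<and>
     (\<forall>j<k. I j \<subseteq> W j \<and> (\<forall>u\<in>I j. \<forall>v\<in>I j. {u, v} \<notin> M))"

definition filled :: "(nat \<Rightarrow> 'v set) \<Rightarrow> 'v set set \<Rightarrow> bool" where
  "filled I M \<longleftrightarrow> (\<forall>j<k. \<forall>w\<in>W j. degr M w < k \<longrightarrow> w \<in> I j \<and> k \<le> degr M w + 1)"

section \<open>Attaching the leaves while sparing the reserve sets \<open>I j\<close>\<close>

lemma stage2D:
  assumes "stage2 I M"
  shows "forest_state M" "trees_connected M" "\<And>j. j < k \<Longrightarrow> I j \<subseteq> W j"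
    "\<And>j u v. \<lbrakk>j < k; u \<in> I j; v \<in> I j\<rbrakk> \<Longrightarrow> {u, v} \<notin> M"
  using assms by (simp_all add: stage2_def)

lemma stage2_leaf_move:
  assumes M: "stage2 I M" and j: "j < k" and w: "w \<in> W j" "degr M w < k" and l: "l \<in> lack M j"
  shows "stage2 I (insert {l, w} M)" "{l, w} \<notin> M" "l \<noteq> w" "degr M l < k"
proof -
  have l': "l \<in> Lam" "ec M {l} (W j) = 0" using l by (auto simp: lack_def)
  note mv = leaf_move[OF stage2D(1)[OF M] j w l']
  show "{l, w} \<notin> M" "l \<noteq> w" "degr M l < k" using mv by auto
  have "l \<notin> W i" if "i < k" for i using W_Lam[OF that] l' by auto
  then have "{u, v} \<noteq> {l, w}" if "i < k" "u \<in> I i" "v \<in> I i" for i u v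
    using stage2D(3)[OF M that(1)] that by (auto simp: doubleton_eq_iff)
  then show "stage2 I (insert {l, w} M)"
    using mv(4) trees_connected_mono[OF stage2D(2)[OF M] subset_insertI] M by (auto simp: stage2_def)
qed

lemma sum_degr_W:
  assumes M: "forest_state M" "trees_connected M" and j: "j < k"
  shows "(\<Sum>w\<in>W j. degr M w) + 2 + card (lack M j) = 2 * s + card Lam"
  using degr_W[OF M(1) j order_refl] trees_connected_edges[OF M j] card_lack[OF M(1) j] by linarith

text \<open>\<open>\<Delta> + card (lack M j)\<close> is the total degree still missing in
  \<open>W j\<close>: from \<open>k * s\<close> the tree takes \<open>2 * s - 2\<close> and each
  attached leaf takes 1. An open vertex misses between 1 and \<open>k\<close> of it, which also
  explains the next two lemmas.\<close>

lemma open_lower: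
  assumes M: "forest_state M" "trees_connected M" and j: "j < k" and Delta: "\<Delta> + card Lam + 2 * s = k * s + 2"
  shows "\<Delta> + card (lack M j) \<le> k * card {w\<in>W j. degr M w < k}"
  using open_count[OF M(1) W_V[OF j]] card_W[OF j] sum_degr_W[OF M j] Delta by simp

lemma lack_lower:
  assumes M: "forest_state M" "trees_connected M" and j: "j < k" and Delta: "\<Delta> + card Lam + 2 * s = k * s + 2"
  shows "card {w\<in>W j. degr M w < k} \<le> \<Delta> + card (lack M j)"
  using open_count_le[OF M(1) W_V[OF j]] card_W[OF j] sum_degr_W[OF M j] Delta by simp

lemma open_filled:
  assumes M: "forest_state M" "trees_connected M" and j: "j < k" and Delta: "\<Delta> + card Lam + 2 * s = k * s + 2"
    and f: "filled I M"
  shows "card {w\<in>W j. degr M w < k} = \<Delta> + card (lack M j)"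
proof -
  have "(\<Sum>w\<in>W j. k) \<le> (\<Sum>w\<in>W j. degr M w + of_bool (degr M w < k))"
    using f j unfolding filled_def by (intro sum_mono) (fastforce simp: of_bool_def)
  also have "\<dots> = (\<Sum>w\<in>W j. degr M w) + card {w\<in>W j. degr M w < k}"
    using fin_W[OF j] by (simp add: sum.distrib sum.If_cases of_bool_def Int_def)
  finally have "k * s \<le> (\<Sum>w\<in>W j. degr M w) + card {w\<in>W j. degr M w < k}"
    using card_W[OF j] by (simp add: mult.commute)
  then show ?thesis using lack_lower[OF M j Delta] sum_degr_W[OF M j] Delta by linarith
qed

text \<open>Two supplies must outlast the stage. Open tree vertices do because
  \<open>\<Delta>\<close> exceeds \<open>k * m\<close>. Unattached leaves do because at least
  \<open>card (I j) - d\<close> reserve vertices are open, and by \<open>lack_lower\<close> this is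
  at most \<open>\<Delta> + card (lack M j)\<close>. Here \<open>d\<close> also bounds the number of
  reserve vertices that have become full.\<close>

lemma stage2a_wins:
  fixes Win :: "'v set set \<Rightarrow> bool"
  assumes goal: "\<And>M B d. \<lbrakk>stage2 I M; filled I M; ctrl k L M B d\<rbrakk> \<Longrightarrow> mwins X Win N M B"
    and N: "N = k * card V div 2 + 1"
    and D: "2 * k * (N + 1) < D * (L + 1)" and m: "L + D + 1 \<le> m"
    and Delta: "\<Delta> + card Lam + 2 * s = k * s + 2" "k * m < \<Delta>"
    and iota: "\<And>j. j < k \<Longrightarrow> \<Delta> + D + m < card (I j)"
    and start: "stage2 I M" "\<And>j. j < k \<Longrightarrow> card {w\<in>I j. degr M w = k} \<le> d" "ctrl k L M B d"
  shows "mwins X Win N M B"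
proof -
  define full where "full M d \<longleftrightarrow> (\<forall>j<k. card {w\<in>I j. degr M w = k} \<le> d)" for M d
  define ok where "ok M d \<longleftrightarrow> stage2 I M \<and> full M d" for M d
  have lackm: "m < card (lack M j)" if M: "ok M d" and j: "j < k" and d: "d < D" for M d j
  proof -
    have s2: "stage2 I M" using M by (simp add: ok_def)
    have "I j = {w\<in>I j. degr M w = k} \<union> {w\<in>I j. degr M w < k}"
      using forest_stateD(2)[OF stage2D(1)[OF s2]] stage2D(3)[OF s2 j] W_V[OF j] by force
    then have "card (I j) \<le> card {w\<in>I j. degr M w = k} + card {w\<in>I j. degr M w < k}"
      by (metis (no_types, lifting) card_Un_le)
    also have "card {w\<in>I j. degr M w = k} \<le> d" using M j by (auto simp: ok_def full_def)
    also have "card {w\<in>I j. degr M w < k} \<le> card {w\<in>W j. degr M w < k}"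
      using stage2D(3)[OF s2 j] fin_W[OF j] by (intro card_mono) auto
    also have "\<dots> \<le> \<Delta> + card (lack M j)" by (rule lack_lower[OF stage2D(1,2)[OF s2] j Delta(1)])
    finally show ?thesis using iota[OF j] d by linarith
  qed
  have openm: "m < card {w\<in>W j. degr M w < k}" if M: "ok M d" and j: "j < k" for M d j
  proof -
    have s2: "stage2 I M" using M by (simp add: ok_def)
    have "k * m < k * card {w\<in>W j. degr M w < k}"
      using open_lower[OF stage2D(1,2)[OF s2] j Delta(1)] Delta(2) by linarith
    then show ?thesis by simp
  qed
  have move: "ok (insert {l, w} M) (Suc d)"
    "(w \<in> I j \<Longrightarrow> degr M w + 1 < k) \<Longrightarrow> ok (insert {l, w} M) d"
    if M: "ok M d" and j: "j < k" and w: "w \<in> W j" "degr M w < k" and l: "l \<in> lack M j" for M d j w l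
  proof -
    have s2: "stage2 I M" using M by (simp add: ok_def)
    note mv = stage2_leaf_move[OF s2 j w l]
    have dg: "degr (insert {l, w} M) v = degr M v + of_bool (v = l \<or> v = w)" for v
      by (rule degr_insert[OF forest_stateD(1)[OF stage2D(1)[OF s2]] mv(3,2)])
    have lI: "v \<noteq> l" if "v \<in> I i" "i < k" for v i
      using that stage2D(3)[OF s2 that(2)] W_Lam[OF that(2)] l by (auto simp: lack_def)
    have sub: "{v\<in>I i. degr (insert {l, w} M) v = k} \<subseteq> insert w {v\<in>I i. degr M v = k}" if "i < k" for i
      using lI that by (auto simp: dg)
    have fin: "finite {v\<in>I i. degr M v = k}" if "i < k" for i
      using stage2D(3)[OF s2 that] fin_sub_W[OF that] by (metis (no_types, lifting) finite_subset mem_Collect_eq subsetI)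
    have "card {v\<in>I i. degr (insert {l, w} M) v = k} \<le> Suc d" if "i < k" for i
    proof -
      have "card {v\<in>I i. degr (insert {l, w} M) v = k} \<le> card (insert w {v\<in>I i. degr M v = k})"
        using sub[OF that] fin[OF that] by (intro card_mono) auto
      also have "\<dots> \<le> Suc (card {v\<in>I i. degr M v = k})" using fin[OF that] by (simp add: card_insert_if)
      finally show ?thesis using M that by (fastforce simp: ok_def full_def)
    qed
    then show "ok (insert {l, w} M) (Suc d)" using mv(1) by (auto simp: ok_def full_def)
    assume a: "w \<in> I j \<Longrightarrow> degr M w + 1 < k"
    have "{v\<in>I i. degr (insert {l, w} M) v = k} = {v\<in>I i. degr M v = k}" if i: "i < k" for i
    proof -
      have "degr M w + 1 < k" if "w \<in> I i"
      proof -
        have "i = j" using W_disj[OF i j] that stage2D(3)[OF s2 i] w(1) by blast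
        then show ?thesis using a that by blast
      qed
      then show ?thesis using lI i w(2) by (auto simp: dg)
    qed
    then show "ok (insert {l, w} M) d" using mv(1) M by (auto simp: ok_def full_def)
  qed
  show ?thesis
  proof (rule controlled_stage[where I = "\<lambda>M d. ok M d \<and> \<not> filled I M"
        and G = "\<lambda>M d. ok M d \<and> filled I M" and D = D and L = L and m = m and k = k and d = d])
    fix M d v
    assume "ok M d \<and> \<not> filled I M \<or> ok M d \<and> filled I M" "v \<in> V"
    then show "degr M v \<le> k" using stage2D(1) forest_stateD(2) by (auto simp: ok_def)
  next
    fix M d assume "ok M d \<and> \<not> filled I M"
    then show "card M < N" using card_le_edges[of M] stage2D(1) N by (fastforce simp: ok_def)
  next
    fix M d v and P :: "'v set"
    assume I: "ok M d \<and> \<not> filled I M" and dD: "d < D" and v: "v \<in> V" "degr M v < k"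
      and P: "finite P" "card P \<le> m"
    have M: "ok M d" and s2: "stage2 I M" using I by (auto simp: ok_def)
    have "\<exists>u\<in>V - P. u \<noteq> v \<and> {u, v} \<notin> M \<and> ok (insert {u, v} M) (Suc d)"
      using v(1)
    proof (cases rule: V_cases)
      case 1
      obtain j where j: "j < k" "v \<in> lack M j" using ex_lack_of_leaf[OF stage2D(1)[OF s2] 1 v(2)] by blast
      obtain w where w: "w \<in> W j" "degr M w < k" "w \<notin> P" using ex_avoid[OF P openm[OF M j(1)]] by blast
      show ?thesis
        using move(1)[OF M j(1) w(1,2) j(2)] stage2_leaf_move[OF s2 j(1) w(1,2) j(2)] w W_V[OF j(1)]
        by (intro bexI[of _ w]) (auto simp: insert_commute)
    next
      case (2 j)
      obtain l where l: "l \<in> lack M j" "l \<notin> P" using ex_avoid[OF P lackm[OF M 2(1) dD]] by blast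
      then show ?thesis
        using move(1)[OF M 2 v(2) l(1)] stage2_leaf_move[OF s2 2 v(2) l(1)] Lam_V
        by (intro bexI[of _ l]) (auto simp: lack_def)
    qed
    then show "\<exists>u\<in>V - P. u \<noteq> v \<and> {u, v} \<notin> M \<and>
      (ok (insert {u, v} M) (Suc d) \<and> \<not> filled I (insert {u, v} M) \<or>
       ok (insert {u, v} M) (Suc d) \<and> filled I (insert {u, v} M))" by blast
  next
    fix M d assume I: "ok M d \<and> \<not> filled I M" and dD: "d < D"
    then have M: "ok M d" and s2: "stage2 I M" by (auto simp: ok_def)
    obtain j w where w: "j < k" "w \<in> W j" "degr M w < k" "w \<in> I j \<Longrightarrow> degr M w + 1 < k"
      using I unfolding filled_def by fastforce
    have "\<exists>u\<in>V - P. u \<noteq> w \<and> {u, w} \<notin> M \<and> ok (insert {u, w} M) d" if P: "finite P" "card P \<le> m" for P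
    proof -
      obtain l where l: "l \<in> lack M j" "l \<notin> P" using ex_avoid[OF P lackm[OF M w(1) dD]] by blast
      then show ?thesis
        using move(2)[OF M w(1-3) l(1) w(4)] stage2_leaf_move[OF s2 w(1-3) l(1)] Lam_V
        by (intro bexI[of _ l]) (auto simp: lack_def)
    qed
    then show "\<exists>v\<in>V. degr M v < k \<and> (\<forall>P. finite P \<and> card P \<le> m \<longrightarrow> (\<exists>u\<in>V - P. u \<noteq> v \<and> {u, v} \<notin> M \<and>
      (ok (insert {u, v} M) d \<and> \<not> filled I (insert {u, v} M) \<or>
       ok (insert {u, v} M) d \<and> filled I (insert {u, v} M))))"
      using w W_V[OF w(1)] by blast
  qed (use goal D m start in \<open>auto simp: ok_def full_def\<close>)
qed

text \<open>By \<open>open_filled\<close> at most \<open>\<iota> - \<Delta>\<close> leaves are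
  unattached at each tree, so at most \<open>k * (\<iota> - \<Delta>)\<close> moves remain and none
  of them has to be a rescue. They use up reserve vertices until exactly \<open>\<Delta>\<close>
  open ones are left in each \<open>W j\<close>.\<close>

lemma stage2b_wins:
  fixes Win :: "'v set set \<Rightarrow> bool"
  assumes goal: "\<And>M B. \<lbrakk>stage2 I M; filled I M; \<And>j. j < k \<Longrightarrow> lack M j = {}; B \<subseteq> X; M \<inter> B = {};
      card B \<le> card M + 1; \<And>v. \<lbrakk>v \<in> V; degr M v < k\<rbrakk> \<Longrightarrow> degr B v \<le> m\<rbrakk> \<Longrightarrow> mwins X Win N M B"
    and N: "N = k * card V div 2 + 1"
    and Delta: "\<Delta> + card Lam + 2 * s = k * s + 2" "m < \<Delta>"
    and iota: "\<And>j. j < k \<Longrightarrow> card (I j) \<le> \<iota>"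
    and start: "stage2 I M" "filled I M" "ctrl k L M B d" and m: "L + d + 1 + k * (\<iota> - \<Delta>) \<le> m"
  shows "mwins X Win N M B"
proof -
  define mu where "mu M = (\<Sum>j<k. card (lack M j))" for M
  define ok where "ok M \<longleftrightarrow> stage2 I M \<and> filled I M" for M
  have finl: "finite (lack M j)" for M j using fin_Lam by (simp add: lack_def)
  have mu0: "mu M = 0 \<longleftrightarrow> (\<forall>j<k. lack M j = {})" for M
    using finl by (auto simp: mu_def)
  show ?thesis
  proof (rule short_stage[where I = "\<lambda>M. ok M \<and> mu M \<noteq> 0" and G = "\<lambda>M. ok M \<and> mu M = 0" and mu = mu and m = m and k = k])
    fix M assume "ok M \<and> mu M \<noteq> 0"
    then show "card M < N" using card_le_edges[of M] stage2D(1) N by (fastforce simp: ok_def)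
  next
    fix M assume a: "ok M \<and> mu M \<noteq> 0"
    then have s2: "stage2 I M" and f: "filled I M" by (auto simp: ok_def)
    note st = stage2D(1)[OF s2]
    obtain j l where j: "j < k" and l: "l \<in> lack M j" using a mu0[of M] by (metis all_not_in_conv)
    have lL: "l \<in> Lam" using l by (simp add: lack_def)
    have o: "m < card {w\<in>W j. degr M w < k}"
      using open_filled[OF st stage2D(2)[OF s2] j Delta(1) f] Delta(2) by simp
    obtain w0 where w0: "w0 \<in> W j" "degr M w0 < k" using o by (metis (no_types, lifting) card.empty empty_Collect_eq less_nat_zero_code)
    have "\<exists>u\<in>V - P. u \<noteq> l \<and> {u, l} \<notin> M \<and> mu (insert {u, l} M) < mu M \<and> ok (insert {u, l} M)"
      if P: "finite P" "card P \<le> m" for P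
    proof -
      obtain w where w: "w \<in> W j" "degr M w < k" "w \<notin> P" using ex_avoid[OF P o] by blast
      note mv = stage2_leaf_move[OF s2 j w(1,2) l]
      have dg: "degr (insert {l, w} M) v = degr M v + of_bool (v = l \<or> v = w)" for v
        by (rule degr_insert[OF forest_stateD(1)[OF st] mv(3,2)])
      have "filled I (insert {l, w} M)" unfolding filled_def
      proof (intro allI impI ballI)
        fix i v assume v: "i < k" "v \<in> W i" "degr (insert {l, w} M) v < k"
        then have "degr M v < k" using dg[of v] by linarith
        then show "v \<in> I i \<and> k \<le> degr (insert {l, w} M) v + 1" using f v dg[of v] by (fastforce simp: filled_def)
      qed
      then have ok': "ok (insert {l, w} M)" using mv(1) by (simp add: ok_def)
      have sub: "lack (insert {l, w} M) i \<subseteq> lack M i" if "i < k" for i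
      proof
        fix u assume u: "u \<in> lack (insert {l, w} M) i"
        have "ec M {u} (W i) \<le> ec (insert {l, w} M) {u} (W i)" by (rule ec_mono) (use fin_W[OF that] in auto)
        then show "u \<in> lack M i" using u by (simp add: lack_def)
      qed
      have "ec (insert {l, w} M) {l} (W j) \<noteq> 0"
        using w fin_W[OF j] by (subst ec_eq_0_iff) auto
      then have "l \<notin> lack (insert {l, w} M) j" by (simp add: lack_def)
      then have ps: "lack (insert {l, w} M) j \<subset> lack M j" using sub[OF j] l by blast
      have "\<forall>i\<in>{..<k}. card (lack (insert {l, w} M) i) \<le> card (lack M i)" using card_mono[OF finl sub] by blast
      moreover have "\<exists>i\<in>{..<k}. card (lack (insert {l, w} M) i) < card (lack M i)"
        using psubset_card_mono[OF finl ps] j by blast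
      ultimately have "mu (insert {l, w} M) < mu M" unfolding mu_def
        by (intro sum_strict_mono_ex1) auto
      then show ?thesis using ok' mv w W_V[OF j] by (intro bexI[of _ w]) (auto simp: insert_commute)
    qed
    then show "\<exists>v\<in>V. degr M v < k \<and> (\<forall>P. finite P \<and> card P \<le> m \<longrightarrow> (\<exists>u\<in>V - P. u \<noteq> v \<and> {u, v} \<notin> M \<and>
      mu (insert {u, v} M) < mu M \<and> (ok (insert {u, v} M) \<and> mu (insert {u, v} M) \<noteq> 0 \<or>
       ok (insert {u, v} M) \<and> mu (insert {u, v} M) = 0)))"
      using lL Lam_V stage2_leaf_move(4)[OF s2 j w0 l] by (intro bexI[of _ l]) blast+
  next
    fix M B assume "ok M \<and> mu M = 0" "M \<subseteq> X" "B \<subseteq> X" "M \<inter> B = {}" "card B \<le> card M + 1"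
      "\<forall>v\<in>V. degr M v < k \<longrightarrow> degr B v \<le> m"
    then show "mwins X Win N M B" using mu0 by (intro goal) (auto simp: ok_def)
  next
    show "ok M \<and> mu M \<noteq> 0 \<or> ok M \<and> mu M = 0" using start by (auto simp: ok_def)
    have lk: "card (lack M j) \<le> \<iota> - \<Delta>" if j: "j < k" for j
    proof -
      have "card {w\<in>W j. degr M w < k} \<le> card (I j)"
        using start(2) j stage2D(3)[OF start(1) j] fin_sub_W[OF j] by (intro card_mono) (auto simp: filled_def)
      then show ?thesis
        using open_filled[OF stage2D(1,2)[OF start(1)] j Delta(1) start(2)] iota[OF j] by simp
    qed
    have "mu M \<le> (\<Sum>j<k. \<iota> - \<Delta>)" unfolding mu_def using lk by (intro sum_mono) auto
    then have "mu M \<le> k * (\<iota> - \<Delta>)" by simp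
    then show "\<forall>v\<in>V. degr M v < k \<longrightarrow> degr B v + mu M \<le> m"
      using start(3) m by (fastforce simp: ctrl_def)
  qed (use start(3) in \<open>auto simp: ctrl_def\<close>)
qed

text \<open>A leftover vertex is joined to one outside \<open>U\<close>, so it costs a whole edge;
  this is what \<open>card M + card U \<le> N\<close> pays for.\<close>

lemma repair_wins:
  fixes Win :: "'v set set \<Rightarrow> bool"
  assumes U0: "U0 \<subseteq> V" "\<And>v. v \<in> U0 \<Longrightarrow> degr M0 v \<le> k" and M0X: "M0 \<subseteq> X"
    and goal: "\<And>M. \<lbrakk>M0 \<subseteq> M; M \<subseteq> X; \<forall>u\<in>U0. \<exists>v. {u, v} \<in> M \<and> {u, v} \<notin> M0\<rbrakk> \<Longrightarrow> Win M"
    and big: "mm + k + 2 < card V"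
    and M: "M0 \<subseteq> M" "M \<subseteq> X" "U \<subseteq> U0" "card U \<le> 2" "\<forall>u\<in>U0 - U. \<exists>v. {u, v} \<in> M \<and> {u, v} \<notin> M0"
      "\<forall>e\<in>M - M0. e \<inter> U = {}" "card M + card U \<le> N"
    and B: "B \<subseteq> X" "M \<inter> B = {}" "\<forall>v\<in>U. degr B v + card U \<le> mm"
  shows "mwins X Win N M B"
  using M B
proof (induction "card U" arbitrary: M B U rule: less_induct)
  case less
  note MX = less.prems(2) and BX = less.prems(8)
  have fU: "finite U" using less.prems(3) U0 finV finite_subset by metis
  show ?case
  proof (cases "U = {}")
    case True
    then show ?thesis using less.prems goal by (intro mwins.won) auto
  next
    case False
    then obtain x where x: "x \<in> U" by blast
    have xV: "x \<in> V" using x less.prems(3) U0 by blast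
    have "card (U \<union> nbr B x \<union> nbr M0 x) \<le> card U + card (nbr B x) + card (nbr M0 x)"
      using card_Un_le[of "U \<union> nbr B x" "nbr M0 x"] card_Un_le[of U "nbr B x"] by linarith
    also have "\<dots> < card V"
      using less.prems(3,4,10) U0 x big by (fastforce simp: degr_def)
    finally obtain a where a: "a \<in> V" "a \<notin> U" "a \<notin> nbr B x" "a \<notin> nbr M0 x"
      using fU fin_nbr[OF BX] fin_nbr[OF M0X] card_mono[of "U \<union> nbr B x \<union> nbr M0 x" V]
      by (metis Un_iff finite_Un leD subsetI)
    have ne: "x \<noteq> a" using a x by blast
    have nM0: "{x, a} \<notin> M0" using a by (simp add: nbr_def)
    have nM: "{x, a} \<notin> M" using bspec[OF less.prems(6), of "{x, a}"] nM0 x by auto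
    have nB: "{x, a} \<notin> B" using a by (simp add: nbr_def)
    have cU: "card (U - {x}) + 1 = card U" using x fU by (metis Suc_eq_plus1 card_Suc_Diff1)
    show ?thesis
    proof (rule mwins.move[of "{x, a}"])
      show "{x, a} \<in> X" using xV a ne by (simp add: X_edge)
      show "card M < N" using less.prems(7) cU by linarith
      fix f assume f: "f \<in> X" "f \<notin> insert {x, a} M" "f \<notin> B"
      have "degr (insert f B) v + card (U - {x}) \<le> mm" if "v \<in> U - {x}" for v
        using degr_insert_le_Suc[OF BX f(1), of v] less.prems(10) that cU by fastforce
      moreover have "\<forall>u\<in>U0 - (U - {x}). \<exists>v. {u, v} \<in> insert {x, a} M \<and> {u, v} \<notin> M0"
        using less.prems(5) nM0 by blast
      moreover have "\<forall>e\<in>insert {x, a} M - M0. e \<inter> (U - {x}) = {}" using less.prems(6) a(2) by blast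
      moreover have "card (insert {x, a} M) + card (U - {x}) \<le> N"
        using less.prems(7) cU nM finE[OF MX] by simp
      ultimately show "mwins X Win N (insert {x, a} M) (insert f B)"
        using less.prems f nB cU xV a ne by (intro less.hyps[of "U - {x}"]) (auto simp: X_edge)
    qed (use nM nB in auto)
  qed
qed

text \<open>Pairing preserves \<open>2 * card M + card U = k * card V\<close>. With at most two
  vertices left, \<open>card M + card U\<close> is half of \<open>k * card V + card U\<close> and
  hence at most \<open>k * card V div 2 + 1\<close>. The set \<open>U0\<close> has
  \<open>k * \<Delta>\<close> elements, and \<open>c\<close> bounds the average Breaker-degree on
  it.\<close>

lemma endgame_wins:
  fixes Win :: "'v set set \<Rightarrow> bool"
  assumes win: "\<And>M. \<lbrakk>M \<subseteq> X; vertex_connected k V M\<rbrakk> \<Longrightarrow> Win M"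
    and N: "N = k * card V div 2 + 1"
    and Delta: "\<Delta> + card Lam + 2 * s = k * s + 2"
    and M0: "stage2 I M0" "filled I M0" "\<And>j. j < k \<Longrightarrow> lack M0 j = {}"
    and B: "B \<subseteq> X" "M0 \<inter> B = {}" "card B \<le> card M0 + 1" "\<And>v. \<lbrakk>v \<in> V; degr M0 v < k\<rbrakk> \<Longrightarrow> degr B v \<le> m"
    and c: "2 * N \<le> c * (k * \<Delta>)" "8 * thr (8 * c + 8) c + 8 * c + 8 \<le> k * \<Delta>" "4 * m + 12 \<le> 3 * (k * \<Delta>)"
      "m + k * \<Delta> + k + 2 < card V"
  shows "mwins X Win N M0 B"
proof -
  define U0 where "U0 = {v\<in>V. degr M0 v < k}"
  define mm where "mm = m + k * \<Delta>"
  note st = stage2D(1)[OF M0(1)] and tc = stage2D(2)[OF M0(1)]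
  note M0X = forest_stateD(1)[OF st]
  have fU0: "finite U0" using finV by (simp add: U0_def)
  have noLam: "v \<notin> Lam" if "v \<in> U0" for v
    using ex_lack_of_leaf[OF st] M0(3) that by (auto simp: U0_def)
  have UW: "\<exists>j<k. v \<in> W j \<and> v \<in> I j \<and> k \<le> degr M0 v + 1" if v: "v \<in> U0" for v
  proof -
    have "v \<in> V" "degr M0 v < k" using v by (auto simp: U0_def)
    then show ?thesis using V_cases[of v] noLam[OF v] M0(2) unfolding filled_def by metis
  qed
  have indep: "{u, v} \<notin> M0" if uv: "u \<in> U0" "v \<in> U0" for u v
  proof
    assume e: "{u, v} \<in> M0"
    obtain i where i: "i < k" "u \<in> W i" "u \<in> I i" using UW[OF uv(1)] by blast
    obtain j where j: "j < k" "v \<in> W j" "v \<in> I j" using UW[OF uv(2)] by blast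
    have "v \<in> W i" using forest_stateD(3)[OF st i(1,2) e] noLam[OF uv(2)] by blast
    then have "i = j" using W_disj[OF i(1) j(1)] j(2) by blast
    then show False using stage2D(4)[OF M0(1) i(1)] i j e by blast
  qed
  have deg: "k \<le> degr M0 v + 1" if "v \<in> V" for v
    using UW[of v] that by (cases "degr M0 v < k") (auto simp: U0_def)
  have leaf: "ec M0 {l} (W j) = 1" if "l \<in> Lam" "j < k" for l j
    using forest_stateD(6)[OF st that] M0(3)[OF that(2)] that(1) by (fastforce simp: lack_def)
  have final: "Win M" if "M0 \<subseteq> M" "M \<subseteq> X" "\<forall>u\<in>U0. \<exists>v. {u, v} \<in> M \<and> {u, v} \<notin> M0" for M
  proof (rule win[OF that(2)])
    show "vertex_connected k V M"
      by (rule vertex_connected_if_trees[OF st tc leaf deg _ that(1,2)])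
        (use indep that(3) in \<open>auto simp: U0_def\<close>)
  qed
  have cU: "card U0 + 2 * card M0 = k * card V"
  proof -
    have "degr M0 v + of_bool (degr M0 v < k) = k" if "v \<in> V" for v
      using deg[OF that] forest_stateD(2)[OF st that] by (simp add: of_bool_def)
    then have "(\<Sum>v\<in>V. degr M0 v + of_bool (degr M0 v < k)) = (\<Sum>v\<in>V. k)"
      by (intro sum.cong) auto
    then show ?thesis using handshake[OF M0X] finV
      by (simp add: sum.distrib U0_def sum.If_cases of_bool_def Int_def mult.commute)
  qed
  have cU2: "card U0 = k * \<Delta>"
  proof -
    have "U0 = (\<Union>j<k. {w\<in>W j. degr M0 w < k})"
      using UW W_V by (fastforce simp: U0_def)
    then have "card U0 = (\<Sum>j<k. card {w\<in>W j. degr M0 w < k})"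
      using fin_W W_disj by (simp, intro card_UN_disjoint) auto
    also have "\<dots> = (\<Sum>j<k. \<Delta>)"
      using open_filled[OF st tc _ Delta M0(2)] M0(3) by (intro sum.cong) auto
    finally show ?thesis by simp
  qed
  define J where "J M U \<longleftrightarrow> M0 \<subseteq> M \<and> M \<subseteq> X \<and> U \<subseteq> U0 \<and> (\<forall>u\<in>U0 - U. \<exists>v. {u, v} \<in> M \<and> {u, v} \<notin> M0) \<and>
    (\<forall>e\<in>M - M0. e \<inter> U = {}) \<and> 2 * card M + card U = k * card V" for M U
  \<comment> \<open>The deficient vertices are pairwise nonadjacent in \<open>M0\<close>, so no
    partner has to be forbidden and \<open>x\<close> itself serves as a dummy value.\<close>
  interpret P: pairing_game V Win N J "\<lambda>_ x. x" mm
  proof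
    fix M U assume "J M U"
    then show "U \<subseteq> V \<and> M \<subseteq> X" by (auto simp: J_def U0_def)
  next
    fix M U assume "J M U" "3 \<le> card U"
    then show "card M < N" using N by (auto simp: J_def)
  next
    fix M U x y assume J: "J M U" "3 \<le> card U" "x \<in> U" "y \<in> U" "x \<noteq> y"
    have fU: "finite U" using J(1) fU0 finite_subset by (auto simp: J_def)
    have xy: "x \<in> U0" "y \<in> U0" using J by (auto simp: J_def)
    have n: "{x, y} \<notin> M0" using indep[OF xy] .
    have M_U: "\<forall>e\<in>M - M0. e \<inter> U = {}" using J(1) by (simp add: J_def)
    have nM: "{x, y} \<notin> M" using bspec[OF M_U, of "{x, y}"] n J(3) by auto
    have "finite M" using J(1) finE by (auto simp: J_def)
    moreover have "card (U - {x, y}) + 2 = card U" using J fU by (simp add: card_Diff_insert)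
    ultimately have "2 * card (insert {x, y} M) + card (U - {x, y}) = k * card V"
      using J(1) nM by (auto simp: J_def)
    moreover have "{x, y} \<in> X" using xy J by (auto simp: U0_def X_edge)
    moreover have "\<forall>u\<in>U0 - (U - {x, y}). \<exists>v. {u, v} \<in> insert {x, y} M \<and> {u, v} \<notin> M0"
    proof
      fix u assume u: "u \<in> U0 - (U - {x, y})"
      show "\<exists>v. {u, v} \<in> insert {x, y} M \<and> {u, v} \<notin> M0"
      proof (cases "u \<in> U")
        case True
        then have "u = x \<or> u = y" using u by blast
        then show ?thesis
        proof
          assume "u = x"
          then show ?thesis using n by (intro exI[of _ y]) simp
        next
          assume "u = y"
          then show ?thesis using n by (intro exI[of _ x]) (simp add: insert_commute)
        qed
      next
        case False
        then show ?thesis using u J(1) by (auto simp: J_def)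
      qed
    qed
    moreover have "\<forall>e\<in>insert {x, y} M - M0. e \<inter> (U - {x, y}) = {}"
    proof
      fix e assume e: "e \<in> insert {x, y} M - M0"
      show "e \<inter> (U - {x, y}) = {}"
      proof (cases "e = {x, y}")
        case False
        then show ?thesis using bspec[OF M_U, of e] e by blast
      qed simp
    qed
    moreover have "M0 \<subseteq> insert {x, y} M" "M \<subseteq> X" "U - {x, y} \<subseteq> U0" using J(1) by (auto simp: J_def)
    ultimately show "{x, y} \<notin> M \<and> J (insert {x, y} M) (U - {x, y})"
      using nM by (simp add: J_def)
  next
    fix M U B assume J: "J M U" "card U \<le> 2" and B: "B \<subseteq> X" "M \<inter> B = {}" "\<forall>v\<in>U. degr B v + card U \<le> mm"
    show "mwins X Win N M B"
    proof (rule repair_wins[of U0 M0 Win mm M U N B])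
      show "card M + card U \<le> N" using J N by (auto simp: J_def)
      show "mm + k + 2 < card V" using c(4) by (simp add: mm_def)
    qed (use J B final M0X in \<open>auto simp: J_def U0_def\<close>)
  qed auto
  show ?thesis
  proof (rule P.cleanup[where U = U0 and c = c])
    show "P.ok M0 B U0"
      unfolding P.ok_def
    proof (intro conjI ballI)
      show "J M0 U0" using cU M0X by (simp add: J_def)
      fix v assume "v \<in> U0"
      then show "degr B v + card U0 \<le> mm" using B(4)[of v] cU2 by (simp add: mm_def U0_def)
    qed (use B in auto)
    have "ec B U0 U0 \<le> ec B V V" by (rule ec_mono) (use finV in \<open>auto simp: U0_def\<close>)
    also have "\<dots> = 2 * card B" using handshake[OF B(1)] sum_degr[OF B(1)] by simp
    also have "\<dots> \<le> 2 * N" using B(3) card_le_edges[OF st] N by simp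
    finally show "ec B U0 U0 \<le> c * card U0" using c(1) cU2 by simp
    show "4 * mm + 12 \<le> 7 * card U0" unfolding mm_def cU2 using c(3) by presburger
    show "8 * thr (8 * c + 8) c + 8 * c + 8 \<le> card U0" using c(2) cU2 by simp
  qed
qed

theorem trees_win:
  fixes Win :: "'v set set \<Rightarrow> bool"
  assumes win: "\<And>M. \<lbrakk>M \<subseteq> X; vertex_connected k V M\<rbrakk> \<Longrightarrow> Win M"
    and N: "N = k * card V div 2 + 1"
    and q: "2 * k * (N + 1) < q * (q + 1)"
    and Delta: "\<Delta> + card Lam + 2 * s = k * s + 2"
    and m: "m = 2 * q + 1"
    and c1: "2 * (q + k * m) < s" and c3: "q + m < card Lam"
    and c2: "k * m < \<Delta>" and iota: "\<iota> = \<Delta> + q + m + 1" "k * ((k + 1) * \<iota>) + q \<le> s"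
    and m2: "m2 = m + k * (\<iota> - \<Delta>)" "m2 < \<Delta>"
    and c: "2 * N \<le> c * (k * \<Delta>)" "8 * thr (8 * c + 8) c + 8 * c + 8 \<le> k * \<Delta>" "4 * m2 + 12 \<le> 3 * (k * \<Delta>)"
      "m2 + k * \<Delta> + k + 2 < card V"
    and B: "B \<subseteq> X" "card B \<le> 1"
  shows "mwins X Win N {} B"
proof (rule stage1_wins[where D = q and L = q and m = m and d = 0])
  show "N = k * card V div 2 + 1" "2 * k * (N + 1) < q * (q + 1)" by fact+
  show "q + q + 1 \<le> m" using m by simp
  show "2 * (q + k * m) < s" "q + m < card Lam" by fact+
  have "k * (q + m) \<le> 2 * (k * m)" using m by simp
  then show "k * (q + m) < s" using c1 by presburger
  show "stage1 {} 0"
  proof -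
    have "ec {} Y Y + 2 \<le> 2 * card Y" if "j < k" "Y \<subseteq> W j" "Y \<noteq> {}" for j Y
      using that fin_sub_W[OF that(1,2)] card_gt_0_iff[of Y] by simp
    then have "forest_state {}" unfolding forest_state_def
      by (auto simp: degr_def nbr_def)
    then show ?thesis by (simp add: stage1_def)
  qed
  show "ctrl k q {} B 0" using ctrl_start[OF B] .
next
  fix M B d assume M: "stage1 M d" "trees_connected M" and ct: "ctrl k q M B d"
  note st = stage1D(1)[OF M(1)]
  have dq: "d < q" using ctrl_bound[OF ct q] card_le_edges[OF st] N by simp
  \<comment> \<open>After the first stage the degree sum of \<open>W j\<close> is less than
    \<open>2 * s + q\<close>, so at least \<open>(s - q) / k\<close> of its vertices are open. That
    is at least \<open>(k + 1) * \<iota>\<close>, enough for an independent reserve of size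
    \<open>\<iota>\<close> in a graph of maximum degree \<open>k\<close>.\<close>
  have ex: "\<exists>A\<subseteq>{w\<in>W j. degr M w < k}. card A = \<iota> \<and> (\<forall>u\<in>A. \<forall>v\<in>A. {u, v} \<notin> M)" if j: "j < k" for j
  proof (rule ex_independent_subset[where k = k])
    let ?O = "{w\<in>W j. degr M w < k}"
    show fO: "finite ?O" using fin_W[OF j] by simp
    have "k * s \<le> (\<Sum>w\<in>W j. degr M w) + k * card ?O"
      using open_count[OF st W_V[OF j]] card_W[OF j] by simp
    moreover have "(\<Sum>w\<in>W j. degr M w) = ec M (W j) (W j) + ec M (W j) Lam" by (rule degr_W[OF st j order_refl])
    moreover have "ec M (W j) (W j) + 2 = 2 * s" by (rule trees_connected_edges[OF st M(2) j])
    moreover have "ec M (W j) Lam \<le> d" using stage1D(2)[OF M(1) j] .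
    moreover have "3 * s \<le> k * s" using k3 by simp
    ultimately have "s \<le> q + k * card ?O" using dq by linarith
    then have "k * ((k + 1) * \<iota>) \<le> k * card ?O" using iota(2) by linarith
    then show "(k + 1) * \<iota> \<le> card ?O" using k3 by simp
    fix v assume v: "v \<in> ?O"
    show "{v} \<notin> M" using forest_stateD(1)[OF st] X_edge[of v v] by auto
    have "card (nbr M v \<inter> ?O) \<le> degr M v" unfolding degr_def
      using fin_nbr[OF forest_stateD(1)[OF st]] by (intro card_mono) auto
    then show "card (nbr M v \<inter> ?O) \<le> k" using v by simp
  qed
  define I where "I j = (SOME A. A \<subseteq> {w\<in>W j. degr M w < k} \<and> card A = \<iota> \<and> (\<forall>u\<in>A. \<forall>v\<in>A. {u, v} \<notin> M))" for j
  have I: "I j \<subseteq> {w\<in>W j. degr M w < k} \<and> card (I j) = \<iota> \<and> (\<forall>u\<in>I j. \<forall>v\<in>I j. {u, v} \<notin> M)" if j: "j < k" for j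
    unfolding I_def by (rule someI_ex) (use ex[OF j] in blast)
  have M2: "stage2 I M" using I st M(2) unfolding stage2_def by blast
  show "mwins X Win N M B"
  proof (rule stage2a_wins[where I = I and D = q and L = q and m = m and d = d and \<Delta> = \<Delta>])
    show "N = k * card V div 2 + 1" "2 * k * (N + 1) < q * (q + 1)" "k * m < \<Delta>"
      "\<Delta> + card Lam + 2 * s = k * s + 2" "stage2 I M" "ctrl k q M B d" by fact+
    show "q + q + 1 \<le> m" using m by simp
    show "\<Delta> + q + m < card (I j)" if "j < k" for j using I[OF that] iota(1) by simp
    fix j assume "j < k"
    then have "{w\<in>I j. degr M w = k} = {}" using I by blast
    then show "card {w\<in>I j. degr M w = k} \<le> d" by (metis card.empty le0)
  next
    fix M' B d assume M': "stage2 I M'" "filled I M'" "ctrl k q M' B d"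
    have dq: "d < q" using ctrl_bound[OF M'(3) q] card_le_edges[OF stage2D(1)[OF M'(1)]] N by simp
    show "mwins X Win N M' B"
    proof (rule stage2b_wins[where I = I and m = m2 and \<Delta> = \<Delta> and \<iota> = \<iota> and L = q and d = d])
      show "N = k * card V div 2 + 1" "\<Delta> + card Lam + 2 * s = k * s + 2" "m2 < \<Delta>"
        "stage2 I M'" "filled I M'" "ctrl k q M' B d" by fact+
      show "card (I j) \<le> \<iota>" if "j < k" for j using I[OF that] by simp
      show "q + d + 1 + k * (\<iota> - \<Delta>) \<le> m2" using m2(1) m dq by simp
    next
      fix M B assume a: "stage2 I M" "filled I M" "\<And>j. j < k \<Longrightarrow> lack M j = {}" "B \<subseteq> X" "M \<inter> B = {}"
        "card B \<le> card M + 1" "\<And>v. v \<in> V \<Longrightarrow> degr M v < k \<Longrightarrow> degr B v \<le> m2"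
      show "mwins X Win N M B" by (rule endgame_wins[OF win N Delta a c])
    qed
  qed
qed

end

section \<open>The case of connectivity at least three\<close>

lemma maker_wins_if_position_wins:
  assumes X: "2 * N + 1 < card (complete_edges {..<n})"
    and w: "\<And>B. \<lbrakk>B \<subseteq> complete_edges {..<n}; card B \<le> 1\<rbrakk> \<Longrightarrow>
      mwins (complete_edges {..<n}) (\<lambda>M. \<exists>F\<in>k_connected_family n k. F \<subseteq> M) N {} B"
  shows "maker_wins_within p (complete_edges {..<n}) (k_connected_family n k) N"
proof (rule maker_wins_within_if_mwins[OF _ X refl])
  show "finite (complete_edges {..<n})" by (simp add: complete_edges_def)
qed (use w in auto)

lemma card_complete_edges: "card (complete_edges {..<n}) = n * (n - 1) div 2"
  unfolding complete_edges_def by (subst n_subsets) (auto simp: choose_two)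

lemma board_large:
  assumes "2 * k + 10 \<le> n"
  shows "2 * (k * n div 2 + 1) + 1 < card (complete_edges {..<n})"
proof -
  obtain r where r: "n = 2 * k + 10 + r" using assms le_Suc_ex by blast
  have "2 * (k * n + 4) \<le> n * (n - 1)" unfolding r by (simp add: algebra_simps)
  then have "k * n + 4 \<le> n * (n - 1) div 2" by (simp add: less_eq_div_iff_mult_less_eq)
  moreover have "2 * (k * n div 2) \<le> k * n" by simp
  ultimately show ?thesis unfolding card_complete_edges by presburger
qed

text \<open>All sizes are compared through \<open>q\<close>, a fixed fraction of \<open>n\<close>,
  and its multiples by powers of \<open>k\<close>. \<open>T\<close> bounds \<open>q\<close> from
  below and collects the constants: the size demanded by \<open>cleanup\<close>, and
  \<open>k * (k * C) + 4 * k\<close> for the inequality with \<open>q * (q + 1)\<close>, which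
  follows from \<open>n < C * (q + 1)\<close>.\<close>

lemma trees_win_numbers:
  fixes k :: nat
  assumes k: "3 \<le> k"
  defines "C \<equiv> 1000 * (k * (k * (k * k)))"
  defines "T \<equiv> 8 * thr (8 * C + 8) C + 8 * C + 8 + k * (k * C) + 4 * k + 4"
  assumes n: "C * T \<le> n"
  obtains q s \<Delta> where "k * s \<le> n" "2 \<le> s" "2 * k * ((k * n div 2 + 1) + 1) < q * (q + 1)"
    "\<Delta> + (n - k * s) + 2 * s = k * s + 2"
    "2 * (q + k * (2 * q + 1)) < s" "q + (2 * q + 1) < n - k * s" "k * (2 * q + 1) < \<Delta>"
    "k * ((k + 1) * (\<Delta> + q + (2 * q + 1) + 1)) + q \<le> s"
    "(2 * q + 1) + k * (q + (2 * q + 1) + 1) < \<Delta>"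
    "2 * (k * n div 2 + 1) \<le> C * (k * \<Delta>)"
    "8 * thr (8 * C + 8) C + 8 * C + 8 \<le> k * \<Delta>"
    "4 * ((2 * q + 1) + k * (q + (2 * q + 1) + 1)) + 12 \<le> 3 * (k * \<Delta>)"
    "(2 * q + 1) + k * (q + (2 * q + 1) + 1) + k * \<Delta> + k + 2 < n"
proof -
  define q where "q = n div C"
  have C0: "0 < C" using k by (simp add: C_def)
  have qT: "T \<le> q" unfolding q_def using n C0 by (metis div_le_mono nonzero_mult_div_cancel_left not_less0)
  have nq: "C * q \<le> n" "n < C * q + C" unfolding q_def using C0
    by (auto simp: mult.commute[of C] dividend_less_times_div) (metis C0 add.commute dividend_less_div_times)
  have q1: "4 \<le> q" "k \<le> q" "8 * thr (8 * C + 8) C + 8 * C + 8 \<le> q" "k * (k * C) + 4 * k \<le> q" using qT by (auto simp: T_def)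
  define t where "t = k * q"
  define u where "u = k * t"
  define v where "v = k * u"
  define w where "w = k * v"
  have tu: "3 * q \<le> t" "3 * t \<le> u" "3 * u \<le> v" "3 * v \<le> w"
    unfolding t_def u_def v_def w_def using k by auto
  have Cq: "C * q = 1000 * w" by (simp add: C_def w_def v_def u_def t_def mult.assoc)
  \<comment> \<open>With \<open>card Lam = n - k * s\<close> the equation for
    \<open>\<Delta>\<close> reads \<open>\<Delta> + n = (2 * k - 2) * s + 2\<close>. The least
    \<open>s\<close> with \<open>(2 * k - 2) * s > n + 40 * t\<close> makes \<open>\<Delta>\<close>
    about \<open>40 * t\<close>: far above the degree bound of about \<open>3 * t\<close>, yet so
    small that the reserves, about \<open>47 * (u + v)\<close> after multiplication by
    \<open>k * (k + 1)\<close>, fit into \<open>s\<close>.\<close>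
  define s where "s = (n + 40 * t) div (2 * k - 2) + 1"
  define y where "y = k * s"
  have kk: "2 * k - 2 \<noteq> 0" using k by simp
  have "(2 * k - 2) * ((n + 40 * t) div (2 * k - 2)) \<le> n + 40 * t" by simp
  moreover have "n + 40 * t < (2 * k - 2) * ((n + 40 * t) div (2 * k - 2)) + (2 * k - 2)"
    using kk by (metis dividend_less_div_times mult.commute add.commute neq0_conv)
  moreover have "(2 * k - 2) * s = (2 * k - 2) * ((n + 40 * t) div (2 * k - 2)) + (2 * k - 2)"
    unfolding s_def by (simp add: add_mult_distrib2)
  moreover have "(2 * k - 2) * s + 2 * s = 2 * y" unfolding y_def using k
    by (metis (no_types, lifting) add_mult_distrib le_add_diff_inverse2 mult.assoc mult_le_mono2 nat_mult_1_right one_le_numeral order_trans)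
  ultimately have s: "n + 40 * t + 2 * s < 2 * y" "2 * y \<le> n + 40 * t + 2 * k + 2 * s"
    by linarith+
  define D where "D = 2 * y + 2 - n - 2 * s"
  have D: "D + n + 2 * s = 2 * y + 2" "40 * t + 2 < D" "D \<le> 40 * t + 2 * k + 2"
    unfolding D_def using s by linarith+
  have sv: "500 * v < s"
  proof -
    have "k * (500 * v) = 500 * w" by (simp add: w_def)
    then have "k * (500 * v) < y" using s(1) nq(1) Cq by linarith
    then show ?thesis unfolding y_def by simp
  qed
  have sy: "3 * s \<le> y" unfolding y_def using k by simp
  have kt: "k \<le> t" unfolding t_def using q1 by simp
  have yn: "4 * y \<le> 3 * n + 120 * t + 6 * k" using s(2) sy by linarith
  have nw: "1000 * w \<le> n" using nq Cq by simp
  have ky: "y + 3 * q + 2 \<le> n" using yn nw tu kt q1 by linarith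
  have km: "k * (2 * q + 1) = 2 * t + k" "k * (q + (2 * q + 1) + 1) = 3 * t + 2 * k" by (simp_all add: t_def algebra_simps)
  have kD: "k * (40 * t) = 40 * u" "40 * u \<le> k * D" "k * D \<le> 45 * u"
  proof -
    show 1: "k * (40 * t) = 40 * u" by (simp add: u_def)
    have "k * (40 * t) \<le> k * D" using D(2) by (intro mult_le_mono2) simp
    then show "40 * u \<le> k * D" using 1 by simp
    have "D \<le> 45 * t" using D(3) kt q1 tu by linarith
    then have "k * D \<le> k * (45 * t)" by (rule mult_le_mono2)
    then show "k * D \<le> 45 * u" by (simp add: u_def)
  qed
  show ?thesis
  proof (rule that[of s q D])
    show "k * s \<le> n" using ky y_def by linarith
    show "2 \<le> s" using sv tu q1 by linarith
    show "2 * k * ((k * n div 2 + 1) + 1) < q * (q + 1)"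
    proof -
      have "2 * ((k * n div 2 + 1) + 1) \<le> k * n + 4" by simp
      then have "k * (2 * ((k * n div 2 + 1) + 1)) \<le> k * (k * n + 4)" by (rule mult_le_mono2)
      also have "\<dots> \<le> k * (k * (C * (q + 1)) + 4)" using nq by (intro mult_le_mono2 add_le_mono) auto
      also have "\<dots> = k * (k * C) * (q + 1) + 4 * k" by (simp add: algebra_simps)
      also have "\<dots> < (k * (k * C) + 4 * k) * (q + 1)"
        using k q1(1) by (simp add: add_mult_distrib)
      also have "\<dots> \<le> q * (q + 1)" using q1 by (intro mult_le_mono1) simp
      finally show ?thesis by (simp add: mult.assoc mult.left_commute)
    qed
    show "D + (n - k * s) + 2 * s = k * s + 2" using D(1) ky unfolding y_def[symmetric] by linarith
    have "2 * q + 4 * t + 2 * k < s" using sv tu kt by linarith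
    then show "2 * (q + k * (2 * q + 1)) < s" unfolding km by simp
    show "q + (2 * q + 1) < n - k * s" unfolding y_def[symmetric] using ky by linarith
    show "k * (2 * q + 1) < D" unfolding km using D kt by linarith
    show "k * ((k + 1) * (D + q + (2 * q + 1) + 1)) + q \<le> s"
    proof -
      have "D + q + (2 * q + 1) + 1 \<le> 47 * t" using D(3) kt q1 tu by linarith
      then have "k * ((k + 1) * (D + q + (2 * q + 1) + 1)) \<le> k * ((k + 1) * (47 * t))" by (intro mult_le_mono2)
      also have "\<dots> = 47 * v + 47 * u" by (simp add: v_def u_def algebra_simps)
      finally show ?thesis using sv tu by linarith
    qed
    show "(2 * q + 1) + k * (q + (2 * q + 1) + 1) < D" unfolding km using D kt tu q1 by linarith
    show "2 * (k * n div 2 + 1) \<le> C * (k * D)"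
    proof -
      have "k * n \<le> k * (C * q + C)" using nq by (intro mult_le_mono2) simp
      also have "\<dots> \<le> k * (C * (2 * q))" using q1(1) C0 by (intro mult_le_mono2) (simp add: algebra_simps)
      also have "\<dots> = C * (2 * t)" by (simp add: t_def)
      finally have 1: "k * n \<le> C * (2 * t)" .
      have "2 * t + 2 \<le> k * D" using kD tu q1 by linarith
      then have "C * (2 * t) + C * 2 \<le> C * (k * D)" by (metis add_mult_distrib2 mult_le_mono2)
      then have "k * n + 2 \<le> C * (k * D)" using 1 C0 by linarith
      moreover have "2 * (k * n div 2 + 1) \<le> k * n + 2" by simp
      ultimately show ?thesis by (rule order_trans[rotated])
    qed
    show "8 * thr (8 * C + 8) C + 8 * C + 8 \<le> k * D" using q1(3) kD(2) tu by linarith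
    have "8 * q + 12 * t + 8 * k + 16 \<le> 3 * (k * D)" using kD(2) tu kt q1 by linarith
    then show "4 * ((2 * q + 1) + k * (q + (2 * q + 1) + 1)) + 12 \<le> 3 * (k * D)" unfolding km by simp
    show "(2 * q + 1) + k * (q + (2 * q + 1) + 1) + k * D + k + 2 < n"
      unfolding km using kD(3) nw tu kt q1 by linarith
  qed
qed

theorem maker_wins_k_ge_3:
  fixes k :: nat
  assumes k: "3 \<le> k"
  shows "\<exists>n0. \<forall>n\<ge>n0. \<forall>p. maker_wins_within p (complete_edges {..<n}) (k_connected_family n k) ((k * n) div 2 + 1)"
proof -
  define C where "C = 1000 * (k * (k * (k * k)))"
  define T where "T = 8 * thr (8 * C + 8) C + 8 * C + 8 + k * (k * C) + 4 * k + 4"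
  have "maker_wins_within p (complete_edges {..<n}) (k_connected_family n k) ((k * n) div 2 + 1)"
    if n: "C * T + 2 * k + 10 \<le> n" for n p
  proof (rule maker_wins_if_position_wins)
    show "2 * (k * n div 2 + 1) + 1 < card (complete_edges {..<n})" using board_large n by simp
    fix B assume B: "B \<subseteq> complete_edges {..<n}" "card B \<le> 1"
    have "C * T \<le> n" using n by simp
    then obtain q s \<Delta> where num: "k * s \<le> n" "2 \<le> s" "2 * k * ((k * n div 2 + 1) + 1) < q * (q + 1)"
      "\<Delta> + (n - k * s) + 2 * s = k * s + 2"
      "2 * (q + k * (2 * q + 1)) < s" "q + (2 * q + 1) < n - k * s" "k * (2 * q + 1) < \<Delta>"
      "k * ((k + 1) * (\<Delta> + q + (2 * q + 1) + 1)) + q \<le> s"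
      "(2 * q + 1) + k * (q + (2 * q + 1) + 1) < \<Delta>"
      "2 * (k * n div 2 + 1) \<le> C * (k * \<Delta>)"
      "8 * thr (8 * C + 8) C + 8 * C + 8 \<le> k * \<Delta>"
      "4 * ((2 * q + 1) + k * (q + (2 * q + 1) + 1)) + 12 \<le> 3 * (k * \<Delta>)"
      "(2 * q + 1) + k * (q + (2 * q + 1) + 1) + k * \<Delta> + k + 2 < n"
      unfolding C_def T_def using trees_win_numbers[OF k, of n] by metis
    define W where "W j = {j * s..<j * s + s}" for j
    interpret tree_parts "{..<n}" k s W
    proof
      show "W j \<subseteq> {..<n}" if "j < k" for j
      proof -
        have "(j + 1) * s \<le> k * s" using that by (intro mult_le_mono1) simp
        then show ?thesis using num(1) by (auto simp: W_def)
      qed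
      have lt: "W i \<inter> W j = {}" if "i < j" for i j
      proof -
        have "(i + 1) * s \<le> j * s" using that by (intro mult_le_mono1) simp
        then show ?thesis by (auto simp: W_def)
      qed
      show "W i \<inter> W j = {}" if "i \<noteq> j" for i j
        using lt[of i j] lt[of j i] that by (metis Int_commute linorder_neqE_nat)
    qed (use k num in \<open>auto simp: W_def\<close>)
    have cL: "card Lam = n - k * s" using card_Lam by simp
    show "mwins (complete_edges {..<n}) (\<lambda>M. \<exists>F\<in>k_connected_family n k. F \<subseteq> M) (k * n div 2 + 1) {} B"
    proof (rule trees_win[OF _ _ _ _ refl _ _ _ refl _ refl _ _ _ _ _ B])
      show "\<exists>F\<in>k_connected_family n k. F \<subseteq> M"
        if "M \<subseteq> complete_edges {..<n}" "vertex_connected k {..<n} M" for M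
        using that by (auto simp: k_connected_family_def)
    qed (use num cL in simp_all)
  qed
  then show ?thesis by blast
qed

section \<open>The case of connectivity two\<close>

fun pedges :: "'v list \<Rightarrow> 'v set set" where
  "pedges (x # y # zs) = insert {x, y} (pedges (y # zs))"
| "pedges _ = {}"

lemma pedges_subset: "e \<in> pedges p \<Longrightarrow> e \<subseteq> set p"
  by (induction p rule: pedges.induct) auto

lemma pedges_append: "\<lbrakk>xs \<noteq> []; ys \<noteq> []\<rbrakk> \<Longrightarrow> pedges (xs @ ys) = insert {last xs, hd ys} (pedges xs \<union> pedges ys)"
  by (induction xs rule: pedges.induct) (auto simp: neq_Nil_conv)

lemma pedges_rev: "pedges (rev p) = pedges p"
proof (induction p rule: pedges.induct)
  case (1 x y zs)
  have "pedges (rev (x # y # zs)) = pedges (rev (y # zs) @ [x])" by simp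
  also have "\<dots> = insert {y, x} (pedges (rev (y # zs)))" by (subst pedges_append) (auto simp: last_rev)
  finally show ?case using 1 by (simp add: insert_commute)
qed auto

lemma pedges_nth: "Suc i < length p \<Longrightarrow> {p ! i, p ! Suc i} \<in> pedges p"
proof (induction p arbitrary: i rule: pedges.induct)
  case (1 x y zs)
  then show ?case by (cases i) auto
qed auto

lemma pedgesE:
  assumes "e \<in> pedges p"
  obtains i where "Suc i < length p" "e = {p ! i, p ! Suc i}"
proof -
  have "\<exists>i. Suc i < length p \<and> e = {p ! i, p ! Suc i}" using assms
  proof (induction p rule: pedges.induct)
    case (1 x y zs)
    show ?case
    proof (cases "e = {x, y}")
      case True
      then show ?thesis by (intro exI[of _ 0]) simp
    next
      case False
      then obtain i where "Suc i < length (y # zs)" "e = {(y # zs) ! i, (y # zs) ! Suc i}" using 1 by auto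
      then show ?thesis by (intro exI[of _ "Suc i"]) simp
    qed
  qed auto
  then show ?thesis using that by blast
qed

lemma nbr_pedges_outside: "v \<notin> set p \<Longrightarrow> nbr (pedges p) v = {}"
  using pedges_subset unfolding nbr_def by fastforce

lemma finite_nbr_pedges: "finite (nbr (pedges p) v)"
  by (rule finite_subset[of _ "set p"]) (use pedges_subset in \<open>auto simp: nbr_def\<close>)

lemma degr_pedges:
  assumes "distinct p"
  shows "degr (pedges p) v \<le> 2" "p \<noteq> [] \<Longrightarrow> v = hd p \<or> v = last p \<Longrightarrow> degr (pedges p) v \<le> 1"
    "v \<in> set p \<Longrightarrow> v \<noteq> hd p \<Longrightarrow> v \<noteq> last p \<Longrightarrow> 2 \<le> degr (pedges p) v"
proof -
  have "degr (pedges p) v \<le> 2 \<and> (p \<noteq> [] \<longrightarrow> v = hd p \<or> v = last p \<longrightarrow> degr (pedges p) v \<le> 1) \<and>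
    (v \<in> set p \<longrightarrow> v \<noteq> hd p \<longrightarrow> v \<noteq> last p \<longrightarrow> 2 \<le> degr (pedges p) v)"
    using assms
  proof (induction p rule: pedges.induct)
    case (1 x y zs)
    define E where "E = pedges (y # zs)"
    have fin: "finite (nbr E v)" for v unfolding E_def by (rule finite_nbr_pedges)
    have nx: "nbr E x = {}" unfolding E_def using 1 by (intro nbr_pedges_outside) auto
    have IH: "degr E v \<le> 2" "v = y \<or> v = last (y # zs) \<Longrightarrow> degr E v \<le> 1"
      "v \<in> set (y # zs) \<Longrightarrow> v \<noteq> y \<Longrightarrow> v \<noteq> last (y # zs) \<Longrightarrow> 2 \<le> degr E v"
      using 1 by (auto simp: E_def)
    have pe: "pedges (x # y # zs) = insert {x, y} E" by (simp add: E_def)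
    have xy: "x \<noteq> y" using 1 by simp
    have xn: "x \<notin> nbr E y" using nx nbr_sym[of x E y] by auto
    consider "v = x" | "v = y" | "v \<noteq> x" "v \<noteq> y" by blast
    then show ?case
    proof cases
      case 1
      then have "nbr (insert {x, y} E) v = {y}" using nx xy by (simp add: nbr_insert)
      then show ?thesis using 1 unfolding pe by (simp add: degr_def)
    next
      case 2
      then have "nbr (insert {x, y} E) v = insert x (nbr E y)" using xy by (simp add: nbr_insert)
      then have d: "degr (insert {x, y} E) v = degr E y + 1" using xn fin by (simp add: degr_def)
      show ?thesis
      proof (cases zs)
        case Nil
        then have "degr E y = 0" by (simp add: E_def degr_def nbr_def)
        then show ?thesis using d 2 Nil unfolding pe by simp
      next
        case (Cons z zs')
        have "z \<in> nbr E y" by (simp add: E_def Cons nbr_def)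
        then have "1 \<le> degr E y" using fin[of y] by (metis Suc_leI card_gt_0_iff degr_def empty_iff One_nat_def)
        moreover have "last (x # y # zs) \<noteq> y" using "1.prems" Cons by (auto dest: last_in_set)
        ultimately show ?thesis using d IH(2) 2 xy unfolding pe by auto
      qed
    next
      case 3
      then have "degr (insert {x, y} E) v = degr E v" by (simp add: degr_def nbr_insert)
      then show ?thesis using IH 3 unfolding pe by auto
    qed
  qed (auto simp: degr_def nbr_def)
  then show "degr (pedges p) v \<le> 2" "p \<noteq> [] \<Longrightarrow> v = hd p \<or> v = last p \<Longrightarrow> degr (pedges p) v \<le> 1"
    "v \<in> set p \<Longrightarrow> v \<noteq> hd p \<Longrightarrow> v \<noteq> last p \<Longrightarrow> 2 \<le> degr (pedges p) v" by blast+
qed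

section \<open>Linear forests and the joining of two paths\<close>

context finite_graph
begin

text \<open>Isolated vertices count as one-vertex paths. A list and its reverse describe the same
  path, so \<open>M\<close> does not determine \<open>PS\<close>; it does determine the set of ends,
  see \<open>ends_eq\<close>.\<close>

definition linear_forest :: "'v set set \<Rightarrow> 'v list set \<Rightarrow> bool" where
  "linear_forest M PS \<longleftrightarrow> finite PS \<and> (\<forall>p\<in>PS. p \<noteq> [] \<and> distinct p) \<and> (\<Union>p\<in>PS. set p) = V \<and>
     (\<forall>p\<in>PS. \<forall>r\<in>PS. p \<noteq> r \<longrightarrow> set p \<inter> set r = {}) \<and> M = (\<Union>p\<in>PS. pedges p) \<and> card M + card PS = card V"

lemma linear_forestD:
  assumes "linear_forest M PS"
  shows "finite PS" "\<And>p. p \<in> PS \<Longrightarrow> p \<noteq> []" "\<And>p. p \<in> PS \<Longrightarrow> distinct p" "(\<Union>p\<in>PS. set p) = V"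
    "\<And>p r v. \<lbrakk>p \<in> PS; r \<in> PS; v \<in> set p; v \<in> set r\<rbrakk> \<Longrightarrow> p = r" "M = (\<Union>p\<in>PS. pedges p)" "card M + card PS = card V"
  using assms by (auto simp: linear_forest_def)

lemma nbr_linear_forest:
  assumes "linear_forest M PS" "p \<in> PS" "v \<in> set p"
  shows "nbr M v = nbr (pedges p) v"
proof -
  have "r = p" if "r \<in> PS" "{v, u} \<in> pedges r" for r u
    using linear_forestD(5)[OF assms(1) that(1) assms(2), of v] assms(3) pedges_subset[OF that(2)] by blast
  then show ?thesis unfolding nbr_def linear_forestD(6)[OF assms(1)] using assms(2) by blast
qed

lemma degr_linear_forest:
  assumes "linear_forest M PS" "p \<in> PS" "v \<in> set p"
  shows "degr M v \<le> 2" "degr M v < 2 \<longleftrightarrow> v = hd p \<or> v = last p"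
  using degr_pedges[OF linear_forestD(3)[OF assms(1,2)], of v] nbr_linear_forest[OF assms]
    linear_forestD(2)[OF assms(1,2)] assms(3) by (fastforce simp: degr_def)+

lemma ex_path:
  assumes "linear_forest M PS" "v \<in> V"
  obtains p where "p \<in> PS" "v \<in> set p"
  using assms linear_forestD(4) by blast

lemma degr_linear_forest_le: "\<lbrakk>linear_forest M PS; v \<in> V\<rbrakk> \<Longrightarrow> degr M v \<le> 2"
  using ex_path degr_linear_forest(1) by metis

text \<open>Reversing the lists where necessary puts \<open>v\<close> last and \<open>u\<close>
  first, so that concatenation adds just the edge between them.\<close>

lemma join:
  assumes lf: "linear_forest M PS" and pr: "p \<in> PS" "r \<in> PS" "p \<noteq> r"
    and v: "v = hd p \<or> v = last p" and u: "u = hd r \<or> u = last r"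
  obtains p' r' where "p' = p \<or> p' = rev p" "r' = r \<or> r' = rev r" "last p' = v" "hd r' = u"
    "u \<in> V" "v \<in> V" "u \<noteq> v" "{u, v} \<notin> M"
    "linear_forest (insert {u, v} M) (insert (p' @ r') (PS - {p, r}))" "p' @ r' \<notin> PS - {p, r}"
proof -
  note D = linear_forestD[OF lf]
  obtain p' where p': "p' = p \<or> p' = rev p" "last p' = v" using v D(2)[OF pr(1)] by (metis last_rev)
  obtain r' where r': "r' = r \<or> r' = rev r" "hd r' = u" using u D(2)[OF pr(2)] by (metis hd_rev)
  have ne: "p' \<noteq> []" "r' \<noteq> []" using p' r' D(2)[OF pr(1)] D(2)[OF pr(2)] by auto
  have st: "set p' = set p" "set r' = set r" "distinct p'" "distinct r'"
    using p' r' D(3)[OF pr(1)] D(3)[OF pr(2)] by auto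
  have pe: "pedges p' = pedges p" "pedges r' = pedges r" using p' r' pedges_rev by auto
  have vu: "v \<in> set p" "u \<in> set r" using p'(2) r'(2) ne st by (metis last_in_set, metis hd_in_set)
  have dis: "set p \<inter> set r = {}" using D(5)[OF pr(1,2)] pr(3) by blast
  have uv: "u \<noteq> v" using vu dis by auto
  have V: "u \<in> V" "v \<in> V" using vu pr D(4) by auto
  have nM: "{u, v} \<notin> M"
  proof
    assume "{u, v} \<in> M"
    then obtain q where q: "q \<in> PS" "{u, v} \<in> pedges q" using D(6) by blast
    then have "u \<in> set q" "v \<in> set q" using pedges_subset by blast+
    then show False using D(5)[OF q(1) pr(1), of v] D(5)[OF q(1) pr(2), of u] vu pr(3) by blast
  qed
  have nin: "p' @ r' \<notin> PS - {p, r}"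
  proof
    assume a: "p' @ r' \<in> PS - {p, r}"
    then have "p' @ r' = p" using D(5)[of "p' @ r'" p v] pr vu st by auto
    then show False using a by blast
  qed
  have fM: "finite M" unfolding D(6) using D(1)
    by (intro finite_UN_I) (auto intro: finite_subset[of _ "Pow (set _)"] dest: pedges_subset)
  have "linear_forest (insert {u, v} M) (insert (p' @ r') (PS - {p, r}))"
    unfolding linear_forest_def
  proof (intro conjI ballI impI)
    show "finite (insert (p' @ r') (PS - {p, r}))" using D(1) by simp
    show "q \<noteq> []" "distinct q" if "q \<in> insert (p' @ r') (PS - {p, r})" for q
      using that D(2,3) ne st dis by auto
    show "(\<Union>p\<in>insert (p' @ r') (PS - {p, r}). set p) = V" using D(4) pr st by auto
    show "insert {u, v} M = (\<Union>q\<in>insert (p' @ r') (PS - {p, r}). pedges q)"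
    proof -
      have "(\<Union>q\<in>insert (p' @ r') (PS - {p, r}). pedges q) = insert {v, u} (pedges p \<union> pedges r \<union> (\<Union>q\<in>PS - {p, r}. pedges q))"
        using pedges_append[OF ne] p'(2) r'(2) pe by simp
      moreover have "M = pedges p \<union> pedges r \<union> (\<Union>q\<in>PS - {p, r}. pedges q)" using D(6) pr by auto
      ultimately show ?thesis by (simp add: insert_commute)
    qed
    have "card (PS - {p, r}) + 2 = card PS" using pr D(1) card_mono[of PS "{p, r}"] by (simp add: card_Diff_insert)
    then show "card (insert {u, v} M) + card (insert (p' @ r') (PS - {p, r})) = card V"
      using D(1,7) nM nin fM by simp
    fix q q' assume q: "q \<in> insert (p' @ r') (PS - {p, r})" "q' \<in> insert (p' @ r') (PS - {p, r})" "q \<noteq> q'"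
    have *: "set q \<inter> set (p' @ r') = {}" if "q \<in> PS - {p, r}" for q
      using D(5)[of q p] D(5)[of q r] that pr st by auto
    show "set q \<inter> set q' = {}" using q * D(5)[of q q'] by blast
  qed
  then show ?thesis using that[OF p'(1) r'(1) p'(2) r'(2) V uv nM _ nin] by blast
qed

lemma ex_head:
  assumes lf: "linear_forest M PS" and Q: "Q \<subseteq> PS" "m < card Q" and P: "finite P" "card P \<le> m"
  shows "\<exists>r\<in>Q. hd r \<notin> P"
proof (rule ccontr)
  assume "\<not> ?thesis"
  then have "hd ` Q \<subseteq> P" by blast
  moreover have "inj_on hd Q"
    using linear_forestD(5)[OF lf] linear_forestD(2)[OF lf] Q(1) by (intro inj_onI) (metis hd_in_set subsetD)
  ultimately have "card Q \<le> card P" using P(1) by (metis card_image card_mono)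
  then show False using Q P by simp
qed

section \<open>From isolated vertices to linearly many long paths\<close>

definition singles :: "'v list set \<Rightarrow> 'v list set" where
  "singles PS = {p\<in>PS. length p = 1}"

definition longer :: "'v list set \<Rightarrow> 'v list set" where
  "longer PS = {p\<in>PS. length p \<noteq> 1}"

lemma card_singles_longer: "finite PS \<Longrightarrow> card PS = card (singles PS) + card (longer PS)"
proof -
  assume "finite PS"
  moreover have "PS = singles PS \<union> longer PS" "singles PS \<inter> longer PS = {}" by (auto simp: singles_def longer_def)
  ultimately show ?thesis by (metis card_Un_disjoint finite_Un)
qed

lemma join_counts:
  assumes lf: "linear_forest M PS" and pr: "p \<in> PS" "r \<in> PS" "p \<noteq> r"
    and q: "q \<notin> PS - {p, r}" "2 \<le> length q"
  shows "card (singles PS) = card (singles (insert q (PS - {p, r}))) + of_bool (length p = 1) + of_bool (length r = 1)"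
    "card (longer PS) + 1 = card (longer (insert q (PS - {p, r}))) + of_bool (length p \<noteq> 1) + of_bool (length r \<noteq> 1)"
proof -
  let ?R = "PS - {p, r}"
  have fin: "finite PS" using linear_forestD(1)[OF lf] .
  have f: "finite (singles ?R)" "finite (longer ?R)" using fin by (auto simp: singles_def longer_def)
  have "singles PS = singles ?R \<union> (if length p = 1 then {p} else {}) \<union> (if length r = 1 then {r} else {})"
    using pr by (auto simp: singles_def)
  moreover have "singles (insert q ?R) = singles ?R" using q by (auto simp: singles_def)
  moreover have "p \<notin> singles ?R" "r \<notin> singles ?R" by (auto simp: singles_def)
  ultimately show "card (singles PS) = card (singles (insert q ?R)) + of_bool (length p = 1) + of_bool (length r = 1)"
    using f pr(3) by (auto simp: card_insert_if)
  have "longer PS = longer ?R \<union> (if length p \<noteq> 1 then {p} else {}) \<union> (if length r \<noteq> 1 then {r} else {})"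
    using pr by (auto simp: longer_def)
  moreover have "longer (insert q ?R) = insert q (longer ?R)" using q by (auto simp: longer_def)
  moreover have "p \<notin> longer ?R" "r \<notin> longer ?R" "q \<notin> longer ?R" using q by (auto simp: longer_def)
  ultimately show "card (longer PS) + 1 = card (longer (insert q ?R)) + of_bool (length p \<noteq> 1) + of_bool (length r \<noteq> 1)"
    using f pr(3) by (auto simp: card_insert_if)
qed

text \<open>The second branch guarantees that many paths remain when the last isolated vertex disappears.\<close>

definition path_stage :: "nat \<Rightarrow> nat \<Rightarrow> 'v list set \<Rightarrow> nat \<Rightarrow> bool" where
  "path_stage m0 \<mu> PS d \<longleftrightarrow> (if singles PS = {} then \<mu> \<le> card (longer PS)
     else card V \<le> 2 * card (longer PS) + max (card (singles PS)) m0 + 2 * d)"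

text \<open>While many isolated vertices remain, a regular move joins two of them, which creates one
  long path for two vertices. Once at most \<open>m + 2\<close> are left, one is joined to any path,
  and the number of long paths does not fall. A rescue costs at most one long path, which the term
  \<open>2 * d\<close> absorbs. Afterwards long paths are joined until exactly \<open>\<mu>\<close>
  remain.\<close>

lemma path_stage_wins:
  fixes Win :: "'v set set \<Rightarrow> bool"
  assumes goal: "\<And>M B d PS. \<lbrakk>linear_forest M PS; singles PS = {}; card PS = \<mu>; ctrl 2 L M B d\<rbrakk> \<Longrightarrow> mwins X Win N M B"
    and N: "N = card V + 1" and D: "2 * 2 * (N + 1) < D * (L + 1)" and m: "L + D + 1 \<le> m"
    and mu: "m < \<mu>" and big: "2 * \<mu> + m + 2 + 2 * D \<le> card V"
    and start: "linear_forest M PS" "path_stage (m + 2) \<mu> PS d" "ctrl 2 L M B d"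
  shows "mwins X Win N M B"
proof -
  define good where "good M d \<longleftrightarrow> (\<exists>PS. linear_forest M PS \<and> path_stage (m + 2) \<mu> PS d)" for M d
  define finished where "finished M \<longleftrightarrow> (\<exists>PS. linear_forest M PS \<and> singles PS = {} \<and> card PS = \<mu>)" for M
  have step: "\<exists>u\<in>V - P. u \<noteq> v \<and> {u, v} \<notin> M \<and> good (insert {u, v} M) d'"
    if lf: "linear_forest M PS" and ps: "path_stage (m + 2) \<mu> PS d" and nd: "singles PS = {} \<Longrightarrow> \<mu> < card (longer PS)"
      and p: "p \<in> PS" "v = hd p \<or> v = last p" and Q: "Q \<subseteq> PS - {p}" "m < card Q" and P: "finite P" "card P \<le> m"
      and d: "d \<le> d'" "d' \<le> D"
      and prog: "d' = Suc d \<or> singles PS = {} \<or> (length p = 1 \<and> (Q \<subseteq> singles PS \<or> card (singles PS) \<le> m + 2))"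
    for M PS d p v P Q d'
  proof -
    obtain r where r: "r \<in> Q" "hd r \<notin> P" using ex_head[OF lf _ Q(2) P] Q(1) by blast
    have rPS: "r \<in> PS" "p \<noteq> r" using r Q by auto
    obtain p' r' where j: "p' = p \<or> p' = rev p" "r' = r \<or> r' = rev r" "last p' = v" "hd r' = hd r" "hd r \<in> V" "v \<in> V" "hd r \<noteq> v" "{hd r, v} \<notin> M"
      "linear_forest (insert {hd r, v} M) (insert (p' @ r') (PS - {p, r}))" "p' @ r' \<notin> PS - {p, r}"
      by (rule join[OF lf p(1) rPS p(2) disjI1[OF refl]])
    have fin: "finite PS" using linear_forestD(1)[OF lf] .
    have "p \<noteq> []" "r \<noteq> []" using linear_forestD(2)[OF lf] p rPS by auto
    then have "length p \<noteq> 0" "length r \<noteq> 0" "length p' = length p" "length r' = length r" using j(1,2) by auto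
    then have l2: "2 \<le> length (p' @ r')" by (cases p; cases r) auto
    let ?PS = "insert (p' @ r') (PS - {p, r})"
    note cnt = join_counts[OF lf p(1) rPS j(10) l2]
    have fs: "finite (singles PS)" "finite (singles ?PS)" using fin by (auto simp: singles_def)
    have "path_stage (m + 2) \<mu> ?PS d'"
    proof (cases "singles PS = {}")
      case True
      have "length p \<noteq> 1" "length r \<noteq> 1" using True p rPS by (auto simp: singles_def)
      then have "singles ?PS = {}" "card (longer PS) = card (longer ?PS) + 1" using cnt True fs by auto
      then show ?thesis using nd[OF True] by (simp add: path_stage_def)
    next
      case False
      then have i: "card V \<le> 2 * card (longer PS) + max (card (singles PS)) (m + 2) + 2 * d"
        using ps by (simp add: path_stage_def)
      have "card V \<le> 2 * card (longer ?PS) + max (card (singles ?PS)) (m + 2) + 2 * d'"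
      proof (cases "d' = Suc d")
        case True
        then show ?thesis using cnt i by (auto simp: of_bool_def split: if_splits)
      next
        case F: False
        then have p1: "length p = 1" "Q \<subseteq> singles PS \<or> card (singles PS) \<le> m + 2" using prog False by auto
        show ?thesis
        proof (cases "length r = 1")
          case True
          then show ?thesis using cnt i p1 d by (auto simp: of_bool_def split: if_splits)
        next
          case nr: False
          then have "card (singles PS) \<le> m + 2" using p1(2) r(1) by (auto simp: singles_def)
          then show ?thesis using cnt i p1 d nr by (auto simp: of_bool_def split: if_splits)
        qed
      qed
      moreover have "\<mu> \<le> card (longer ?PS)" if "card V \<le> 2 * card (longer ?PS) + (m + 2) + 2 * d'"
        using that big d(2) by linarith
      ultimately show ?thesis by (auto simp: path_stage_def)
    qed
    then have "good (insert {hd r, v} M) d'" using j(9) by (auto simp: good_def)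
    then show ?thesis using j(5,7,8) r(2) by (intro bexI[of _ "hd r"]) auto
  qed
  have many: "m + 1 < card PS" if lf: "linear_forest M PS" and ps: "path_stage (m + 2) \<mu> PS d" and dD: "d < D"
    and nd: "singles PS = {} \<Longrightarrow> \<mu> < card (longer PS)" for M PS d
  proof -
    have c: "card PS = card (singles PS) + card (longer PS)" using card_singles_longer linear_forestD(1)[OF lf] by blast
    show ?thesis
    proof (cases "singles PS = {}")
      case True
      then show ?thesis using nd c mu by simp
    next
      case False
      then have "card V \<le> 2 * card (longer PS) + max (card (singles PS)) (m + 2) + 2 * d"
        using ps by (simp add: path_stage_def)
      then show ?thesis using c big mu dD by (simp add: max_def split: if_splits)
    qed
  qed
  have not_finished: "\<mu> < card (longer PS)" if "linear_forest M PS" "path_stage (m + 2) \<mu> PS d" "\<not> finished M" "singles PS = {}" for M PS d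
  proof -
    have "card PS = card (longer PS)" using card_singles_longer[of PS] linear_forestD(1)[OF that(1)] that(4) by simp
    then have "card (longer PS) \<noteq> \<mu>" using that(1,3,4) unfolding finished_def by metis
    then show ?thesis using that(2,4) by (simp add: path_stage_def)
  qed
  show ?thesis
  proof (rule controlled_stage[where I = "\<lambda>M d. good M d \<and> \<not> finished M" and G = "\<lambda>M d. good M d \<and> finished M"
        and D = D and L = L and m = m and k = 2 and d = d])
    fix M d v
    assume "good M d \<and> \<not> finished M \<or> good M d \<and> finished M" "v \<in> V"
    then show "degr M v \<le> 2" using degr_linear_forest_le by (auto simp: good_def)
  next
    fix M d assume "good M d \<and> \<not> finished M"
    then obtain PS where "linear_forest M PS" by (auto simp: good_def)
    then show "card M < N" using linear_forestD(7) N by fastforce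
  next
    fix M d v and P :: "'v set"
    assume I: "good M d \<and> \<not> finished M" and dD: "d < D" and v: "v \<in> V" "degr M v < 2"
      and P: "finite P" "card P \<le> m"
    obtain PS where PS: "linear_forest M PS" "path_stage (m + 2) \<mu> PS d" using I by (auto simp: good_def)
    obtain p where p: "p \<in> PS" "v \<in> set p" using ex_path[OF PS(1) v(1)] .
    have e: "v = hd p \<or> v = last p" using degr_linear_forest(2)[OF PS(1) p] v(2) by blast
    note nd = not_finished[OF PS conjunct2[OF I]]
    have "m < card (PS - {p})" using many[OF PS dD nd] p linear_forestD(1)[OF PS(1)] by simp
    then have "\<exists>u\<in>V - P. u \<noteq> v \<and> {u, v} \<notin> M \<and> good (insert {u, v} M) (Suc d)"
      using step[OF PS nd p(1) e order_refl _ P, of "Suc d"] dD by simp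
    then show "\<exists>u\<in>V - P. u \<noteq> v \<and> {u, v} \<notin> M \<and> (good (insert {u, v} M) (Suc d) \<and> \<not> finished (insert {u, v} M) \<or>
      good (insert {u, v} M) (Suc d) \<and> finished (insert {u, v} M))" by blast
  next
    fix M d assume I: "good M d \<and> \<not> finished M" and dD: "d < D"
    obtain PS where PS: "linear_forest M PS" "path_stage (m + 2) \<mu> PS d" using I by (auto simp: good_def)
    note nd = not_finished[OF PS conjunct2[OF I]]
    note mn = many[OF PS dD nd]
    have fin: "finite PS" using linear_forestD(1)[OF PS(1)] .
    obtain p Q where pQ: "p \<in> PS" "Q \<subseteq> PS - {p}" "m < card Q"
      "singles PS = {} \<or> (length p = 1 \<and> (Q \<subseteq> singles PS \<or> card (singles PS) \<le> m + 2))"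
    proof (cases "singles PS = {}")
      case True
      have "PS \<noteq> {}" using mn by auto
      then obtain p where "p \<in> PS" by blast
      then show ?thesis using that[of p "PS - {p}"] mn fin True by simp
    next
      case False
      then obtain p where p: "p \<in> singles PS" by blast
      then have p': "p \<in> PS" "length p = 1" by (auto simp: singles_def)
      show ?thesis
      proof (cases "card (singles PS) \<le> m + 2")
        case True
        then show ?thesis using that[of p "PS - {p}"] mn fin p' by simp
      next
        case False
        have "finite (singles PS)" using fin by (simp add: singles_def)
        then have "m < card (singles PS - {p})" using False p by simp
        then show ?thesis using that[of p "singles PS - {p}"] p' by (auto simp: singles_def)
      qed
    qed
    have pV: "hd p \<in> V" "hd p \<in> set p" using pQ(1) linear_forestD(2,4)[OF PS(1)] by force+
    have "degr M (hd p) < 2" using degr_linear_forest(2)[OF PS(1) pQ(1) pV(2)] by blast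
    moreover have "\<exists>u\<in>V - P. u \<noteq> hd p \<and> {u, hd p} \<notin> M \<and> good (insert {u, hd p} M) d" if "finite P" "card P \<le> m" for P
      using step[OF PS nd pQ(1) _ pQ(2,3) that, of "hd p" d] dD pQ(4) by auto
    ultimately show "\<exists>v\<in>V. degr M v < 2 \<and> (\<forall>P. finite P \<and> card P \<le> m \<longrightarrow> (\<exists>u\<in>V - P. u \<noteq> v \<and> {u, v} \<notin> M \<and>
      (good (insert {u, v} M) d \<and> \<not> finished (insert {u, v} M) \<or> good (insert {u, v} M) d \<and> finished (insert {u, v} M))))"
      using pV(1) by blast
  next
    fix M B d assume "good M d \<and> finished M" "ctrl 2 L M B d"
    then show "mwins X Win N M B" using goal by (auto simp: finished_def)
  qed (use D m start in \<open>auto simp: good_def\<close>)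
qed

text \<open>
  Deleting a vertex of the Hamiltonian path \<open>p\<close> leaves at most two segments; as \<open>b < a\<close>, one of
  the two chords joins them.
\<close>

lemma path_with_crossing_chords:
  assumes p: "distinct p" "set p = V" and ab: "0 < b" "b < a" "a < length p - 1"
    and M: "pedges p \<subseteq> M" "{p ! 0, p ! a} \<in> M" "{p ! (length p - 1), p ! b} \<in> M"
  shows "vertex_connected 2 V M"
proof -
  define n where "n = length p"
  have n: "card V = n" using p distinct_card n_def by fastforce
  have "connected_graph (V - S) {e \<in> M. e \<inter> S = {}}" if S: "S \<subseteq> V" "card S < 2" for S
  proof -
    define R where "R = {(x, y). {x, y} \<in> {e \<in> M. e \<inter> S = {}}}"
    have fS: "finite S" using S finV finite_subset by blast
    have "sym (R\<^sup>*)" by (rule sym_rtrancl) (auto simp: R_def sym_def insert_commute)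
    then have sR: "(x, y) \<in> R\<^sup>* \<longleftrightarrow> (y, x) \<in> R\<^sup>*" for x y by (meson symD)
    have "0 < n" using ab n_def by linarith
    obtain c where c: "c < n" "S \<subseteq> {p ! c}"
    proof (cases "S = {}")
      case True
      then show ?thesis using that[of 0] \<open>0 < n\<close> by simp
    next
      case False
      then have "card S = 1" using S fS by (metis card_0_eq less_2_cases One_nat_def)
      then obtain x where x: "S = {x}" by (meson card_1_singletonE)
      then have "x \<in> set p" using S p by auto
      then show ?thesis using that x by (auto simp: in_set_conv_nth n_def)
    qed
    have nS: "p ! i \<notin> S" if "i < n" "i \<noteq> c" for i
      using c that nth_eq_iff_index_eq[OF p(1), of i c] by (auto simp: n_def)
    have edge: "(p ! i, p ! j) \<in> R" if "{p ! i, p ! j} \<in> M" "p ! i \<notin> S" "p ! j \<notin> S" for i j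
      using that by (auto simp: R_def)
    have chain: "(p ! i, p ! j) \<in> R\<^sup>*" if "i \<le> j" "j < n" "\<And>l. i \<le> l \<Longrightarrow> l \<le> j \<Longrightarrow> p ! l \<notin> S" for i j
      using that
    proof (induction j rule: dec_induct)
      case (step j)
      have "{p ! j, p ! Suc j} \<in> M" using M(1) pedges_nth[of j p] step by (auto simp: n_def)
      then have "(p ! j, p ! Suc j) \<in> R" using step by (intro edge) auto
      moreover have "(p ! i, p ! j) \<in> R\<^sup>*" using step by auto
      ultimately show ?case by (rule rtrancl_into_rtrancl[rotated])
    qed simp
    have left: "(p ! 0, p ! i) \<in> R\<^sup>*" if "i < c" for i
      using that c(1) nS by (intro chain) auto
    have right: "(p ! i, p ! (n - 1)) \<in> R\<^sup>*" if "c < i" "i < n" for i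
      using that nS by (intro chain) auto
    \<comment> \<open>If \<open>c < a\<close>, the chord at \<open>p ! 0\<close> passes over
      \<open>c\<close>; otherwise \<open>b < a \<le> c\<close>, and the chord at the last vertex
      does.\<close>
    have mid: "(p ! 0, p ! (n - 1)) \<in> R\<^sup>*" if c: "0 < c" "c < n - 1"
    proof (cases "c < a")
      case True
      have "(p ! 0, p ! a) \<in> R" using M(2) nS[OF \<open>0 < n\<close>] nS[of a] c ab True n_def by (intro edge) auto
      moreover have "(p ! a, p ! (n - 1)) \<in> R\<^sup>*" using True ab n_def by (intro right) auto
      ultimately show ?thesis by (rule converse_rtrancl_into_rtrancl)
    next
      case False
      have "n - 1 < n" using \<open>0 < n\<close> by simp
      then have "(p ! b, p ! (n - 1)) \<in> R" using M(3) nS[of b] nS[of "n - 1"] c ab False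
        by (intro edge) (auto simp: insert_commute n_def)
      moreover have "(p ! 0, p ! b) \<in> R\<^sup>*" using False ab n_def by (intro left) auto
      ultimately show ?thesis by (rule rtrancl_into_rtrancl[rotated])
    qed
    define root where "root = (if c = n - 1 then p ! 0 else p ! (n - 1))"
    have reach: "(x, root) \<in> R\<^sup>*" if x: "x \<in> V - S" for x
    proof -
      obtain i where i: "i < n" "x = p ! i" using x p(2) by (auto simp: in_set_conv_nth n_def)
      consider "S = {}" | "i \<noteq> c" using i x c by fastforce
      then show ?thesis
      proof cases
        case 1
        have "(p ! 0, x) \<in> R\<^sup>*" "(x, p ! (n - 1)) \<in> R\<^sup>*" using i 1 by (auto intro!: chain)
        then show ?thesis unfolding root_def using sR by auto
      next
        case 2
        show ?thesis
        proof (cases "c < i")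
          case True
          then have "c \<noteq> n - 1" using i(1) by simp
          then show ?thesis using right[OF True i(1)] i by (simp add: root_def)
        next
          case False
          then have l: "(x, p ! 0) \<in> R\<^sup>*" using 2 left[of i] i sR by simp
          show ?thesis
          proof (cases "c = n - 1")
            case True
            then show ?thesis using l by (simp add: root_def)
          next
            case F: False
            have "0 < c" "c < n - 1" using F False 2 c(1) by auto
            then show ?thesis using l mid F unfolding root_def by (simp add: rtrancl_trans)
          qed
        qed
      qed
    qed
    have "V - S \<noteq> {}"
    proof
      assume "V - S = {}"
      then have "card V \<le> card S" using fS by (intro card_mono) auto
      then show False using S n ab n_def by simp
    qed
    moreover have "(x, y) \<in> R\<^sup>*" if "x \<in> V - S" "y \<in> V - S" for x y
      using reach[OF that(1)] reach[OF that(2)] sR rtrancl_trans by metis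
    ultimately show ?thesis unfolding connected_graph_def R_def by blast
  qed
  then show ?thesis unfolding vertex_connected_def using n ab n_def by auto
qed

section \<open>Completing a Hamiltonian path\<close>

lemma ex_index:
  assumes "distinct p" "finite P" "card P < h - l" "h \<le> length p"
  shows "\<exists>i. l \<le> i \<and> i < h \<and> p ! i \<notin> P"
proof (rule ccontr)
  assume a: "\<not> ?thesis"
  have "inj_on ((!) p) {l..<h}" using assms by (auto simp: inj_on_def nth_eq_iff_index_eq)
  then have "card {l..<h} \<le> card P" by (rule card_inj_on_le) (use a assms in auto)
  then show False using assms by simp
qed

lemma chord_not_in_path:
  assumes "distinct p" "i < length p" "j < length p" "Suc i < j"
  shows "{p ! i, p ! j} \<notin> pedges p" "{p ! j, p ! i} \<notin> pedges p"
proof -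
  show "{p ! i, p ! j} \<notin> pedges p"
  proof
    assume "{p ! i, p ! j} \<in> pedges p"
    then obtain l where "Suc l < length p" "{p ! i, p ! j} = {p ! l, p ! Suc l}" by (rule pedgesE)
    then show False using assms by (auto simp: doubleton_eq_iff nth_eq_iff_index_eq)
  qed
  then show "{p ! j, p ! i} \<notin> pedges p" by (simp add: insert_commute)
qed

text \<open>Taking \<open>a\<close> in the upper half and \<open>b\<close> in the lower half makes
  the chords cross whichever indices Breaker has left free. The second chord has to cope with one
  more Breaker edge. The path has \<open>card V - 1\<close> edges, so the two chords use up the
  budget exactly.\<close>

lemma hamiltonian_path_wins:
  fixes Win :: "'v set set \<Rightarrow> bool"
  assumes win: "\<And>M. \<lbrakk>M \<subseteq> X; vertex_connected 2 V M\<rbrakk> \<Longrightarrow> Win M"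
    and lf: "linear_forest M {p}" and N: "N = card V + 1" and MX: "M \<subseteq> X"
    and B: "B \<subseteq> X" "M \<inter> B = {}" and deg: "degr B (hd p) \<le> m" "degr B (last p) \<le> m"
    and big: "2 * m + 8 \<le> card V"
  shows "mwins X Win N M B"
proof -
  note D = linear_forestD[OF lf]
  have p: "distinct p" "set p = V" "p \<noteq> []" using D(2-4) by auto
  define n where "n = length p"
  have n: "card V = n" using p distinct_card n_def by fastforce
  have M: "M = pedges p" "card M + 1 = n" using D(6,7) n by auto
  define x where "x = p ! 0"
  define y where "y = p ! (n - 1)"
  have xy: "hd p = x" "last p = y" using p(3) by (auto simp: x_def y_def n_def hd_conv_nth last_conv_nth)
  have inV: "p ! i \<in> V" if "i < n" for i using that p(2) n_def nth_mem by blast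
  define h where "h = n div 2"
  have h: "2 * h \<le> n" "n \<le> 2 * h + 1" unfolding h_def by presburger+
  have bn: "2 * m + 8 \<le> n" using big n by simp
  have neq: "p ! i \<noteq> p ! j" if "i < n" "j < n" "i \<noteq> j" for i j
    using that p(1) by (simp add: nth_eq_iff_index_eq n_def)
  obtain a where a: "h \<le> a" "a < n - 1" "p ! a \<notin> nbr B x"
  proof -
    have "card (nbr B x) < (n - 1) - h" using deg(1) xy h bn by (simp add: degr_def)
    then show ?thesis using ex_index[OF p(1) fin_nbr[OF B(1)], of x "n - 1" h] that n_def by auto
  qed
  let ?e = "{x, p ! a}"
  have eX: "?e \<in> X" unfolding X_edge x_def using inV[of 0] inV[of a] neq[of 0 a] a h bn by auto
  have eM: "?e \<notin> M" unfolding M(1) x_def using a h bn n_def by (intro chord_not_in_path(1)[OF p(1)]) auto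
  have eB: "?e \<notin> B" using a(3) by (simp add: nbr_def)
  have fM: "finite M" using finE[OF MX] .
  show ?thesis
  proof (rule mwins.move[of ?e])
    show "card M < N" using M(2) N n by simp
    fix f assume f: "f \<in> X" "f \<notin> insert ?e M" "f \<notin> B"
    have B'X: "insert f B \<subseteq> X" using f B by auto
    have dy: "degr (insert f B) y \<le> m + 1"
      using degr_insert_le_Suc[OF B(1) f(1), of y] deg(2) xy by simp
    obtain b where b: "1 \<le> b" "b < h" "p ! b \<notin> nbr (insert f B) y"
    proof -
      have "card (nbr (insert f B) y) < h - 1" using dy h bn by (simp add: degr_def)
      then show ?thesis using ex_index[OF p(1) fin_nbr[OF B'X], of y h 1] that n_def h by auto
    qed
    let ?g = "{y, p ! b}"
    have gX: "?g \<in> X" unfolding X_edge y_def using inV[of "n - 1"] inV[of b] neq[of "n - 1" b] b h bn by auto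
    have "?g \<notin> pedges p" unfolding y_def using b h bn n_def by (intro chord_not_in_path(2)[OF p(1)]) auto
    moreover have "?g \<noteq> ?e" unfolding x_def y_def using neq[of "n - 1" 0] neq[of "n - 1" a] a h bn
      by (auto simp: doubleton_eq_iff)
    ultimately have gM: "?g \<notin> insert ?e M" using M(1) by blast
    have gB: "?g \<notin> insert f B" using b(3) by (simp add: nbr_def)
    show "mwins X Win N (insert ?e M) (insert f B)"
    proof (rule mwins.move[of ?g])
      show "card (insert ?e M) < N" using M(2) N n eM fM by simp
      fix f'
      have "vertex_connected 2 V (insert ?g (insert ?e M))"
        by (rule path_with_crossing_chords[OF p(1,2), of b a])
          (use a b h M(1) in \<open>auto simp: x_def y_def n_def\<close>)
      then show "mwins X Win N (insert ?g (insert ?e M)) (insert f' (insert f B))"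
        using win gX eX MX by (intro mwins.won) auto
    qed (use gX gM gB in auto)
  qed (use eX eM eB in auto)
qed

section \<open>Pairing the ends of paths\<close>

definition ends :: "'v list set \<Rightarrow> 'v set" where
  "ends PS = (\<Union>p\<in>PS. {hd p, last p})"

definition path_system :: "'v set set \<Rightarrow> 'v set \<Rightarrow> bool" where
  "path_system M U \<longleftrightarrow> M \<subseteq> X \<and> (\<exists>PS. linear_forest M PS \<and> (\<forall>p\<in>PS. 2 \<le> length p) \<and> U = ends PS)"

lemma ends_eq:
  assumes "linear_forest M PS"
  shows "ends PS = {v\<in>V. degr M v < 2}"
proof -
  note D = linear_forestD[OF assms]
  have "hd p \<in> set p \<and> last p \<in> set p" if "p \<in> PS" for p using D(2)[OF that] by simp
  then show ?thesis
    unfolding ends_def using degr_linear_forest(2)[OF assms] D(4) by blast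
qed

lemma card_ends:
  assumes "linear_forest M PS" "\<forall>p\<in>PS. 2 \<le> length p"
  shows "card (ends PS) = 2 * card PS"
proof -
  note D = linear_forestD[OF assms(1)]
  have e: "hd p \<in> set p \<and> last p \<in> set p \<and> hd p \<noteq> last p" if "p \<in> PS" for p
  proof -
    have "p \<noteq> []" "distinct p" "2 \<le> length p" using D(2,3) assms(2) that by auto
    then show ?thesis by (auto simp: hd_conv_nth last_conv_nth nth_eq_iff_index_eq)
  qed
  have "card (ends PS) = (\<Sum>p\<in>PS. card {hd p, last p})" unfolding ends_def
  proof (rule card_UN_disjoint)
    show "\<forall>p\<in>PS. \<forall>r\<in>PS. p \<noteq> r \<longrightarrow> {hd p, last p} \<inter> {hd r, last r} = {}"
    proof (intro ballI impI)
      fix p r assume pr: "p \<in> PS" "r \<in> PS" "p \<noteq> r"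
      then have "set p \<inter> set r = {}" using D(5)[OF pr(1,2)] by blast
      moreover have "{hd p, last p} \<subseteq> set p" "{hd r, last r} \<subseteq> set r" using e pr by auto
      ultimately show "{hd p, last p} \<inter> {hd r, last r} = {}" by fast
    qed
  qed (use D(1) in auto)
  also have "\<dots> = (\<Sum>p\<in>PS. 2)" using e by (intro sum.cong) auto
  finally show ?thesis by simp
qed

text \<open>\<open>z\<close> is the other end of the path of \<open>x\<close>: joining these two
  would close a cycle.\<close>

lemma path_system_step:
  assumes J: "path_system M U" and x: "x \<in> U"
  shows "\<exists>z. \<forall>y\<in>U - {x, z}. {x, y} \<notin> M \<and> path_system (insert {x, y} M) (U - {x, y})"
proof -
  obtain PS where PS: "linear_forest M PS" "\<forall>p\<in>PS. 2 \<le> length p" "U = ends PS" and MX: "M \<subseteq> X"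
    using J by (auto simp: path_system_def)
  note D = linear_forestD[OF PS(1)]
  obtain p where p: "p \<in> PS" "x = hd p \<or> x = last p" using x PS(3) by (auto simp: ends_def)
  define z where "z = (if x = hd p then last p else hd p)"
  have "{x, y} \<notin> M \<and> path_system (insert {x, y} M) (U - {x, y})" if y: "y \<in> U - {x, z}" for y
  proof -
    obtain r where r: "r \<in> PS" "y = hd r \<or> y = last r" using y PS(3) by (auto simp: ends_def)
    have pr: "p \<noteq> r" using r p y by (auto simp: z_def split: if_splits)
    obtain p' r' where j: "p' = p \<or> p' = rev p" "r' = r \<or> r' = rev r" "last p' = x" "hd r' = y"
      "y \<in> V" "x \<in> V" "y \<noteq> x" "{y, x} \<notin> M"
      "linear_forest (insert {y, x} M) (insert (p' @ r') (PS - {p, r}))" "p' @ r' \<notin> PS - {p, r}"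
      by (rule join[OF PS(1) p(1) r(1) pr p(2) r(2)])
    let ?PS = "insert (p' @ r') (PS - {p, r})"
    have len: "\<forall>q\<in>?PS. 2 \<le> length q" using PS(2) p r j(1,2) by auto
    have "ends ?PS = U - {x, y}"
    proof -
      have dg: "degr (insert {y, x} M) v = degr M v + of_bool (v = y \<or> v = x)" for v
        by (rule degr_insert[OF MX j(7,8)])
      \<comment> \<open>Every path has an edge, so each end has degree exactly 1 and leaves the set
        of ends as soon as it is joined.\<close>
      have pos: "degr M v \<noteq> 0" if "v \<in> V" for v
      proof -
        obtain q where q: "q \<in> PS" "v \<in> set q" using ex_path[OF PS(1) \<open>v \<in> V\<close>] .
        obtain i where i: "i < length q" "v = q ! i" using q(2) by (auto simp: in_set_conv_nth)
        have "2 \<le> length q" using PS(2) q by blast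
        then have "\<exists>u. {v, u} \<in> pedges q"
        proof (cases "Suc i < length q")
          case True
          then show ?thesis using pedges_nth[OF True] i by blast
        next
          case False
          then obtain l where l: "i = Suc l" using i \<open>2 \<le> length q\<close> by (cases i) auto
          then have "{q ! i, q ! l} \<in> pedges q" using pedges_nth[of l q] i by (simp add: insert_commute)
          then show ?thesis using i by blast
        qed
        then have "nbr M v \<noteq> {}" using D(6) q by (auto simp: nbr_def)
        then show ?thesis using fin_nbr[OF MX] by (simp add: degr_def)
      qed
      have "degr (insert {y, x} M) v < 2 \<longleftrightarrow> degr M v < 2 \<and> v \<noteq> x \<and> v \<noteq> y" if "v \<in> V" for v
        using pos[OF that] by (cases "v = y \<or> v = x") (auto simp: dg)
      then show ?thesis
        unfolding ends_eq[OF j(9)] PS(3) ends_eq[OF PS(1)] by blast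
    qed
    then have "path_system (insert {y, x} M) (U - {x, y})"
      using j len MX unfolding path_system_def by (intro conjI exI[of _ ?PS]) (auto simp: X_edge)
    then show ?thesis using j(8) by (simp add: insert_commute)
  qed
  then show ?thesis by blast
qed

lemma path_system_unique: "\<lbrakk>path_system M U; path_system M U'\<rbrakk> \<Longrightarrow> U = U'"
  unfolding path_system_def using ends_eq by metis

lemma path_endgame_wins:
  fixes Win :: "'v set set \<Rightarrow> bool"
  assumes win: "\<And>M. \<lbrakk>M \<subseteq> X; vertex_connected 2 V M\<rbrakk> \<Longrightarrow> Win M" and N: "N = card V + 1"
    and lf: "linear_forest M PS" and len: "singles PS = {}" and mu: "card PS = \<mu>"
    and MB: "M \<subseteq> X" "B \<subseteq> X" "M \<inter> B = {}" "card B \<le> card M + 1" "\<And>v. \<lbrakk>v \<in> V; degr M v < 2\<rbrakk> \<Longrightarrow> degr B v \<le> m"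
    and c: "2 * card V \<le> c * (2 * \<mu>)" "8 * thr (8 * c + 8) c + 8 * c + 8 \<le> 2 * \<mu>" "4 * m + 12 \<le> 6 * \<mu>"
      "2 * (m + 2 * \<mu>) + 8 \<le> card V"
  shows "mwins X Win N M B"
proof -
  \<comment> \<open>The forbidden partner may depend on \<open>M\<close> only; this suffices because
    \<open>M\<close> determines \<open>U\<close> by \<open>path_system_unique\<close>.\<close>
  define \<pi> where "\<pi> M x = (SOME z. \<forall>U. path_system M U \<longrightarrow>
    (\<forall>y\<in>U - {x, z}. {x, y} \<notin> M \<and> path_system (insert {x, y} M) (U - {x, y})))" for M x
  have pi: "{x, y} \<notin> M \<and> path_system (insert {x, y} M) (U - {x, y})"
    if J: "path_system M U" "x \<in> U" "y \<in> U" "x \<noteq> y" "y \<noteq> \<pi> M x" for M U x y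
  proof -
    have "\<exists>z. \<forall>U. path_system M U \<longrightarrow>
      (\<forall>y\<in>U - {x, z}. {x, y} \<notin> M \<and> path_system (insert {x, y} M) (U - {x, y}))"
      using path_system_step[OF J(1,2)] path_system_unique[OF J(1)] by metis
    then have "\<forall>U. path_system M U \<longrightarrow>
      (\<forall>y\<in>U - {x, \<pi> M x}. {x, y} \<notin> M \<and> path_system (insert {x, y} M) (U - {x, y}))"
      unfolding \<pi>_def by (rule someI_ex)
    then show ?thesis using J by blast
  qed
  define mm where "mm = m + 2 * \<mu>"
  \<comment> \<open>Ends come in pairs. This rules out three remaining vertices, where a forbidden
    partner could not be afforded.\<close>
  have ev: "even (card U)" if "path_system M U" for M U
    using that card_ends by (auto simp: path_system_def)
  interpret P: pairing_game V Win N path_system \<pi> mm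
  proof
    fix M U assume "path_system M U"
    then show "U \<subseteq> V \<and> M \<subseteq> X" using ends_eq by (auto simp: path_system_def)
  next
    fix M U assume "path_system M U" "3 \<le> card U"
    then show "card M < N" using linear_forestD(7) N by (fastforce simp: path_system_def)
  next
    fix M U x y assume "path_system M U" "3 \<le> card U" "x \<in> U" "y \<in> U" "x \<noteq> y" "y \<noteq> \<pi> M x"
    then show "{x, y} \<notin> M \<and> path_system (insert {x, y} M) (U - {x, y})" by (intro pi)
  next
    fix M U x assume "path_system M U" "card U = 3" "x \<in> U"
    then show "\<pi> M x \<notin> U - {x}" using ev[of M U] by simp
  next
    fix M U B assume J: "path_system M U" "card U \<le> 2" and B: "B \<subseteq> X" "M \<inter> B = {}" "\<forall>v\<in>U. degr B v + card U \<le> mm"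
    obtain PS where PS: "linear_forest M PS" "\<forall>p\<in>PS. 2 \<le> length p" "U = ends PS" and MX: "M \<subseteq> X"
      using J by (auto simp: path_system_def)
    note D = linear_forestD[OF PS(1)]
    have "card PS \<le> 1" using card_ends[OF PS(1,2)] J(2) PS(3) by simp
    moreover have "PS \<noteq> {}" using D(4) c(4) by auto
    ultimately have "card PS = 1" using D(1) by (simp add: card_gt_0_iff le_antisym Suc_leI)
    then obtain p where p: "PS = {p}" by (meson card_1_singletonE)
    have "degr B (hd p) \<le> mm" "degr B (last p) \<le> mm" using B(3) PS(3) p by (auto simp: ends_def)
    then show "mwins X Win N M B"
      using hamiltonian_path_wins[OF win PS(1)[unfolded p] N MX B(1,2)] c(4) by (simp add: mm_def)
  qed
  have l2: "\<forall>p\<in>PS. 2 \<le> length p"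
  proof
    fix p assume "p \<in> PS"
    then have "length p \<noteq> 1" "p \<noteq> []" using len linear_forestD(2)[OF lf] by (auto simp: singles_def)
    then show "2 \<le> length p" by (cases p) (auto simp: Suc_le_eq)
  qed
  have cU: "card (ends PS) = 2 * \<mu>" using card_ends[OF lf l2] mu by simp
  show ?thesis
  proof (rule P.cleanup[where U = "ends PS" and c = c])
    show "P.ok M B (ends PS)" unfolding P.ok_def
    proof (intro conjI ballI)
      show "path_system M (ends PS)" using MB lf l2 by (auto simp: path_system_def)
      fix v assume "v \<in> ends PS"
      then show "degr B v + card (ends PS) \<le> mm" using MB(5)[of v] cU ends_eq[OF lf] by (simp add: mm_def)
    qed (use MB in auto)
    have "ec B (ends PS) (ends PS) \<le> ec B V V" by (rule ec_mono) (use finV ends_eq[OF lf] in auto)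
    also have "\<dots> = 2 * card B" using handshake[OF MB(2)] sum_degr[OF MB(2)] by simp
    also have "\<dots> \<le> 2 * card V"
    proof -
      have "0 < \<mu>" using c(3) by simp
      then show ?thesis using MB(4) linear_forestD(7)[OF lf] mu by linarith
    qed
    finally show "ec B (ends PS) (ends PS) \<le> c * card (ends PS)" using c(1) cU by simp
    show "4 * mm + 12 \<le> 7 * card (ends PS)" unfolding mm_def cU using c(3) by simp
    show "8 * thr (8 * c + 8) c + 8 * c + 8 \<le> card (ends PS)" using c(2) cU by simp
  qed
qed

theorem two_connected_wins:
  fixes Win :: "'v set set \<Rightarrow> bool"
  assumes win: "\<And>M. \<lbrakk>M \<subseteq> X; vertex_connected 2 V M\<rbrakk> \<Longrightarrow> Win M" and N: "N = card V + 1"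
    and q: "2 * 2 * (N + 1) < q * (q + 1)" "1 \<le> q"
    and big: "100 * q \<le> card V" "card V \<le> 200 * q" "thr (8 * c + 8) c + c + 1 \<le> q" "50 \<le> c"
    and B: "B \<subseteq> X" "card B \<le> 1"
  shows "mwins X Win N {} B"
proof (rule path_stage_wins[where L = q and D = q and m = "2 * q + 1" and \<mu> = "4 * q" and d = 0 and PS = "(\<lambda>v. [v]) ` V"])
  show "N = card V + 1" "2 * 2 * (N + 1) < q * (q + 1)" by fact+
  show "q + q + 1 \<le> 2 * q + 1" "2 * q + 1 < 4 * q" using q by auto
  show "2 * (4 * q) + (2 * q + 1) + 2 + 2 * q \<le> card V" using big q by simp
  have inj: "inj_on (\<lambda>v. [v]) V" by (simp add: inj_on_def)
  show "linear_forest {} ((\<lambda>v. [v]) ` V)"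
    using finV card_image[OF inj] by (auto simp: linear_forest_def)
  have "singles ((\<lambda>v. [v]) ` V) = (\<lambda>v. [v]) ` V" by (auto simp: singles_def)
  then show "path_stage (2 * q + 1 + 2) (4 * q) ((\<lambda>v. [v]) ` V) 0"
    using card_image[OF inj] big q by (auto simp: path_stage_def)
  show "ctrl 2 q {} B 0" using ctrl_start[OF B] .
next
  fix M B d PS
  assume a: "linear_forest M PS" "singles PS = {}" "card PS = 4 * q" and ct: "ctrl 2 q M B d"
  have "card M \<le> N" using linear_forestD(7)[OF a(1)] N by simp
  then have d: "d < q" using ctrl_bound[OF ct q(1)] by simp
  show "mwins X Win N M B"
  proof (rule path_endgame_wins[OF win N a, where m = "2 * q" and c = c])
    show "degr B v \<le> 2 * q" if "v \<in> V" "degr M v < 2" for v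
      using ct that d by (fastforce simp: ctrl_def)
    \<comment> \<open>There are \<open>8 * q\<close> ends for the \<open>4 * q\<close> paths, and
      \<open>2 * card V \<le> 400 * q\<close>; this is where \<open>50 \<le> c\<close> comes
      from.\<close>
    have "400 * q \<le> c * (8 * q)" using mult_le_mono1[OF big(4), of "8 * q"] by simp
    then have "2 * card V \<le> c * (8 * q)" using big(2) by linarith
    then show "2 * card V \<le> c * (2 * (4 * q))" by simp
  qed (use ct big q in \<open>auto simp: ctrl_def\<close>)
qed

end

theorem maker_wins_k_eq_2:
  "\<exists>n0. \<forall>n\<ge>n0. \<forall>p. maker_wins_within p (complete_edges {..<n}) (k_connected_family n 2) ((2 * n) div 2 + 1)"
proof -
  obtain c :: nat where c: "c = 50" by blast
  \<comment> \<open>The summand 1000 makes \<open>q = n div 100\<close> large enough for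
    \<open>4 * (n + 2) < q * (q + 1)\<close>; the rest is the size needed by
    \<open>cleanup\<close>.\<close>
  define T where "T = thr (8 * c + 8) c + c + 1 + 1000"
  have "maker_wins_within p (complete_edges {..<n}) (k_connected_family n 2) ((2 * n) div 2 + 1)"
    if n: "100 * T \<le> n" for n p
  proof (rule maker_wins_if_position_wins)
    show "2 * (2 * n div 2 + 1) + 1 < card (complete_edges {..<n})"
      using n by (intro board_large) (simp add: T_def)
    fix B assume B: "B \<subseteq> complete_edges {..<n}" "card B \<le> 1"
    interpret finite_graph "{..<n}" by unfold_locales simp
    define q where "q = n div 100"
    have q: "100 * q \<le> n" "n < 100 * q + 100" unfolding q_def by linarith+
    have "T \<le> q" using n unfolding q_def by linarith
    then have qT: "1000 \<le> q" "thr (8 * c + 8) c + c + 1 \<le> q" by (auto simp: T_def)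
    have "1000 * (q + 1) \<le> q * (q + 1)" using qT(1) by (rule mult_le_mono1)
    then have q2: "2 * 2 * (2 * n div 2 + 1 + 1) < q * (q + 1)" using q by simp
    show "mwins (complete_edges {..<n}) (\<lambda>M. \<exists>F\<in>k_connected_family n 2. F \<subseteq> M) (2 * n div 2 + 1) {} B"
    proof (rule two_connected_wins[OF _ _ q2 _ _ _ qT(2) _ B])
      show "\<exists>F\<in>k_connected_family n 2. F \<subseteq> M"
        if "M \<subseteq> complete_edges {..<n}" "vertex_connected 2 {..<n} M" for M
        using that by (auto simp: k_connected_family_def)
    qed (use q qT c in auto)
  qed
  then show ?thesis by blast
qed

theorem theorem1p1:
  fixes k :: nat
  assumes "k \<ge> 2"
  shows "\<exists>n0::nat. \<forall>n\<ge>n0. \<forall>p::player.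
    maker_wins_within p (complete_edges {..<n}) (k_connected_family n k) ((k * n) div 2 + 1)"
proof (cases "k = 2")
  case True
  then show ?thesis using maker_wins_k_eq_2 by simp
next
  case False
  then show ?thesis using assms by (intro maker_wins_k_ge_3) simp
qed

end
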